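(* Let $\nu>0$, let $\{c_n\}_{n\ge1}$ be real numbers and $\{k_n\}_{n\ge1}$ positive integers with $c_n,k_n\to+\infty$ and $c_n/k_n\to0$, let $r_n=[n/k_n]$, and let $v_n=u^{(\nu)}_{[n/c_n]}$ be levels satisfying $$nP(X_1\le v_n<X_2)-c_n\nu\to0 \qquad (n\to+\infty).$$ Suppose there exists a sequence of integers $\{l_n\}_{n\ge1}$ such that, for the levels $v_n$, $$k_n\left[\alpha_{n,l_n-2}+P\left(\widetilde N_n([0,l_n/n])>0\right)\right]\to0,$$ and suppose that $$E\left[\overline N_{r_n}^2\mathbf 1_{\{\widehat N_{r_n}>1\}}\right]=o(c_n/k_n),$$ $$E\left[(Z_j(v_n))^2\mathbf 1_{\{\widehat N_{r_n}>1\}}\right]=o(1)\quad\text{uniformly in } j=1,\ldots,r_n,$$ $$\sigma_n^2=E[(Z_1(v_n))^2]\to\sigma^2<+\infty,$$ and, for each $\epsilon>0$, $$E\left[(Z_1^*(v_n))^2\mathbf 1_{\{(Z_1^*(v_n))^2>\epsilon c_n\}}\right]\to0.$$ Then, with $\widehat\eta_n^*=\widehat N_n/\overline N_n$ and $\eta_n=E[\widehat N_n]/E[\overline N_n]$ (at the levels $v_n$), $$\sqrt{c_n}\,(\widehat\eta_n^*-\eta_n)\ \xrightarrow{d}\ \mathcal N\left(0,\ \frac{\eta}{\nu}(\eta^2\sigma^2-1)\right)\qquad(n\to+\infty),$$ the normal distribution with mean $0$ and variance $\frac{\eta}{\nu}(\eta^2\sigma^2-1)$.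
   Context: $\mathbf X=\{X_n\}_{n\ge1}$ is a stationary sequence of real random variables; $[x]$ is the integer part and $\mathbf 1_A$ the indicator of $A$. For a level $u$, there is an upcrossing of $u$ at $i$ if $X_i\le u<X_{i+1}$. For levels $\mathbf u=\{u_n\}$, $\widetilde N_n(B)=\sum_{i=1}^{n-1}\mathbf 1_{\{X_i\le u_n<X_{i+1}\}}\delta_{i/n}(B)$, $B\subset[0,1]$, where $\delta_a$ is unit mass at $a$; $\widetilde N_{i,j}$ is the number of upcrossings of $u_n$ at indices $i,\dots,j$ (and $0$ if $j<i$); in particular $\widetilde N_{i,i}=\mathbf 1_{\{X_i\le u_n<X_{i+1}\}}$. Mixing coefficients and condition $\Delta(\mathbf u)$: $\alpha_{n,l}=\max\{|P(A\cap B)-P(A)P(B)|: A\in\mathcal B_1^k(u_n),\,B\in\mathcal B_{k+l}^n(u_n),\,1\le k\le n-l\}$, where $\mathcal B_a^b(u_n)$ is the $\sigma$-field generated by the events $\{X_i\le u_n\}$, $a\le i\le b$. Condition $\Delta(\mathbf u)$ holds if $\alpha_{n,l_n}\to0$ for some $l_n=o(n)$. Condition $\widetilde D^{(3)}(\mathbf u)$: $\Delta(\mathbf u)$ holds and $nP(X_1\le u_n<X_2,\ \widetilde N_{3,3}=0,\ \widetilde N_{4,r'_n}>0)\to0$ for some $r'_n=[n/k'_n]$, where $k'_n$ are positive integers with $k'_n\to\infty$, $k'_nl_n/n\to0$, $k'_n\alpha_{n,l_n}\to0$. Upcrossings index: for each $\nu>0$ there are levels $\mathbf u^{(\nu)}=\{u_n^{(\nu)}\}$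 with $nP(X_1\le u_n^{(\nu)}<X_2)\to\nu$, and $P(\widetilde N_n([0,1])=0)\to e^{-\eta\nu}$ for these levels, with a constant $0\le\eta\le1$; then $\mathbf X$ has upcrossings index $\eta$. For levels $u_n$, let $Y_i=0$ if $\widetilde N_{i+2,i+2}=0$, and $Y_i=k\ge1$ if $X_{i+2}\le u_n<X_{i+3},\,X_{i+4}\le u_n<X_{i+5},\ldots,X_{i+2k}\le u_n<X_{i+2k+1}$ and $\widetilde N_{i+2k+2,i+2k+2}=0$. $Z_i(u_n)$ is the length $Y_i$ given the event $A_i=\{\widetilde N_{i,i}=0,\ X_{i+2}\le u_n<X_{i+3}\}$; that is, $P(Z_i(u_n)=k)=P(Y_i=k\mid A_i)$, $k\ge1$ (independent of $i$), and an expectation $E[g(Z_j(u_n))\mathbf 1_C]$ with $C$ an event determined by $\mathbf X$ means $E[g(Y_j)\mathbf 1_C\mid A_j]$. At the levels $v_n$ (that is, with $\widetilde N_n$, $\widetilde N_{i,j}$, $\alpha_{n,l}$, $Y_i$, $A_i$ and $Z_i(u_n)$ all taken with $u_n=v_n$): $\widehat N_n=\sum_{i=1}^{n-3}\mathbf 1_{A_i}$, $\overline N_n=\sum_{i=1}^{n-3}Y_i\mathbf 1_{A_i}$, and $\widehat N_{r_n}$, $\overline N_{r_n}$ are the same sums restricted to $i\le r_n$. $Z_1^*(v_n)$ is a random variable with the distribution of $Z_1(v_n)$. Standing assumptions: for each $\nu>0$, $\mathbf X$ satisfies $\widetilde D^{(3)}(\mathbf u^{(\nu)})$ and $P(X_3\le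 u_n^{(\nu)}<X_4,\ldots,X_{2j-1}\le u_n^{(\nu)}<X_{2j})\to0$ as $j\to\infty$; $\mathbf X$ has upcrossings index $\eta>0$; and $E[Z_1(v_n)]\to1/\eta$. *)

theory Defs
  imports "HOL-Probability.Probability"
begin

text \<open>
  A sequence X(1), X(2), ... of real random variables on M is modelled by a function on nat;
  the value at index 0 is never used. Counting statistics take a single real level u;
  a level sequence u(n) is passed as its value at n.
\<close>

definition stationary :: "'a measure \<Rightarrow> (nat \<Rightarrow> 'a \<Rightarrow> real) \<Rightarrow> bool" where
  "stationary M X \<longleftrightarrow> (\<forall>i\<ge>1. X i \<in> borel_measurable M) \<and>
     (\<forall>h m. distr M (\<Pi>\<^sub>M i\<in>{1..m}. borel) (\<lambda>\<omega>. \<lambda>i\<in>{1..m}. X (i + h) \<omega>) =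
            distr M (\<Pi>\<^sub>M i\<in>{1..m}. borel) (\<lambda>\<omega>. \<lambda>i\<in>{1..m}. X i \<omega>))"

definition upcrossing :: "(nat \<Rightarrow> 'a \<Rightarrow> real) \<Rightarrow> real \<Rightarrow> nat \<Rightarrow> 'a \<Rightarrow> bool" where
  "upcrossing X u i \<omega> \<longleftrightarrow> X i \<omega> \<le> u \<and> u < X (i + 1) \<omega>"

definition upcrossing_process ::
    "(nat \<Rightarrow> 'a \<Rightarrow> real) \<Rightarrow> real \<Rightarrow> nat \<Rightarrow> real set \<Rightarrow> 'a \<Rightarrow> nat" where
  "upcrossing_process X u n B \<omega> =
     (\<Sum>i=1..n-1. of_bool (upcrossing X u i \<omega>) * indicator B (real i / real n))"

definition upcrossing_count ::
    "(nat \<Rightarrow> 'a \<Rightarrow> real) \<Rightarrow> real \<Rightarrow> nat \<Rightarrow> nat \<Rightarrow> 'a \<Rightarrow> nat" where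
  "upcrossing_count X u i j \<omega> = (\<Sum>m=i..j. of_bool (upcrossing X u m \<omega>))"

text \<open>
  The bounds of the index range and the gap l are integers, because the mixing coefficients
  are used with gap l(n) - 2 for an integer sequence l; only indices i at least 1 contribute.
\<close>

definition level_sigma_field ::
    "'a measure \<Rightarrow> (nat \<Rightarrow> 'a \<Rightarrow> real) \<Rightarrow> real \<Rightarrow> int \<Rightarrow> int \<Rightarrow> 'a set set" where
  "level_sigma_field M X u a b =
     sigma_sets (space M) {{\<omega> \<in> space M. X i \<omega> \<le> u} | i. 1 \<le> i \<and> a \<le> int i \<and> int i \<le> b}"

text \<open>
  The maximum is attained since the sigma-fields are finite; inserting 0 only matters when
  no k is admissible (l at least n), where the coefficient is taken to be 0.
\<close>

definition mixing_coeff ::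
    "'a measure \<Rightarrow> (nat \<Rightarrow> 'a \<Rightarrow> real) \<Rightarrow> real \<Rightarrow> nat \<Rightarrow> int \<Rightarrow> real" where
  "mixing_coeff M X u n l = Sup (insert 0
     {\<bar>measure M (A \<inter> B) - measure M A * measure M B\<bar> | A B k.
        1 \<le> k \<and> k \<le> int n - l \<and>
        A \<in> level_sigma_field M X u 1 k \<and> B \<in> level_sigma_field M X u (k + l) (int n)})"

definition Delta_with ::
    "'a measure \<Rightarrow> (nat \<Rightarrow> 'a \<Rightarrow> real) \<Rightarrow> (nat \<Rightarrow> real) \<Rightarrow> (nat \<Rightarrow> nat) \<Rightarrow> bool" where
  "Delta_with M X u l \<longleftrightarrow>
     (\<lambda>n. real (l n) / real n) \<longlonglongrightarrow> 0 \<and>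
     (\<lambda>n. mixing_coeff M X (u n) n (int (l n))) \<longlonglongrightarrow> 0"

definition D3_condition ::
    "'a measure \<Rightarrow> (nat \<Rightarrow> 'a \<Rightarrow> real) \<Rightarrow> (nat \<Rightarrow> real) \<Rightarrow> bool" where
  "D3_condition M X u \<longleftrightarrow> (\<exists>l k. Delta_with M X u l \<and>
     (\<forall>n\<ge>1. 0 < k n) \<and> filterlim k at_top sequentially \<and>
     (\<lambda>n. real (k n) * real (l n) / real n) \<longlonglongrightarrow> 0 \<and>
     (\<lambda>n. real (k n) * mixing_coeff M X (u n) n (int (l n))) \<longlonglongrightarrow> 0 \<and>
     (\<lambda>n. real n * measure M {\<omega> \<in> space M. upcrossing X (u n) 1 \<omega> \<and>
            upcrossing_count X (u n) 3 3 \<omega> = 0 \<and>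
            upcrossing_count X (u n) 4 (n div k n) \<omega> > 0}) \<longlonglongrightarrow> 0)"

text \<open>The index is stated relative to a given family of levels u, one sequence for each \<nu> > 0.\<close>

definition has_upcrossings_index ::
    "'a measure \<Rightarrow> (nat \<Rightarrow> 'a \<Rightarrow> real) \<Rightarrow> (real \<Rightarrow> nat \<Rightarrow> real) \<Rightarrow> real \<Rightarrow> bool" where
  "has_upcrossings_index M X u \<eta> \<longleftrightarrow> 0 \<le> \<eta> \<and> \<eta> \<le> 1 \<and>
     (\<forall>\<nu>>0.
        (\<lambda>n. real n * measure M {\<omega> \<in> space M. upcrossing X (u \<nu> n) 1 \<omega>}) \<longlonglongrightarrow> \<nu> \<and>
        (\<lambda>n. measure M {\<omega> \<in> space M. upcrossing_process X (u \<nu> n) n {0..1} \<omega> = 0})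
          \<longlonglongrightarrow> exp (- \<eta> * \<nu>))"

definition run_of_length ::
    "(nat \<Rightarrow> 'a \<Rightarrow> real) \<Rightarrow> real \<Rightarrow> nat \<Rightarrow> nat \<Rightarrow> 'a \<Rightarrow> bool" where
  "run_of_length X u i k \<omega> \<longleftrightarrow>
     (\<forall>m\<in>{1..k}. X (i + 2 * m) \<omega> \<le> u \<and> u < X (i + 2 * m + 1) \<omega>) \<and>
     upcrossing_count X u (i + 2 * k + 2) (i + 2 * k + 2) \<omega> = 0"

text \<open>
  At most one k satisfies the run condition, and k = 0 says that there is no upcrossing at i + 2.
  An infinite run, for which the length is undefined, gets the value 0; it has probability
  zero whenever the probability of j consecutive upcrossings vanishes as j grows.
\<close>

definition run_length :: "(nat \<Rightarrow> 'a \<Rightarrow> real) \<Rightarrow> real \<Rightarrow> nat \<Rightarrow> 'a \<Rightarrow> nat" where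
  "run_length X u i \<omega> =
     (if \<exists>k. run_of_length X u i k \<omega> then THE k. run_of_length X u i k \<omega> else 0)"

definition run_start :: "'a measure \<Rightarrow> (nat \<Rightarrow> 'a \<Rightarrow> real) \<Rightarrow> real \<Rightarrow> nat \<Rightarrow> 'a set" where
  "run_start M X u i =
     {\<omega> \<in> space M. upcrossing_count X u i i \<omega> = 0 \<and> X (i + 2) \<omega> \<le> u \<and> u < X (i + 3) \<omega>}"

text \<open>
  Conditioning on an event A is integration against \<^term>\<open>uniform_measure M A\<close>. All moments of
  run lengths are extended nonnegative numbers, so that their finiteness is not presupposed.
\<close>

definition Z_law :: "'a measure \<Rightarrow> (nat \<Rightarrow> 'a \<Rightarrow> real) \<Rightarrow> real \<Rightarrow> nat \<Rightarrow> nat measure" where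
  "Z_law M X u i = distr (uniform_measure M (run_start M X u i)) (count_space UNIV) (run_length X u i)"

definition Z_expectation_on ::
    "'a measure \<Rightarrow> (nat \<Rightarrow> 'a \<Rightarrow> real) \<Rightarrow> real \<Rightarrow> nat \<Rightarrow> (nat \<Rightarrow> ennreal) \<Rightarrow> 'a set \<Rightarrow> ennreal" where
  "Z_expectation_on M X u j g C =
     (\<integral>\<^sup>+\<omega>. g (run_length X u j \<omega>) * indicator C \<omega> \<partial>uniform_measure M (run_start M X u j))"

text \<open>Sums over i with i at most n - 3 and i at most r; the unrestricted sums are obtained for r = n.\<close>

definition N_hat ::
    "'a measure \<Rightarrow> (nat \<Rightarrow> 'a \<Rightarrow> real) \<Rightarrow> real \<Rightarrow> nat \<Rightarrow> nat \<Rightarrow> 'a \<Rightarrow> real" where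
  "N_hat M X u n r \<omega> = (\<Sum>i=1..min r (n - 3). indicator (run_start M X u i) \<omega>)"

definition N_bar ::
    "'a measure \<Rightarrow> (nat \<Rightarrow> 'a \<Rightarrow> real) \<Rightarrow> real \<Rightarrow> nat \<Rightarrow> nat \<Rightarrow> 'a \<Rightarrow> real" where
  "N_bar M X u n r \<omega> =
     (\<Sum>i=1..min r (n - 3). real (run_length X u i \<omega>) * indicator (run_start M X u i) \<omega>)"

text \<open>
  The normal law with mean m and variance V. Variance 0, which does occur as a limit, means
  the point mass at m; \<^const>\<open>normal_density\<close> with standard deviation 0 is identically 0.
\<close>

definition normal_law :: "real \<Rightarrow> real \<Rightarrow> real measure" where
  "normal_law m V =
     (if V = 0 then return borel m else density lborel (\<lambda>x. ennreal (normal_density m (sqrt V) x)))"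

end

theory Submission
  imports Defs
begin

text \<open>
Fix \<open>n\<close> and the level \<open>u = v n\<close>; let \<open>U\<close> be the probability of an upcrossing of \<open>u\<close> at 1 and \<open>p\<close>
the probability of the event \<open>A\<^sub>1\<close> that a run starts at 1. Put \<open>V\<^sub>i = Y\<^sub>i\<close> on \<open>A\<^sub>i\<close> and \<open>V\<^sub>i = 0\<close>
elsewhere. Then \<open>N_bar\<close> is the sum of the identically distributed \<open>V\<^sub>i\<close>, and \<open>N_hat\<close> almost surely
counts the positive ones. Each upcrossing belongs to exactly one run, so \<open>E V\<^sub>1 = U\<close> by telescoping
(\<open>nn_integral_cluster_size\<close>). Hence \<open>\<eta>\<^sub>n = p / U\<close>, the convergence of \<open>E Z\<^sub>1 = U / p\<close> gives
\<open>\<eta>\<^sub>n \<rightarrow> \<eta>\<close>, and among \<open>n\<close> indices there are about \<open>\<nu> c\<^sub>n\<close> upcrossings in \<open>\<eta> \<nu> c\<^sub>n\<close> clusters.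

\<^bold>\<open>Removing the quotient.\<close> If \<open>N_bar > 0\<close>, then \<open>sqrt c\<^sub>n (N_hat / N_bar - \<eta>\<^sub>n) \<le> x\<close> says that
\<open>T\<^sub>x = N_hat - (\<eta>\<^sub>n + x / sqrt c\<^sub>n) N_bar\<close> is not positive. So it suffices that, for each \<open>x\<close>,
\<open>T\<^sub>x / sqrt c\<^sub>n\<close> is asymptotically normal with mean \<open>- \<nu> x\<close> and variance
\<open>\<eta> \<nu> (\<eta>\<^sup>2 \<sigma>\<^sup>2 - 1)\<close>, and that \<open>N_bar > 0\<close> with probability tending to 1 (\<open>ratio_weak_conv\<close>).

\<^bold>\<open>One block.\<close> Cut the indices into \<open>k\<^sub>n\<close> blocks of length \<open>r\<^sub>n\<close>, and let \<open>S\<close> be the part of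
\<open>T\<^sub>x / sqrt c\<^sub>n\<close> that comes from one block. By the assumption on \<open>N_bar\<^sup>2\<close>, blocks with two or more
clusters contribute nothing in the limit; on the others the square of a sum is the sum of the
squares, so the second moment and the Lindeberg condition of \<open>S\<close> reduce to those of a single \<open>V\<^sub>1\<close>
(\<open>block_moments\<close>, \<open>block_limits\<close>). A second-order expansion of \<open>E exp (i t S)\<close> then shows that its
\<open>k\<^sub>n\<close>-th power converges to the normal characteristic function (\<open>block_clt\<close>).

\<^bold>\<open>Independence of the blocks.\<close> Leave a gap of \<open>L\<close> indices at the end of every block. A run visits
every second index, so it cannot cross a gap in which there is no upcrossing, and the probability
that any of the gaps contains one tends to 0. Outside that event the block sums are functions of the
\<open>r\<^sub>n - L + 3\<close> level indicators at the beginning of each block, and the mixing coefficient at distance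
\<open>L - 2\<close> compares the expectation of their product with the product of the expectations
(\<open>block_factorization\<close>, \<open>functional_factorization\<close>).

The scales fit together because the mixing hypothesis, applied to a single upcrossing, forces
\<open>k\<^sub>n U \<rightarrow> 0\<close>: hence \<open>r\<^sub>n\<close> and \<open>n / c\<^sub>n\<close> tend to infinity. The gaps are shorter than the blocks, since
the expected number of blocks containing a cluster is of order \<open>c\<^sub>n\<close>.
\<close>

section \<open>Characteristic functions of block sums and of a ratio\<close>

text \<open>
On the unit disc the \<open>k\<close>-th power is \<open>k\<close>-Lipschitz, so it is enough that \<open>\<phi> n\<close> and \<open>exp (z / k n)\<close>,
both of which lie in the disc, differ by \<open>o(1 / k n)\<close>.
\<close>

lemma power_tendsto_exp:
  fixes \<phi> :: "nat \<Rightarrow> complex" and k :: "nat \<Rightarrow> nat"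
  assumes k: "filterlim k at_top sequentially" and \<phi>: "\<And>n. norm (\<phi> n) \<le> 1"
    and z: "Re z \<le> 0" and lim: "(\<lambda>n. of_nat (k n) * (\<phi> n - 1)) \<longlonglongrightarrow> z"
  shows "(\<lambda>n. \<phi> n ^ k n) \<longlonglongrightarrow> exp z"
proof -
  have kr: "filterlim (\<lambda>n. real (k n)) at_top sequentially"
    by (rule filterlim_compose[OF filterlim_real_sequentially k])
  have pos: "\<forall>\<^sub>F n in sequentially. 0 < k n"
    using k by (auto simp: filterlim_at_top Suc_le_eq dest: spec[of _ 1])
  have "((\<lambda>h. exp (z * h)) has_field_derivative z) (at 0)"
    by (auto intro!: derivative_eq_intros)
  then have D: "((\<lambda>h. (exp (z * h) - 1) / h) \<longlongrightarrow> z) (at 0)"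
    by (simp add: DERIV_def)
  have "(\<lambda>n. inverse (of_nat (k n)) :: complex) \<longlonglongrightarrow> 0"
    by (rule filterlim_compose[OF lim_inverse_n k])
  then have "filterlim (\<lambda>n. inverse (of_nat (k n)) :: complex) (at 0) sequentially"
    unfolding filterlim_at using pos by (auto elim: eventually_mono)
  from filterlim_compose[OF D this]
  have E: "(\<lambda>n. of_nat (k n) * (exp (z / of_nat (k n)) - 1)) \<longlonglongrightarrow> z"
    by (simp add: divide_inverse mult.commute)
  have "(\<lambda>n. norm (of_nat (k n) * (\<phi> n - 1) - of_nat (k n) * (exp (z / of_nat (k n)) - 1))) \<longlonglongrightarrow> 0"
    using tendsto_norm[OF tendsto_diff[OF lim E]] by simp
  then have "(\<lambda>n. \<phi> n ^ k n - exp z) \<longlonglongrightarrow> 0"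
  proof (rule Lim_null_comparison[rotated], use pos in eventually_elim)
    case (elim n)
    have "norm (exp (z / of_nat (k n))) \<le> 1"
      using z elim by (simp add: norm_exp_eq_Re divide_nonpos_pos)
    moreover have "exp (z / of_nat (k n)) ^ k n = exp z"
      using elim by (simp add: exp_of_nat_mult[symmetric])
    ultimately have "norm (\<phi> n ^ k n - exp z) \<le> k n * norm (\<phi> n - exp (z / of_nat (k n)))"
      using norm_power_diff[OF \<phi>, of "exp (z / of_nat (k n))" n "k n"] by simp
    also have "\<dots> = norm (of_nat (k n) * (\<phi> n - exp (z / of_nat (k n))))"
      by (simp add: norm_mult)
    finally show ?case by (simp add: algebra_simps)
  qed
  then show ?thesis by (simp add: LIM_zero_iff)
qed

text \<open>
The cubic Taylor bound is used for \<open>\<bar>x\<bar> \<le> \<delta>\<close> and the quadratic one beyond.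
\<close>

lemma iexp_second_order:
  fixes x \<delta> :: real
  assumes "\<delta> \<ge> 0"
  shows "cmod (iexp (t * x) - (1 + \<i> * t * x - t\<^sup>2 * x\<^sup>2 / 2))
    \<le> t\<^sup>2 * (x\<^sup>2 * of_bool (x\<^sup>2 > \<delta>\<^sup>2)) + \<bar>t\<bar> ^ 3 * \<delta> * x\<^sup>2"
proof -
  define y where "y = t * x"
  have s: "(\<Sum>k\<le>2. (\<i> * complex_of_real y) ^ k / fact k) = 1 + \<i> * t * x - t\<^sup>2 * x\<^sup>2 / 2"
    by (simp add: y_def numeral_2_eq_2 power2_eq_square field_simps)
  show ?thesis
  proof (cases "x\<^sup>2 > \<delta>\<^sup>2")
    case True
    have "cmod (iexp y - (\<Sum>k\<le>2. (\<i> * complex_of_real y) ^ k / fact k)) \<le> y\<^sup>2"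
      using iexp_approx2[of y 2] by simp
    moreover have "0 \<le> \<bar>t\<bar> ^ 3 * \<delta> * x\<^sup>2" using assms by simp
    ultimately show ?thesis using True unfolding s by (simp add: y_def power_mult_distrib)
  next
    case False
    then have "\<bar>x\<bar> \<le> \<delta>" using assms by (metis abs_le_square_iff abs_of_nonneg linorder_not_le)
    have "cmod (iexp y - (\<Sum>k\<le>2. (\<i> * complex_of_real y) ^ k / fact k)) \<le> \<bar>y\<bar> ^ 3 / 6"
      using iexp_approx1[of y 2] by (simp add: numeral_3_eq_3 fact_numeral)
    also have "\<dots> \<le> \<bar>y\<bar> ^ 3" by simp
    also have "\<dots> = \<bar>t\<bar> ^ 3 * (\<bar>x\<bar> * \<bar>x\<bar>\<^sup>2)"
      unfolding y_def abs_mult power_mult_distrib by (simp add: power3_eq_cube power2_eq_square mult.assoc)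
    also have "\<dots> = \<bar>t\<bar> ^ 3 * \<bar>x\<bar> * x\<^sup>2"
      by simp
    also have "\<dots> \<le> \<bar>t\<bar> ^ 3 * \<delta> * x\<^sup>2"
      using \<open>\<bar>x\<bar> \<le> \<delta>\<close> by (intro mult_right_mono mult_left_mono) auto
    finally show ?thesis using False unfolding s by (simp add: y_def)
  qed
qed

text \<open>
Truncation at \<open>\<delta>\<close> leaves an error of order \<open>\<delta>\<close> times the second moments plus a Lindeberg
term that vanishes in the limit; then \<open>\<delta>\<close> is made small.
\<close>

lemma (in prob_space) char_tendsto_second_order:
  fixes S :: "nat \<Rightarrow> 'a \<Rightarrow> real" and k :: "nat \<Rightarrow> nat"
  assumes [measurable]: "\<And>n. S n \<in> borel_measurable M"
    and int: "\<forall>\<^sub>F n in sequentially. integrable M (\<lambda>\<omega>. (S n \<omega>)\<^sup>2)"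
    and m1: "(\<lambda>n. k n * expectation (S n)) \<longlonglongrightarrow> \<mu>"
    and m2: "(\<lambda>n. k n * expectation (\<lambda>\<omega>. (S n \<omega>)\<^sup>2)) \<longlonglongrightarrow> V"
    and lind: "\<And>\<epsilon>. \<epsilon> > 0 \<Longrightarrow>
      (\<lambda>n. k n * expectation (\<lambda>\<omega>. (S n \<omega>)\<^sup>2 * of_bool ((S n \<omega>)\<^sup>2 > \<epsilon>))) \<longlonglongrightarrow> 0"
  shows "(\<lambda>n. of_nat (k n) * ((CLINT \<omega>|M. iexp (t * S n \<omega>)) - 1)) \<longlonglongrightarrow> \<i> * t * \<mu> - t\<^sup>2 * V / 2"
proof -
  define D where "D n = (CLINT \<omega>|M. iexp (t * S n \<omega>)) -
     (1 + \<i> * t * expectation (S n) - t\<^sup>2 * expectation (\<lambda>\<omega>. (S n \<omega>)\<^sup>2) / 2)" for n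
  have bound: "\<forall>\<^sub>F n in sequentially. \<forall>\<delta>>0. k n * norm (D n) \<le>
      t\<^sup>2 * (k n * expectation (\<lambda>\<omega>. (S n \<omega>)\<^sup>2 * of_bool ((S n \<omega>)\<^sup>2 > \<delta>\<^sup>2)))
      + \<bar>t\<bar> ^ 3 * \<delta> * (k n * expectation (\<lambda>\<omega>. (S n \<omega>)\<^sup>2))"
    using int
  proof (eventually_elim, intro allI impI)
    case (elim n)
    fix \<delta> :: real assume "\<delta> > 0"
    note [simp] = elim
    have i1[simp]: "integrable M (S n)"
      by (rule square_integrable_imp_integrable) auto
    have i2[simp]: "integrable M (\<lambda>\<omega>. (S n \<omega>)\<^sup>2 * of_bool ((S n \<omega>)\<^sup>2 > \<delta>\<^sup>2))"
      by (rule Bochner_Integration.integrable_bound[OF elim]) auto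
    have i3: "integrable M (\<lambda>\<omega>. iexp (t * S n \<omega>))"
      by (rule integrable_const_bound[of _ 1]) auto
    have i1c: "integrable M (\<lambda>\<omega>. \<i> * t * complex_of_real (S n \<omega>))"
      by (intro integrable_mult_right integrable_of_real i1)
    have i2c: "integrable M (\<lambda>\<omega>. complex_of_real (t\<^sup>2 / 2) * complex_of_real ((S n \<omega>)\<^sup>2))"
      by (intro integrable_mult_right integrable_of_real elim)
    have e2: "(\<integral>\<omega>. complex_of_real (t\<^sup>2 / 2) * complex_of_real ((S n \<omega>)\<^sup>2) \<partial>M)
        = t\<^sup>2 * expectation (\<lambda>\<omega>. (S n \<omega>)\<^sup>2) / 2"
      by (subst integral_mult_right_zero, subst integral_complex_of_real) simp
    have e1: "(\<integral>\<omega>. \<i> * t * complex_of_real (S n \<omega>) \<partial>M) = \<i> * t * expectation (S n)"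
      by (subst integral_mult_right_zero, subst integral_complex_of_real) simp
    have "D n = (CLINT \<omega>|M. iexp (t * S n \<omega>) - (1 + \<i> * t * complex_of_real (S n \<omega>)
        - complex_of_real (t\<^sup>2 / 2) * complex_of_real ((S n \<omega>)\<^sup>2)))"
      unfolding D_def using i3 i1c i2c e1 e2 by (simp add: prob_space, metis)
    also have "norm \<dots> \<le> expectation (\<lambda>\<omega>. t\<^sup>2 * ((S n \<omega>)\<^sup>2 * of_bool ((S n \<omega>)\<^sup>2 > \<delta>\<^sup>2)) 
        + \<bar>t\<bar> ^ 3 * \<delta> * (S n \<omega>)\<^sup>2)"
    proof (rule order_trans[OF integral_norm_bound integral_mono])
      fix \<omega>
      show "norm (iexp (t * S n \<omega>) - (1 + \<i> * t * complex_of_real (S n \<omega>)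
        - complex_of_real (t\<^sup>2 / 2) * complex_of_real ((S n \<omega>)\<^sup>2)))
        \<le> t\<^sup>2 * ((S n \<omega>)\<^sup>2 * of_bool ((S n \<omega>)\<^sup>2 > \<delta>\<^sup>2)) + \<bar>t\<bar> ^ 3 * \<delta> * (S n \<omega>)\<^sup>2"
        using iexp_second_order[of \<delta> t "S n \<omega>"] \<open>\<delta> > 0\<close> by (simp add: mult_ac)
    qed (use i1c i2c i3 in auto)
    also have "\<dots> = t\<^sup>2 * expectation (\<lambda>\<omega>. (S n \<omega>)\<^sup>2 * of_bool ((S n \<omega>)\<^sup>2 > \<delta>\<^sup>2))
      + \<bar>t\<bar> ^ 3 * \<delta> * expectation (\<lambda>\<omega>. (S n \<omega>)\<^sup>2)"
      by simp
    finally have "k n * norm (D n) \<le> k n * \<dots>" by (intro mult_left_mono) auto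
    then show "k n * norm (D n) \<le>
      t\<^sup>2 * (k n * expectation (\<lambda>\<omega>. (S n \<omega>)\<^sup>2 * of_bool ((S n \<omega>)\<^sup>2 > \<delta>\<^sup>2)))
      + \<bar>t\<bar> ^ 3 * \<delta> * (k n * expectation (\<lambda>\<omega>. (S n \<omega>)\<^sup>2))"
      by (simp add: algebra_simps)
  qed
  have "(\<lambda>n. k n * norm (D n)) \<longlonglongrightarrow> 0"
  proof (rule order_tendstoI)
    fix e :: real assume "0 < e"
    define q where "q = \<bar>t\<bar> ^ 3 * (\<bar>V\<bar> + 1)"
    have "q \<ge> 0" by (simp add: q_def)
    define \<delta> where "\<delta> = e / (2 * (q + 1))"
    have \<delta>: "\<delta> > 0" using \<open>0 < e\<close> \<open>q \<ge> 0\<close> by (simp add: \<delta>_def)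
    have q\<delta>: "\<delta> * q < e / 2"
      using \<open>0 < e\<close> \<open>q \<ge> 0\<close> by (simp add: \<delta>_def field_simps)
    have "(\<lambda>n. t\<^sup>2 * (k n * expectation (\<lambda>\<omega>. (S n \<omega>)\<^sup>2 * of_bool ((S n \<omega>)\<^sup>2 > \<delta>\<^sup>2)))) \<longlonglongrightarrow> t\<^sup>2 * 0"
      using \<delta> by (intro tendsto_mult tendsto_const lind) simp
    then have "\<forall>\<^sub>F n in sequentially. t\<^sup>2 * (k n * expectation (\<lambda>\<omega>. (S n \<omega>)\<^sup>2 * of_bool ((S n \<omega>)\<^sup>2 > \<delta>\<^sup>2))) < e / 2"
      using \<open>0 < e\<close> by (intro order_tendstoD(2)) auto
    moreover have "\<forall>\<^sub>F n in sequentially. k n * expectation (\<lambda>\<omega>. (S n \<omega>)\<^sup>2) < \<bar>V\<bar> + 1"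
      by (rule order_tendstoD(2)[OF m2]) auto
    ultimately show "\<forall>\<^sub>F n in sequentially. k n * norm (D n) < e"
      using bound
    proof eventually_elim
      case (elim n)
      have "\<bar>t\<bar> ^ 3 * \<delta> * (k n * expectation (\<lambda>\<omega>. (S n \<omega>)\<^sup>2)) \<le> \<bar>t\<bar> ^ 3 * \<delta> * (\<bar>V\<bar> + 1)"
        using elim(2) \<delta> by (intro mult_left_mono) auto
      also have "\<dots> = \<delta> * q" by (simp add: q_def)
      finally show ?case using elim(1) elim(3)[rule_format, OF \<delta>] q\<delta> by linarith
    qed
  next
    fix e :: real assume "e < 0"
    have "e < k n * norm (D n)" for n
      by (rule less_le_trans[OF \<open>e < 0\<close>]) simp
    then show "\<forall>\<^sub>F n in sequentially. e < k n * norm (D n)" by simp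
  qed
  then have "(\<lambda>n. of_nat (k n) * D n) \<longlonglongrightarrow> 0"
    by (subst tendsto_norm_zero_iff[symmetric]) (simp add: norm_mult)
  moreover have "(\<lambda>n. \<i> * t * complex_of_real (k n * expectation (S n))
     - t\<^sup>2 * complex_of_real (k n * expectation (\<lambda>\<omega>. (S n \<omega>)\<^sup>2)) / 2) \<longlonglongrightarrow> \<i> * t * \<mu> - t\<^sup>2 * V / 2"
    by (rule tendsto_eq_rhs[OF tendsto_diff[OF tendsto_mult_left[OF tendsto_of_real[OF m1]]
          tendsto_divide[OF tendsto_mult_left[OF tendsto_of_real[OF m2]] tendsto_const]]]) simp_all
  ultimately have "(\<lambda>n. of_nat (k n) * D n + (\<i> * t * complex_of_real (k n * expectation (S n))
     - t\<^sup>2 * complex_of_real (k n * expectation (\<lambda>\<omega>. (S n \<omega>)\<^sup>2)) / 2)) \<longlonglongrightarrow> 0 + (\<i> * t * \<mu> - t\<^sup>2 * V / 2)"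
    by (intro tendsto_add)
  then show ?thesis by (simp add: D_def algebra_simps)
qed

text \<open>
This form covers variance 0 together with the nondegenerate case, which spares a case
distinction in everything that follows.
\<close>

lemma normal_law_eq_distr:
  assumes "V \<ge> 0"
  shows "normal_law m V = distr std_normal_distribution borel (\<lambda>x. m + sqrt V * x)"
proof -
  interpret N: real_distribution std_normal_distribution by (rule real_dist_normal_dist)
  show ?thesis
  proof (cases "V = 0")
    case True
    then show ?thesis by (simp add: normal_law_def N.distr_const)
  next
    case False
    have "distributed std_normal_distribution lborel (\<lambda>x. x) (normal_density 0 1)"
      by (auto simp: distributed_def distr_id2)
    from N.normal_density_affine[OF this, of "sqrt V" m] assms False
    have "distributed std_normal_distribution lborel (\<lambda>x. m + sqrt V * x) (normal_density m (sqrt V))"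
      by simp
    then have "distr std_normal_distribution lborel (\<lambda>x. m + sqrt V * x)
        = density lborel (normal_density m (sqrt V))"
      by (simp add: distributed_def)
    moreover have "distr std_normal_distribution borel (\<lambda>x. m + sqrt V * x)
        = distr std_normal_distribution lborel (\<lambda>x. m + sqrt V * x)"
      by (intro distr_cong) auto
    ultimately show ?thesis using False by (simp add: normal_law_def)
  qed
qed

lemma real_distribution_normal_law: "V \<ge> 0 \<Longrightarrow> real_distribution (normal_law m V)"
proof -
  assume "V \<ge> 0"
  interpret N: real_distribution std_normal_distribution by (rule real_dist_normal_dist)
  show ?thesis unfolding normal_law_eq_distr[OF \<open>V \<ge> 0\<close>] 
    by (rule N.real_distribution_distr) simp
qed

lemma char_normal_law:
  assumes "V \<ge> 0"
  shows "char (normal_law m V) t = exp (\<i> * t * m - t\<^sup>2 * V / 2)"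
proof -
  interpret N: real_distribution std_normal_distribution by (rule real_dist_normal_dist)
  have "char (normal_law m V) t = (CLINT x|std_normal_distribution. iexp (t * (m + sqrt V * x)))"
    unfolding char_def normal_law_eq_distr[OF assms] by (subst integral_distr) auto
  also have "\<dots> = (CLINT x|std_normal_distribution. iexp (t * m) * iexp (t * sqrt V * x))"
    by (simp add: exp_add[symmetric] algebra_simps)
  also have "\<dots> = iexp (t * m) * char std_normal_distribution (t * sqrt V)"
    by (simp add: char_def)
  also have "\<dots> = exp (\<i> * t * m - t\<^sup>2 * V / 2)"
    using assms by (simp add: char_std_normal_distribution exp_of_real[symmetric] exp_add[symmetric]
        power_mult_distrib mult_ac flip: of_real_power)
  finally show ?thesis .
qed

text \<open>
It is enough that the characteristic functions of \<open>R n\<close> are asymptotically the \<open>k n\<close>-th powers of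
those of \<open>S n\<close>; this admits sums of weakly dependent blocks.
\<close>

lemma (in prob_space) block_clt:
  fixes S R :: "nat \<Rightarrow> 'a \<Rightarrow> real" and k :: "nat \<Rightarrow> nat"
  assumes S: "\<And>n. S n \<in> borel_measurable M" and R: "\<And>n. R n \<in> borel_measurable M"
    and k: "filterlim k at_top sequentially"
    and int: "\<forall>\<^sub>F n in sequentially. integrable M (\<lambda>\<omega>. (S n \<omega>)\<^sup>2)"
    and m1: "(\<lambda>n. k n * expectation (S n)) \<longlonglongrightarrow> \<mu>"
    and m2: "(\<lambda>n. k n * expectation (\<lambda>\<omega>. (S n \<omega>)\<^sup>2)) \<longlonglongrightarrow> V"
    and lind: "\<And>\<epsilon>. \<epsilon> > 0 \<Longrightarrow>
      (\<lambda>n. k n * expectation (\<lambda>\<omega>. (S n \<omega>)\<^sup>2 * of_bool ((S n \<omega>)\<^sup>2 > \<epsilon>))) \<longlonglongrightarrow> 0"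
    and factor: "\<And>t. (\<lambda>n. (CLINT \<omega>|M. iexp (t * R n \<omega>)) - (CLINT \<omega>|M. iexp (t * S n \<omega>)) ^ k n) \<longlonglongrightarrow> 0"
  shows "weak_conv_m (\<lambda>n. distr M borel (R n)) (normal_law \<mu> V)"
proof -
  note [measurable] = S R
  have V: "V \<ge> 0" by (rule LIMSEQ_le_const[OF m2]) auto
  show ?thesis
  proof (rule levy_continuity)
    show "real_distribution (distr M borel (R n))" for n by (rule real_distribution_distr) simp
    show "real_distribution (normal_law \<mu> V)" by (rule real_distribution_normal_law[OF V])
    fix t
    have "(\<lambda>n. (CLINT \<omega>|M. iexp (t * S n \<omega>)) ^ k n) \<longlonglongrightarrow> exp (\<i> * t * \<mu> - t\<^sup>2 * V / 2)"
    proof (rule power_tendsto_exp[OF k])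
      fix n
      have "norm (CLINT \<omega>|M. iexp (t * S n \<omega>)) \<le> expectation (\<lambda>\<omega>. norm (iexp (t * S n \<omega>)))"
        by (rule integral_norm_bound)
      then show "norm (CLINT \<omega>|M. iexp (t * S n \<omega>)) \<le> 1" by (simp add: prob_space)
    qed (use V char_tendsto_second_order[OF S int m1 m2 lind] in \<open>auto simp flip: of_real_power\<close>)
    have char_distr: "char (distr M borel (R n)) t = (CLINT \<omega>|M. iexp (t * R n \<omega>))" for n
      unfolding char_def by (subst integral_distr) auto
    from tendsto_add[OF factor[of t] \<open>(\<lambda>n. _ ^ k n) \<longlonglongrightarrow> _\<close>]
    show "(\<lambda>n. char (distr M borel (R n)) t) \<longlonglongrightarrow> char (normal_law \<mu> V) t"
      by (simp add: char_normal_law[OF V] char_distr)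
  qed
qed

lemma measure_normal_law:
  assumes "V \<ge> 0" "B \<in> sets borel"
  shows "measure (normal_law m V) B = measure std_normal_distribution {x. m + sqrt V * x \<in> B}"
  unfolding normal_law_eq_distr[OF assms(1)] using assms(2)
  by (subst measure_distr) (auto simp: vimage_def)

text \<open>
For \<open>B > 0\<close> the ratio lies below a bound exactly if a linear combination of \<open>A\<close> and \<open>B\<close> is not
positive. This gives the distribution function of the ratio at \<open>x\<close> as that of the linear combination
at 0, and \<open>normal_law (- (\<nu> * x)) (\<nu>\<^sup>2 * V)\<close> has no atom at 0 if \<open>normal_law 0 V\<close> has none at \<open>x\<close>.
\<close>

lemma (in prob_space) ratio_weak_conv:
  fixes A B :: "nat \<Rightarrow> 'a \<Rightarrow> real" and a c :: "nat \<Rightarrow> real"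
  assumes [measurable]: "\<And>n. A n \<in> borel_measurable M" "\<And>n. B n \<in> borel_measurable M"
    and B0: "\<And>n \<omega>. B n \<omega> \<ge> 0" and c: "filterlim c at_top sequentially" and V: "V \<ge> 0" and \<nu>: "\<nu> > 0"
    and lim: "\<And>x. weak_conv_m (\<lambda>n. distr M borel (\<lambda>\<omega>. (A n \<omega> - (a n + x / sqrt (c n)) * B n \<omega>) / sqrt (c n)))
        (normal_law (- (\<nu> * x)) (\<nu>\<^sup>2 * V))"
    and zero: "(\<lambda>n. prob {\<omega> \<in> space M. B n \<omega> = 0}) \<longlonglongrightarrow> 0"
  shows "weak_conv_m (\<lambda>n. distr M borel (\<lambda>\<omega>. sqrt (c n) * (A n \<omega> / B n \<omega> - a n))) (normal_law 0 V)"
  unfolding weak_conv_m_def weak_conv_def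
proof (intro allI impI)
  fix x assume x: "isCont (cdf (normal_law 0 V)) x"
  let ?N = "normal_law (- (\<nu> * x)) (\<nu>\<^sup>2 * V)"
  interpret N0: real_distribution "normal_law 0 V" by (rule real_distribution_normal_law[OF V])
  interpret N1: real_distribution ?N using V by (intro real_distribution_normal_law) simp
  have s: "sqrt (\<nu>\<^sup>2 * V) = \<nu> * sqrt V" using \<nu> by (simp add: real_sqrt_mult)
  have eq: "- (\<nu> * x) + \<nu> * sqrt V * y = \<nu> * (sqrt V * y - x)" for y
    by (simp add: algebra_simps)
  have "measure ?N {0} = measure (normal_law 0 V) {x}"
    using V \<nu> by (simp add: measure_normal_law s eq)
  then have "isCont (cdf ?N) 0" using x by (simp add: N0.isCont_cdf N1.isCont_cdf)
  then have "(\<lambda>n. cdf (distr M borel (\<lambda>\<omega>. (A n \<omega> - (a n + x / sqrt (c n)) * B n \<omega>) / sqrt (c n))) 0) \<longlonglongrightarrow> cdf ?N 0"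
    using lim[of x] by (simp add: weak_conv_m_def weak_conv_def)
  moreover have "cdf ?N 0 = cdf (normal_law 0 V) x"
    using V \<nu> by (simp add: cdf_def measure_normal_law s eq mult_le_0_iff not_le)
  ultimately have L: "(\<lambda>n. prob {\<omega> \<in> space M. (A n \<omega> - (a n + x / sqrt (c n)) * B n \<omega>) / sqrt (c n) \<le> 0})
      \<longlonglongrightarrow> cdf (normal_law 0 V) x"
    by (simp add: cdf_def measure_distr vimage_def Int_def conj_commute)
  have "\<forall>\<^sub>F n in sequentially. c n > 0"
    using c by (simp add: filterlim_at_top_dense)
  then have D: "\<forall>\<^sub>F n in sequentially. norm (prob {\<omega> \<in> space M. sqrt (c n) * (A n \<omega> / B n \<omega> - a n) \<le> x}
     - prob {\<omega> \<in> space M. (A n \<omega> - (a n + x / sqrt (c n)) * B n \<omega>) / sqrt (c n) \<le> 0})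
     \<le> prob {\<omega> \<in> space M. B n \<omega> = 0}"
  proof eventually_elim
    case (elim n)
    let ?P = "{\<omega> \<in> space M. sqrt (c n) * (A n \<omega> / B n \<omega> - a n) \<le> x}"
    let ?Q = "{\<omega> \<in> space M. (A n \<omega> - (a n + x / sqrt (c n)) * B n \<omega>) / sqrt (c n) \<le> 0}"
    let ?Z = "{\<omega> \<in> space M. B n \<omega> = 0}"
    have *: "sqrt (c n) * (A n \<omega> / B n \<omega> - a n) \<le> x \<longleftrightarrow>
        (A n \<omega> - (a n + x / sqrt (c n)) * B n \<omega>) / sqrt (c n) \<le> 0" if "B n \<omega> \<noteq> 0" for \<omega>
    proof -
      have b: "B n \<omega> > 0" using B0[of n \<omega>] that by simp
      have "sqrt (c n) * (A n \<omega> / B n \<omega> - a n) \<le> x \<longleftrightarrow> A n \<omega> / B n \<omega> \<le> a n + x / sqrt (c n)"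
        using elim by (simp add: field_simps)
      also have "\<dots> \<longleftrightarrow> A n \<omega> - (a n + x / sqrt (c n)) * B n \<omega> \<le> 0"
        using b by (simp add: pos_divide_le_eq)
      also have "\<dots> \<longleftrightarrow> (A n \<omega> - (a n + x / sqrt (c n)) * B n \<omega>) / sqrt (c n) \<le> 0"
        using elim by (simp add: divide_le_0_iff)
      finally show ?thesis .
    qed
    have "prob ?P \<le> prob (?Q \<union> ?Z)" using * by (intro finite_measure_mono) auto
    also have "\<dots> \<le> prob ?Q + prob ?Z" by (intro measure_Un_le) auto
    finally have 1: "prob ?P \<le> prob ?Q + prob ?Z" .
    have "prob ?Q \<le> prob (?P \<union> ?Z)" using * by (intro finite_measure_mono) auto
    also have "\<dots> \<le> prob ?P + prob ?Z" by (intro measure_Un_le) auto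
    finally show ?case using 1 by simp
  qed
  have "(\<lambda>n. prob {\<omega> \<in> space M. sqrt (c n) * (A n \<omega> / B n \<omega> - a n) \<le> x}) \<longlonglongrightarrow> cdf (normal_law 0 V) x"
    using tendsto_add[OF Lim_null_comparison[OF D zero] L] by simp
  then show "(\<lambda>n. cdf (distr M borel (\<lambda>\<omega>. sqrt (c n) * (A n \<omega> / B n \<omega> - a n))) x) \<longlonglongrightarrow> cdf (normal_law 0 V) x"
    by (simp add: cdf_def measure_distr vimage_def Int_def conj_commute)
qed

section \<open>Level patterns, stationarity and mixing\<close>

text \<open>
The signs split each index set in two, hence the sum into four rectangle sums.
\<close>

lemma bilinear_bound_pm1:
  fixes \<delta> :: "'a \<Rightarrow> 'b \<Rightarrow> real"
  assumes fin: "finite A" "finite B"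
    and rect: "\<And>Q R. Q \<subseteq> A \<Longrightarrow> R \<subseteq> B \<Longrightarrow> \<bar>\<Sum>a\<in>Q. \<Sum>b\<in>R. \<delta> a b\<bar> \<le> \<alpha>"
    and s: "\<And>a. s a = 1 \<or> s a = -1" and t: "\<And>b. t b = 1 \<or> t b = -1"
  shows "\<bar>\<Sum>a\<in>A. \<Sum>b\<in>B. s a * t b * \<delta> a b\<bar> \<le> 4 * \<alpha>"
proof -
  let ?A = "{a\<in>A. s a = 1}" and ?A' = "{a\<in>A. s a \<noteq> 1}"
  let ?B = "{b\<in>B. t b = 1}" and ?B' = "{b\<in>B. t b \<noteq> 1}"
  have split_B: "(\<Sum>b\<in>B. t b * f b) = (\<Sum>b\<in>?B. f b) - (\<Sum>b\<in>?B'. f b)" for f :: "'b \<Rightarrow> real"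
  proof -
    have "(\<Sum>b\<in>B. t b * f b) = (\<Sum>b\<in>?B. t b * f b) + (\<Sum>b\<in>?B'. t b * f b)"
      using fin by (subst sum.union_disjoint[symmetric]) (auto intro!: sum.cong)
    also have "(\<Sum>b\<in>?B'. t b * f b) = (\<Sum>b\<in>?B'. - f b)"
      using t by (intro sum.cong) (auto, metis mult_minus1)
    finally show ?thesis by (simp add: sum_negf)
  qed
  have split_A: "(\<Sum>a\<in>A. s a * f a) = (\<Sum>a\<in>?A. f a) - (\<Sum>a\<in>?A'. f a)" for f :: "'a \<Rightarrow> real"
  proof -
    have "(\<Sum>a\<in>A. s a * f a) = (\<Sum>a\<in>?A. s a * f a) + (\<Sum>a\<in>?A'. s a * f a)"
      using fin by (subst sum.union_disjoint[symmetric]) (auto intro!: sum.cong)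
    also have "(\<Sum>a\<in>?A'. s a * f a) = (\<Sum>a\<in>?A'. - f a)"
      using s by (intro sum.cong) (auto, metis mult_minus1)
    finally show ?thesis by (simp add: sum_negf)
  qed
  have "(\<Sum>a\<in>A. \<Sum>b\<in>B. s a * t b * \<delta> a b) = (\<Sum>a\<in>A. s a * (\<Sum>b\<in>B. t b * \<delta> a b))"
    by (simp add: sum_distrib_left mult.assoc)
  also have "\<dots> = ((\<Sum>a\<in>?A. \<Sum>b\<in>?B. \<delta> a b) - (\<Sum>a\<in>?A. \<Sum>b\<in>?B'. \<delta> a b))
      - ((\<Sum>a\<in>?A'. \<Sum>b\<in>?B. \<delta> a b) - (\<Sum>a\<in>?A'. \<Sum>b\<in>?B'. \<delta> a b))"
    by (simp only: split_A split_B sum_subtractf)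
  also have "\<bar>\<dots>\<bar> \<le> 4 * \<alpha>"
    using rect[of ?A ?B] rect[of ?A ?B'] rect[of ?A' ?B] rect[of ?A' ?B'] by auto
  finally show ?thesis .
qed

text \<open>
For real coefficients in \<open>[-1, 1]\<close> the form is largest at coefficients \<open>1\<close> and \<open>-1\<close>, chosen first for
the rows and then for the columns; real and imaginary part of \<open>G\<close> are bounded separately.
\<close>

lemma bilinear_bound_complex:
  fixes \<delta> :: "'a \<Rightarrow> 'b \<Rightarrow> real" and F :: "'a \<Rightarrow> complex" and G :: "'b \<Rightarrow> complex"
  assumes fin: "finite A" "finite B"
    and rect: "\<And>Q R. Q \<subseteq> A \<Longrightarrow> R \<subseteq> B \<Longrightarrow> \<bar>\<Sum>a\<in>Q. \<Sum>b\<in>R. \<delta> a b\<bar> \<le> \<alpha>"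
    and F: "\<And>a. a \<in> A \<Longrightarrow> norm (F a) \<le> 1" and G: "\<And>b. b \<in> B \<Longrightarrow> norm (G b) \<le> 1"
  shows "norm (\<Sum>a\<in>A. \<Sum>b\<in>B. F a * G b * \<delta> a b) \<le> 8 * \<alpha>"
proof -
  define sg :: "real \<Rightarrow> real" where "sg x = (if x \<ge> 0 then 1 else - 1)" for x
  have sg: "sg x = 1 \<or> sg x = -1" "\<bar>x\<bar> = sg x * x" for x by (auto simp: sg_def)
  have real: "(\<Sum>a\<in>A. \<bar>\<Sum>b\<in>B. g b * \<delta> a b\<bar>) \<le> 4 * \<alpha>" if g: "\<And>b. b \<in> B \<Longrightarrow> \<bar>g b\<bar> \<le> 1" for g :: "'b \<Rightarrow> real"
  proof -
    \<comment> \<open>the signs of the row sums make them absolute values, and those of the resulting columns remove \<open>g\<close>\<close>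
    define s where "s a = sg (\<Sum>b\<in>B. g b * \<delta> a b)" for a
    define t where "t b = sg (\<Sum>a\<in>A. s a * \<delta> a b)" for b
    have "(\<Sum>a\<in>A. \<bar>\<Sum>b\<in>B. g b * \<delta> a b\<bar>) = (\<Sum>a\<in>A. \<Sum>b\<in>B. g b * (s a * \<delta> a b))"
      unfolding sg(2) s_def[symmetric] by (simp add: sum_distrib_left mult_ac)
    also have "\<dots> = (\<Sum>b\<in>B. g b * (\<Sum>a\<in>A. s a * \<delta> a b))"
      by (subst sum.swap) (simp add: sum_distrib_left)
    also have "\<dots> \<le> (\<Sum>b\<in>B. \<bar>\<Sum>a\<in>A. s a * \<delta> a b\<bar>)"
    proof (rule sum_mono)
      fix b assume "b \<in> B"
      have "g b * (\<Sum>a\<in>A. s a * \<delta> a b) \<le> \<bar>g b\<bar> * \<bar>\<Sum>a\<in>A. s a * \<delta> a b\<bar>"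
        by (metis abs_ge_self abs_mult)
      also have "\<dots> \<le> 1 * \<bar>\<Sum>a\<in>A. s a * \<delta> a b\<bar>"
        using g[OF \<open>b \<in> B\<close>] by (intro mult_right_mono) auto
      finally show "g b * (\<Sum>a\<in>A. s a * \<delta> a b) \<le> \<bar>\<Sum>a\<in>A. s a * \<delta> a b\<bar>" by simp
    qed
    also have "\<dots> = (\<Sum>a\<in>A. \<Sum>b\<in>B. s a * t b * \<delta> a b)"
      unfolding sg(2) t_def[symmetric]
      by (subst sum.swap) (simp add: sum_distrib_left mult_ac)
    also have "\<dots> \<le> \<bar>\<Sum>a\<in>A. \<Sum>b\<in>B. s a * t b * \<delta> a b\<bar>" by simp
    also have "\<dots> \<le> 4 * \<alpha>"
      by (rule bilinear_bound_pm1[OF fin rect]) (auto simp: s_def t_def sg)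
    finally show ?thesis .
  qed
  have "norm (\<Sum>a\<in>A. \<Sum>b\<in>B. F a * G b * \<delta> a b) = norm (\<Sum>a\<in>A. F a * (\<Sum>b\<in>B. G b * \<delta> a b))"
    by (simp add: sum_distrib_left mult.assoc)
  also have "\<dots> \<le> (\<Sum>a\<in>A. norm (F a * (\<Sum>b\<in>B. G b * \<delta> a b)))"
    by (rule norm_sum)
  also have "\<dots> \<le> (\<Sum>a\<in>A. \<bar>\<Sum>b\<in>B. Re (G b) * \<delta> a b\<bar> + \<bar>\<Sum>b\<in>B. Im (G b) * \<delta> a b\<bar>)"
  proof (rule sum_mono)
    fix a assume "a \<in> A"
    have "norm (F a * (\<Sum>b\<in>B. G b * \<delta> a b)) \<le> 1 * norm (\<Sum>b\<in>B. G b * \<delta> a b)"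
      unfolding norm_mult using F[OF \<open>a \<in> A\<close>] by (intro mult_right_mono) auto
    also have "\<dots> \<le> \<bar>Re (\<Sum>b\<in>B. G b * \<delta> a b)\<bar> + \<bar>Im (\<Sum>b\<in>B. G b * \<delta> a b)\<bar>"
      by (simp only: mult_1 cmod_le)
    finally show "norm (F a * (\<Sum>b\<in>B. G b * \<delta> a b))
        \<le> \<bar>\<Sum>b\<in>B. Re (G b) * \<delta> a b\<bar> + \<bar>\<Sum>b\<in>B. Im (G b) * \<delta> a b\<bar>" by simp
  qed
  also have "\<dots> \<le> 8 * \<alpha>"
    using real[of "\<lambda>b. Re (G b)"] real[of "\<lambda>b. Im (G b)"] G abs_Re_le_cmod abs_Im_le_cmod
    by (simp add: sum.distrib) (smt (verit, best))
  finally show ?thesis .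
qed

text \<open>
Patterns take finitely many values. Every function of a pattern is therefore measurable, and
stationarity becomes a statement about the law of one discrete random variable.
\<close>

definition pattern :: "(nat \<Rightarrow> 'a \<Rightarrow> real) \<Rightarrow> real \<Rightarrow> nat \<Rightarrow> nat \<Rightarrow> 'a \<Rightarrow> nat set" where
  "pattern X u h m \<omega> = {i \<in> {1..m}. X (i + h) \<omega> \<le> u}"

lemma pattern_subset: "pattern X u h m \<omega> \<in> Pow {1..m}" by (auto simp: pattern_def)

lemma level_sigma_field_mono:
  "a' \<le> a \<Longrightarrow> b \<le> b' \<Longrightarrow> level_sigma_field M X u a b \<subseteq> level_sigma_field M X u a' b'"
  unfolding level_sigma_field_def by (rule sigma_sets_mono') force

lemma pattern_in_level_sigma_field:
  "{\<omega> \<in> space M. pattern X u h m \<omega> \<in> Q} \<in> level_sigma_field M X u (int h + 1) (int h + int m)"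
proof -
  let ?S = "level_sigma_field M X u (int h + 1) (int h + int m)"
  interpret S: sigma_algebra "space M" ?S
    unfolding level_sigma_field_def by (rule sigma_algebra_sigma_sets) auto
  have gen: "{\<omega> \<in> space M. X (i + h) \<omega> \<le> u} \<in> ?S" if "i \<in> {1..m}" for i
    unfolding level_sigma_field_def using that by (intro sigma_sets.Basic) force
  have "{\<omega> \<in> space M. (X (i + h) \<omega> \<le> u) = (i \<in> a)} \<in> ?S" if "i \<in> {1..m}" for i a
    using gen[OF that] S.sets_Collect_neg[OF gen[OF that]] by (cases "i \<in> a") auto
  then have "{\<omega> \<in> space M. \<exists>a\<in>Q \<inter> Pow {1..m}. \<forall>i\<in>{1..m}. (X (i + h) \<omega> \<le> u) = (i \<in> a)} \<in> ?S"
    by (intro S.sets_Collect_finite_Ex S.sets_Collect_finite_All) auto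
  also have "{\<omega> \<in> space M. \<exists>a\<in>Q \<inter> Pow {1..m}. \<forall>i\<in>{1..m}. (X (i + h) \<omega> \<le> u) = (i \<in> a)}
      = {\<omega> \<in> space M. pattern X u h m \<omega> \<in> Q}"
  proof -
    have "(\<exists>a\<in>Q \<inter> Pow {1..m}. \<forall>i\<in>{1..m}. (X (i + h) \<omega> \<le> u) = (i \<in> a)) \<longleftrightarrow> pattern X u h m \<omega> \<in> Q" for \<omega>
    proof
      assume "\<exists>a\<in>Q \<inter> Pow {1..m}. \<forall>i\<in>{1..m}. (X (i + h) \<omega> \<le> u) = (i \<in> a)"
      then obtain a where a: "a \<in> Q" "a \<subseteq> {1..m}" "\<forall>i\<in>{1..m}. (X (i + h) \<omega> \<le> u) = (i \<in> a)" by auto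
      then have "pattern X u h m \<omega> = a" by (auto simp: pattern_def)
      with a show "pattern X u h m \<omega> \<in> Q" by simp
    next
      assume "pattern X u h m \<omega> \<in> Q"
      then show "\<exists>a\<in>Q \<inter> Pow {1..m}. \<forall>i\<in>{1..m}. (X (i + h) \<omega> \<le> u) = (i \<in> a)"
        by (intro bexI[of _ "pattern X u h m \<omega>"]) (auto simp: pattern_def)
    qed
    then show ?thesis by auto
  qed
  finally show ?thesis .
qed

text \<open>
Enlarging the gap \<open>l\<close> shrinks both the range of \<open>k\<close> and the second sigma-field.
\<close>

lemma mixing_coeff_nonneg: "prob_space M \<Longrightarrow> mixing_coeff M X u n l \<ge> 0"
  and mixing_coeff_upper: "prob_space M \<Longrightarrow> 1 \<le> k \<Longrightarrow> k \<le> int n - l \<Longrightarrow>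
      A \<in> level_sigma_field M X u 1 k \<Longrightarrow> B \<in> level_sigma_field M X u (k + l) (int n) \<Longrightarrow>
      \<bar>measure M (A \<inter> B) - measure M A * measure M B\<bar> \<le> mixing_coeff M X u n l"
  and mixing_coeff_antimono: "prob_space M \<Longrightarrow> l \<le> l' \<Longrightarrow> mixing_coeff M X u n l' \<le> mixing_coeff M X u n l"
proof -
  define D where "D l = insert 0
     {\<bar>measure M (A \<inter> B) - measure M A * measure M B\<bar> | A B k.
        1 \<le> k \<and> k \<le> int n - l \<and>
        A \<in> level_sigma_field M X u 1 k \<and> B \<in> level_sigma_field M X u (k + l) (int n)}" for l
  have m: "mixing_coeff M X u n l = Sup (D l)" for l by (simp add: mixing_coeff_def D_def)
  assume "prob_space M"
  then interpret prob_space M .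
  have "\<bar>measure M (A \<inter> B) - measure M A * measure M B\<bar> \<le> 1" for A B
  proof -
    have "measure M A * measure M B \<le> 1" by (simp add: mult_le_one)
    moreover have "0 \<le> measure M A * measure M B" by simp
    moreover have "measure M (A \<inter> B) \<le> 1" "0 \<le> measure M (A \<inter> B)" by auto
    ultimately show ?thesis by linarith
  qed
  then have bdd: "bdd_above (D l)" for l
    by (intro bdd_aboveI[of _ 1]) (auto simp: D_def)
  show "0 \<le> mixing_coeff M X u n l" unfolding m by (rule cSup_upper[OF _ bdd]) (simp add: D_def)
  show "\<bar>measure M (A \<inter> B) - measure M A * measure M B\<bar> \<le> mixing_coeff M X u n l"
    if "1 \<le> k" "k \<le> int n - l" "A \<in> level_sigma_field M X u 1 k" "B \<in> level_sigma_field M X u (k + l) (int n)"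
    unfolding m by (rule cSup_upper[OF _ bdd]) (use that in \<open>auto simp: D_def\<close>)
  assume "l \<le> l'"
  have "D l' \<subseteq> D l"
  proof
    fix x assume "x \<in> D l'"
    then consider "x = 0" | A B k where "x = \<bar>measure M (A \<inter> B) - measure M A * measure M B\<bar>" "1 \<le> k"
      "k \<le> int n - l'" "A \<in> level_sigma_field M X u 1 k" "B \<in> level_sigma_field M X u (k + l') (int n)"
      by (auto simp: D_def)
    then show "x \<in> D l"
    proof cases
      case 2
      moreover have "B \<in> level_sigma_field M X u (k + l) (int n)"
        using 2(5) level_sigma_field_mono[of "k + l" "k + l'" "int n" "int n" M X u] \<open>l \<le> l'\<close> by auto
      moreover have "k \<le> int n - l" using 2 \<open>l \<le> l'\<close> by simp
      ultimately show ?thesis unfolding D_def by blast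
    qed (simp add: D_def)
  qed
  then show "mixing_coeff M X u n l' \<le> mixing_coeff M X u n l"
    unfolding m by (intro cSup_subset_mono bdd) (auto simp: D_def)
qed

locale stationary_process = prob_space M for M :: "'a measure" +
  fixes X :: "nat \<Rightarrow> 'a \<Rightarrow> real" and u :: real
  assumes stat: "stationary M X"
begin

lemma X_measurable: "i \<ge> 1 \<Longrightarrow> X i \<in> borel_measurable M"
  using stat by (simp add: stationary_def)

lemma level_sigma_field_events: "level_sigma_field M X u a b \<subseteq> events"
proof -
  have "{{\<omega> \<in> space M. X i \<omega> \<le> u} | i. 1 \<le> i \<and> a \<le> int i \<and> int i \<le> b} \<subseteq> events"
    using X_measurable by (auto intro!: borel_measurable_le)
  then show ?thesis unfolding level_sigma_field_def by (rule sets.sigma_sets_subset)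
qed

lemma pattern_event[measurable]: "{\<omega> \<in> space M. pattern X u h m \<omega> \<in> Q} \<in> events"
  using pattern_in_level_sigma_field level_sigma_field_events by blast

lemma pattern_measurable[measurable]: "pattern X u h m \<in> M \<rightarrow>\<^sub>M count_space (Pow {1..m})"
proof (subst measurable_count_space_eq2, simp, intro conjI ballI funcsetI pattern_subset)
  show "pattern X u h m -` {a} \<inter> space M \<in> events" for a
    using pattern_event[of h m "{a}"] by (simp add: vimage_def Int_def conj_commute)
qed

lemma measurable_pattern_fun[measurable (raw)]: "(\<lambda>\<omega>. G (pattern X u h m \<omega>)) \<in> M \<rightarrow>\<^sub>M count_space UNIV"
  by (rule measurable_compose[OF pattern_measurable]) simp

lemma borel_measurable_pattern_fun: 
  "(\<lambda>\<omega>. G (pattern X u h m \<omega>)) \<in> borel_measurable M"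
  by (rule measurable_compose[OF pattern_measurable]) simp

lemma distr_pattern_shift:
  "distr M (count_space (Pow {1..m})) (pattern X u h m) = distr M (count_space (Pow {1..m})) (pattern X u 0 m)"
proof -
  let ?P = "\<Pi>\<^sub>M i\<in>{1..m}. borel :: real measure"
  define g where "g f = {i\<in>{1..m}. f i \<le> u}" for f
  have g: "g \<in> ?P \<rightarrow>\<^sub>M count_space (Pow {1..m})"
  proof (subst measurable_count_space_eq2, simp, intro conjI ballI)
    show "g \<in> space ?P \<rightarrow> Pow {1..m}" by (auto simp: g_def)
    fix a assume "a \<in> Pow {1..m}"
    then have "g f = a \<longleftrightarrow> (\<forall>i\<in>{1..m}. (f i \<le> u) = (i \<in> a))" for f
      unfolding g_def by blast
    then have "g -` {a} \<inter> space ?P = {f \<in> space ?P. \<forall>i\<in>{1..m}. (f i \<le> u) = (i \<in> a)}"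
      by (simp add: vimage_def Int_def conj_commute)
    also have "\<dots> \<in> sets ?P"
    proof (intro sets.sets_Collect_finite_All)
      fix i assume i: "i \<in> {1..m}"
      have [measurable]: "(\<lambda>f. f i) \<in> borel_measurable ?P"
        by (rule measurable_component_singleton[OF i])
      have "{f \<in> space ?P. f i \<le> u} \<in> sets ?P" by measurable
      then show "{f \<in> space ?P. (f i \<le> u) = (i \<in> a)} \<in> sets ?P"
        using sets.sets_Collect_neg[of ?P "\<lambda>f. f i \<le> u"] by (cases "i \<in> a") auto
    qed simp
    finally show "g -` {a} \<inter> space ?P \<in> sets ?P" .
  qed
  have X': "(\<lambda>\<omega>. \<lambda>i\<in>{1..m}. X (i + h) \<omega>) \<in> M \<rightarrow>\<^sub>M ?P" for h
    by (intro measurable_restrict X_measurable) auto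
  have *: "distr M (count_space (Pow {1..m})) (pattern X u h m)
      = distr (distr M ?P (\<lambda>\<omega>. \<lambda>i\<in>{1..m}. X (i + h) \<omega>)) (count_space (Pow {1..m})) g" for h
    by (subst distr_distr[OF g X']) (intro distr_cong, auto simp: g_def pattern_def)
  have "distr M ?P (\<lambda>\<omega>. \<lambda>i\<in>{1..m}. X (i + h) \<omega>) = distr M ?P (\<lambda>\<omega>. \<lambda>i\<in>{1..m}. X (i + 0) \<omega>)"
    using stat unfolding stationary_def add_0_right by blast
  then show ?thesis unfolding *[of h] *[of 0] by (rule arg_cong)
qed

lemma prob_pattern_shift:
  "prob {\<omega> \<in> space M. pattern X u h m \<omega> \<in> Q} = prob {\<omega> \<in> space M. pattern X u 0 m \<omega> \<in> Q}"
proof -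
  have "prob {\<omega> \<in> space M. pattern X u h m \<omega> \<in> Q}
      = measure (distr M (count_space (Pow {1..m})) (pattern X u h m)) (Q \<inter> Pow {1..m})" for h
    by (subst measure_distr[OF pattern_measurable]) (auto simp: pattern_def intro!: arg_cong[where f=prob])
  then show ?thesis using distr_pattern_shift by metis
qed

lemma expectation_pattern_shift:
  fixes G :: "nat set \<Rightarrow> 'b::{banach, second_countable_topology}"
  shows "(\<integral>\<omega>. G (pattern X u h m \<omega>) \<partial>M) = (\<integral>\<omega>. G (pattern X u 0 m \<omega>) \<partial>M)"
proof -
  have "(\<integral>\<omega>. G (pattern X u h m \<omega>) \<partial>M)
      = (\<integral>W. G W \<partial>distr M (count_space (Pow {1..m})) (pattern X u h m))" for h
    by (subst integral_distr[OF pattern_measurable]) auto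
  then show ?thesis using distr_pattern_shift by metis
qed

lemma expectation_pattern:
  fixes G :: "nat set \<Rightarrow> complex"
  assumes E: "E \<in> events"
  shows "(\<integral>\<omega>. G (pattern X u h m \<omega>) * indicator E \<omega> \<partial>M)
    = (\<Sum>a\<in>Pow {1..m}. G a * prob ({\<omega> \<in> space M. pattern X u h m \<omega> = a} \<inter> E))"
proof -
  have ev: "{\<omega> \<in> space M. pattern X u h m \<omega> = a} \<inter> E \<in> events" for a
    using pattern_event[of h m "{a}"] E by auto
  have "(\<integral>\<omega>. G (pattern X u h m \<omega>) * indicator E \<omega> \<partial>M)
     = (\<integral>\<omega>. (\<Sum>a\<in>Pow {1..m}. G a * indicator ({\<omega> \<in> space M. pattern X u h m \<omega> = a} \<inter> E) \<omega>) \<partial>M)"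
  proof (rule Bochner_Integration.integral_cong)
    fix \<omega> assume "\<omega> \<in> space M"
    then have "(\<Sum>a\<in>Pow {1..m}. G a * indicator ({\<omega> \<in> space M. pattern X u h m \<omega> = a} \<inter> E) \<omega>)
      = (\<Sum>a\<in>Pow {1..m}. if a = pattern X u h m \<omega> then G a * indicator E \<omega> else 0)"
      by (intro sum.cong) (auto simp: indicator_def)
    then show "G (pattern X u h m \<omega>) * indicator E \<omega>
      = (\<Sum>a\<in>Pow {1..m}. G a * indicator ({\<omega> \<in> space M. pattern X u h m \<omega> = a} \<inter> E) \<omega>)"
      using pattern_subset[of X u h m \<omega>] by (simp add: sum.delta)
  qed simp
  also have "\<dots> = (\<Sum>a\<in>Pow {1..m}. G a * prob ({\<omega> \<in> space M. pattern X u h m \<omega> = a} \<inter> E))"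
  proof (subst Bochner_Integration.integral_sum)
    let ?I = "\<lambda>a. indicator ({\<omega> \<in> space M. pattern X u h m \<omega> = a} \<inter> E) :: 'a \<Rightarrow> complex"
    have I: "integrable M (?I a)" "integral\<^sup>L M (?I a) = prob ({\<omega> \<in> space M. pattern X u h m \<omega> = a} \<inter> E)" for a
    proof -
      have r: "?I a = (\<lambda>\<omega>. complex_of_real (indicator ({\<omega> \<in> space M. pattern X u h m \<omega> = a} \<inter> E) \<omega>))"
        by (auto simp: indicator_def)
      have i: "integrable M (indicator ({\<omega> \<in> space M. pattern X u h m \<omega> = a} \<inter> E) :: 'a \<Rightarrow> real)"
        using ev by (intro integrable_real_indicator) (auto simp: emeasure_eq_measure)
      show "integrable M (?I a)" unfolding r by (intro integrable_of_real i)
      show "integral\<^sup>L M (?I a) = prob ({\<omega> \<in> space M. pattern X u h m \<omega> = a} \<inter> E)"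
        unfolding r integral_complex_of_real using sets.sets_into_space[OF ev[of a]] ev[of a]
        by (simp add: Int_absorb1)
    qed
    show "integrable M (\<lambda>\<omega>. G a * ?I a \<omega>)" for a by (intro integrable_mult_right I)
    show "(\<Sum>a\<in>Pow {1..m}. \<integral>\<omega>. G a * ?I a \<omega> \<partial>M)
      = (\<Sum>a\<in>Pow {1..m}. G a * prob ({\<omega> \<in> space M. pattern X u h m \<omega> = a} \<inter> E))"
      by (simp only: integral_mult_right_zero I)
  qed
  finally show ?thesis .
qed

text \<open>
Expanding both functions over the values of the two patterns turns their covariance into a bilinear
form whose rectangle sums are covariances of events, which the mixing coefficient bounds.
\<close>

lemma covariance_pattern_bound:
  fixes F G :: "nat set \<Rightarrow> complex"
  assumes F: "\<And>a. norm (F a) \<le> 1" and G: "\<And>b. norm (G b) \<le> 1"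
    and m: "m \<ge> 1" and sep: "int m + l \<le> int h + 1" and n: "h + m' \<le> n" and n': "m + l \<le> n"
  shows "norm ((\<integral>\<omega>. F (pattern X u 0 m \<omega>) * G (pattern X u h m' \<omega>) \<partial>M)
      - (\<integral>\<omega>. F (pattern X u 0 m \<omega>) \<partial>M) * (\<integral>\<omega>. G (pattern X u h m' \<omega>) \<partial>M)) \<le> 8 * mixing_coeff M X u n l"
proof -
  define EA where "EA Q = {\<omega> \<in> space M. pattern X u 0 m \<omega> \<in> Q}" for Q
  define EB where "EB Q = {\<omega> \<in> space M. pattern X u h m' \<omega> \<in> Q}" for Q
  define \<delta> where "\<delta> a b = prob (EA {a} \<inter> EB {b}) - prob (EA {a}) * prob (EB {b})" for a b
  have evs[simp, intro]: "EA Q \<in> events" "EB Q \<in> events" for Q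
    by (auto simp: EA_def EB_def)
  have finA: "finite (Pow {1..m})" and finB: "finite (Pow {1..m'})" by auto
  have rect: "\<bar>\<Sum>a\<in>Q. \<Sum>b\<in>R. \<delta> a b\<bar> \<le> mixing_coeff M X u n l"
    if QR: "Q \<subseteq> Pow {1..m}" "R \<subseteq> Pow {1..m'}" for Q R
  proof -
    have fin: "finite Q" "finite R" using QR finite_subset by blast+
    have uA: "EA Q = (\<Union>a\<in>Q. EA {a})" and uB: "EB R = (\<Union>b\<in>R. EB {b})"
      by (auto simp: EA_def EB_def)
    have sA: "(\<Sum>a\<in>Q. prob (EA {a} \<inter> E)) = prob (EA Q \<inter> E)" if "E \<in> events" for E
    proof -
      have "EA Q \<inter> E = (\<Union>a\<in>Q. EA {a} \<inter> E)" using uA by auto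
      then show ?thesis using that fin
        by (simp only:, subst finite_measure_finite_Union) (auto simp: disjoint_family_on_def EA_def)
    qed
    have sB: "(\<Sum>b\<in>R. prob (E \<inter> EB {b})) = prob (E \<inter> EB R)" if "E \<in> events" for E
    proof -
      have "E \<inter> EB R = (\<Union>b\<in>R. E \<inter> EB {b})" using uB by auto
      then show ?thesis using that fin
        by (simp only:, subst finite_measure_finite_Union) (auto simp: disjoint_family_on_def EB_def)
    qed
    have sA': "(\<Sum>a\<in>Q. prob (EA {a})) = prob (EA Q)"
      using sA[of "space M"] sets.Int_space_eq2[OF evs(1)] by simp
    have sB': "(\<Sum>b\<in>R. prob (EB {b})) = prob (EB R)"
      using sB[of "space M"] sets.Int_space_eq1[OF evs(2)] by simp
    have "(\<Sum>a\<in>Q. \<Sum>b\<in>R. \<delta> a b) = (\<Sum>a\<in>Q. prob (EA {a} \<inter> EB R)) - (\<Sum>a\<in>Q. prob (EA {a})) * (\<Sum>b\<in>R. prob (EB {b}))"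
      by (simp add: \<delta>_def sum_subtractf sB sum_product)
    also have "\<dots> = prob (EA Q \<inter> EB R) - prob (EA Q) * prob (EB R)"
      by (simp add: sA sA' sB')
    also have "\<bar>\<dots>\<bar> \<le> mixing_coeff M X u n l"
    proof (rule mixing_coeff_upper[where k="int m"])
      show "EA Q \<in> level_sigma_field M X u 1 (int m)"
        using pattern_in_level_sigma_field[of M X u 0 m Q] by (simp add: EA_def)
      show "EB R \<in> level_sigma_field M X u (int m + l) (int n)"
        using pattern_in_level_sigma_field[of M X u h m' R] sep n
          level_sigma_field_mono[of "int m + l" "int h + 1" "int h + int m'" "int n" M X u]
        by (auto simp: EB_def)
    qed (use m n' prob_space_axioms in auto)
    finally show ?thesis .
  qed
  have A: "(\<integral>\<omega>. F (pattern X u 0 m \<omega>) \<partial>M) = (\<Sum>a\<in>Pow {1..m}. F a * prob (EA {a}))"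
    using expectation_pattern[of "space M" F 0 m] by (simp add: EA_def Int_absorb2 cong: Bochner_Integration.integral_cong)
  have B: "(\<integral>\<omega>. G (pattern X u h m' \<omega>) * indicator E \<omega> \<partial>M) = (\<Sum>b\<in>Pow {1..m'}. G b * prob (E \<inter> EB {b}))"
    if "E \<in> events" for E
    using expectation_pattern[OF that, of G h m'] by (simp add: EB_def Int_commute)
  have B': "(\<integral>\<omega>. G (pattern X u h m' \<omega>) \<partial>M) = (\<Sum>b\<in>Pow {1..m'}. G b * prob (EB {b}))"
    using expectation_pattern[of "space M" G h m'] by (simp add: EB_def Int_absorb2 cong: Bochner_Integration.integral_cong)
  have "(\<integral>\<omega>. F (pattern X u 0 m \<omega>) * G (pattern X u h m' \<omega>) \<partial>M)
     = (\<integral>\<omega>. (\<Sum>a\<in>Pow {1..m}. F a * (G (pattern X u h m' \<omega>) * indicator (EA {a}) \<omega>)) \<partial>M)"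
  proof (rule Bochner_Integration.integral_cong)
    fix \<omega> assume "\<omega> \<in> space M"
    then have "(\<Sum>a\<in>Pow {1..m}. F a * (G (pattern X u h m' \<omega>) * indicator (EA {a}) \<omega>))
      = (\<Sum>a\<in>Pow {1..m}. if a = pattern X u 0 m \<omega> then F a * G (pattern X u h m' \<omega>) else 0)"
      by (intro sum.cong) (auto simp: indicator_def EA_def)
    then show "F (pattern X u 0 m \<omega>) * G (pattern X u h m' \<omega>)
      = (\<Sum>a\<in>Pow {1..m}. F a * (G (pattern X u h m' \<omega>) * indicator (EA {a}) \<omega>))"
      using pattern_subset[of X u 0 m \<omega>] by (simp add: sum.delta)
  qed simp
  also have "\<dots> = (\<Sum>a\<in>Pow {1..m}. F a * (\<integral>\<omega>. G (pattern X u h m' \<omega>) * indicator (EA {a}) \<omega> \<partial>M))"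
  proof (subst Bochner_Integration.integral_sum)
    show "integrable M (\<lambda>\<omega>. F a * (G (pattern X u h m' \<omega>) * indicator (EA {a}) \<omega>))" for a
      using G borel_measurable_pattern_fun[of G h m']
      by (intro integrable_mult_right integrable_const_bound[of _ 1] borel_measurable_times
          borel_measurable_indicator evs) (auto simp: norm_mult indicator_def)
  qed simp
  also have "\<dots> = (\<Sum>a\<in>Pow {1..m}. F a * (\<Sum>b\<in>Pow {1..m'}. G b * prob (EA {a} \<inter> EB {b})))"
    by (simp add: B)
  finally have "(\<integral>\<omega>. F (pattern X u 0 m \<omega>) * G (pattern X u h m' \<omega>) \<partial>M)
      - (\<integral>\<omega>. F (pattern X u 0 m \<omega>) \<partial>M) * (\<integral>\<omega>. G (pattern X u h m' \<omega>) \<partial>M)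
    = (\<Sum>a\<in>Pow {1..m}. F a * (\<Sum>b\<in>Pow {1..m'}. G b * prob (EA {a} \<inter> EB {b})))
      - (\<Sum>a\<in>Pow {1..m}. F a * prob (EA {a})) * (\<Sum>b\<in>Pow {1..m'}. G b * prob (EB {b}))"
    by (simp only: A B')
  also have "\<dots> = (\<Sum>a\<in>Pow {1..m}. \<Sum>b\<in>Pow {1..m'}. F a * G b * \<delta> a b)"
    unfolding sum_product \<delta>_def of_real_diff of_real_mult right_diff_distrib sum_subtractf
    by (simp add: sum_distrib_left mult_ac)
  also have "norm \<dots> \<le> 8 * mixing_coeff M X u n l"
    by (rule bilinear_bound_complex[OF finA finB rect]) (use F G in auto)
  finally show ?thesis .
qed

text \<open>
Induction on the number of blocks: the product over the first \<open>J\<close> of them is a function of one long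
pattern, and this pattern is separated from the next block by \<open>l\<close>.
\<close>

lemma block_factorization:
  fixes H :: "nat set \<Rightarrow> complex"
  assumes H: "\<And>a. norm (H a) \<le> 1" and m: "m \<ge> 1" and sep: "int m + l \<le> int r + 1" and l: "l \<ge> 0" and mr: "m \<le> r"
  shows "J * r \<le> n \<Longrightarrow> norm ((\<integral>\<omega>. (\<Prod>j<J. H (pattern X u (j * r) m \<omega>)) \<partial>M)
      - (\<integral>\<omega>. H (pattern X u 0 m \<omega>) \<partial>M) ^ J) \<le> real J * (8 * mixing_coeff M X u n l)"
proof (induction J)
  case 0
  then show ?case by (simp add: prob_space)
next
  case (Suc J)
  let ?\<alpha> = "8 * mixing_coeff M X u n l" and ?\<phi> = "\<integral>\<omega>. H (pattern X u 0 m \<omega>) \<partial>M"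
  have \<alpha>: "?\<alpha> \<ge> 0" using mixing_coeff_nonneg[OF prob_space_axioms] by simp
  have Hint: "norm (\<integral>\<omega>. (\<Prod>j<J. H (pattern X u (j * r) m \<omega>)) \<partial>M) \<le> 1" for J
  proof -
    have b: "norm (\<Prod>j<J. H (pattern X u (j * r) m \<omega>)) \<le> 1" for \<omega>
      unfolding prod_norm[symmetric] by (rule prod_le_1) (use H in auto)
    have "norm (\<integral>\<omega>. (\<Prod>j<J. H (pattern X u (j * r) m \<omega>)) \<partial>M) \<le> 
       (\<integral>\<omega>. norm (\<Prod>j<J. H (pattern X u (j * r) m \<omega>)) \<partial>M)" by (rule integral_norm_bound)
    also have "\<dots> \<le> (\<integral>\<omega>. 1 \<partial>M)"
    proof (rule integral_mono)
      have "(\<lambda>\<omega>. \<Prod>j<J. H (pattern X u (j * r) m \<omega>)) \<in> borel_measurable M"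
        by (intro borel_measurable_prod borel_measurable_pattern_fun)
      then show "integrable M (\<lambda>\<omega>. norm (\<Prod>j<J. H (pattern X u (j * r) m \<omega>)))"
        using b by (intro integrable_norm integrable_const_bound[of _ 1]) auto
    qed (use b in auto)
    finally show ?thesis by (simp add: prob_space)
  qed
  have \<phi>1: "norm ?\<phi> \<le> 1" using Hint[of 1] by simp
  show ?case
  proof (cases "J = 0")
    case True
    then show ?thesis using \<alpha> by simp
  next
    case False
    then obtain J' where J': "J = Suc J'" by (cases J) auto
    define m0 where "m0 = J' * r + m"
    define F where "F W = (\<Prod>j<J. H {i\<in>{1..m}. i + j * r \<in> W})" for W
    have F1: "norm (F a) \<le> 1" for a
      unfolding F_def prod_norm[symmetric] by (rule prod_le_1) (use H in auto)
    have F: "(\<Prod>j<J. H (pattern X u (j * r) m \<omega>)) = F (pattern X u 0 m0 \<omega>)" for \<omega>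
      unfolding F_def
    proof (intro prod.cong arg_cong[where f=H])
      fix j assume "j \<in> {..<J}"
      then have "j \<le> J'" using J' by auto
      then show "pattern X u (j * r) m \<omega> = {i \<in> {1..m}. i + j * r \<in> pattern X u 0 m0 \<omega>}"
        by (auto simp: pattern_def m0_def add.commute[of _ m] intro!: add_mono mult_right_mono)
    qed simp
    have "norm ((\<integral>\<omega>. F (pattern X u 0 m0 \<omega>) * H (pattern X u (J * r) m \<omega>) \<partial>M)
      - (\<integral>\<omega>. F (pattern X u 0 m0 \<omega>) \<partial>M) * (\<integral>\<omega>. H (pattern X u (J * r) m \<omega>) \<partial>M)) \<le> ?\<alpha>"
    proof (rule covariance_pattern_bound[OF F1 H])
      show "1 \<le> m0" using m by (simp add: m0_def)
      have "int m0 + l = int J' * int r + (int m + l)" by (simp add: m0_def)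
      also have "\<dots> \<le> int J' * int r + (int r + 1)" using sep by simp
      finally have *: "int m0 + l \<le> int (J * r) + 1" by (simp add: J' algebra_simps)
      then show "int m0 + l \<le> int (J * r) + 1" .
      show "J * r + m \<le> n" using Suc.prems mr by simp
      have "J * r + 1 \<le> n" using Suc.prems m mr by simp
      then have "int (J * r) + 1 \<le> int n" by (simp flip: of_nat_mult)
      then show "int m0 + l \<le> int n" using * by linarith
    qed
    then have 1: "norm ((\<integral>\<omega>. (\<Prod>j<Suc J. H (pattern X u (j * r) m \<omega>)) \<partial>M)
      - (\<integral>\<omega>. (\<Prod>j<J. H (pattern X u (j * r) m \<omega>)) \<partial>M) * ?\<phi>) \<le> ?\<alpha>"
      by (simp only: F[symmetric] prod.lessThan_Suc expectation_pattern_shift[of H "J * r"])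
    have "norm ((\<integral>\<omega>. (\<Prod>j<J. H (pattern X u (j * r) m \<omega>)) \<partial>M) * ?\<phi> - ?\<phi> ^ Suc J)
      = norm ((\<integral>\<omega>. (\<Prod>j<J. H (pattern X u (j * r) m \<omega>)) \<partial>M) - ?\<phi> ^ J) * norm ?\<phi>"
      unfolding norm_mult[symmetric] by (simp add: algebra_simps)
    also have "\<dots> \<le> norm ((\<integral>\<omega>. (\<Prod>j<J. H (pattern X u (j * r) m \<omega>)) \<partial>M) - ?\<phi> ^ J) * 1"
      by (intro mult_left_mono \<phi>1) auto
    also have "\<dots> \<le> real J * ?\<alpha>" using Suc by simp
    finally have "norm ((\<integral>\<omega>. (\<Prod>j<Suc J. H (pattern X u (j * r) m \<omega>)) \<partial>M) - ?\<phi> ^ Suc J) \<le> ?\<alpha> + real J * ?\<alpha>"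
      by (rule norm_diff_triangle_le[OF 1])
    then show ?thesis by (simp only: of_nat_Suc distrib_right mult_1 add.commute)
  qed
qed

end

section \<open>Runs of upcrossings inside a block\<close>

definition up_in :: "nat set \<Rightarrow> nat \<Rightarrow> bool" where "up_in W i \<longleftrightarrow> i \<in> W \<and> Suc i \<notin> W"

lemma up_in_pattern: "1 \<le> i \<Longrightarrow> i < m \<Longrightarrow> up_in (pattern X u h m \<omega>) i \<longleftrightarrow> upcrossing X u (i + h) \<omega>"
  by (auto simp: up_in_def pattern_def upcrossing_def not_le)

lemma upcrossing_count_self: "upcrossing_count X u i i \<omega> = 0 \<longleftrightarrow> \<not> upcrossing X u i \<omega>"
  by (simp add: upcrossing_count_def)

lemma run_start_iff:
  "\<omega> \<in> run_start M X u i \<longleftrightarrow> \<omega> \<in> space M \<and> \<not> upcrossing X u i \<omega> \<and> upcrossing X u (i + 2) \<omega>"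
  unfolding run_start_def upcrossing_count_self by (simp add: upcrossing_def numeral_3_eq_3)

lemma run_of_length_iff:
  "run_of_length X u i k \<omega> \<longleftrightarrow> (\<forall>q\<in>{1..k}. upcrossing X u (i + 2 * q) \<omega>) \<and> \<not> upcrossing X u (i + 2 * Suc k) \<omega>"
  unfolding run_of_length_def upcrossing_count_self by (simp add: upcrossing_def)

lemma run_length_eqI:
  assumes "run_of_length X u i k \<omega>"
  shows "run_length X u i \<omega> = k"
proof -
  have le: "k' \<le> k''" if "run_of_length X u i k' \<omega>" "run_of_length X u i k'' \<omega>" for k' k''
  proof (rule ccontr)
    assume "\<not> k' \<le> k''"
    then have "Suc k'' \<in> {1..k'}" by auto
    then show False using that unfolding run_of_length_iff by blast
  qed
  then have "(THE k. run_of_length X u i k \<omega>) = k"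
    using assms by (intro the_equality) (auto intro: antisym)
  then show ?thesis using assms by (auto simp: run_length_def)
qed

lemma run_exists:
  assumes "\<not> upcrossing X u (i + 2 * Suc m) \<omega>"
  shows "\<exists>k\<le>m. run_of_length X u i k \<omega>"
proof -
  define k where "k = (LEAST k. \<not> upcrossing X u (i + 2 * Suc k) \<omega>)"
  have k: "\<not> upcrossing X u (i + 2 * Suc k) \<omega>" unfolding k_def by (rule LeastI[of _ m]) fact
  have "k \<le> m" unfolding k_def by (rule Least_le) fact
  have "upcrossing X u (i + 2 * q) \<omega>" if "q \<in> {1..k}" for q
  proof -
    have "q - 1 < k" using that by auto
    then have "upcrossing X u (i + 2 * Suc (q - 1)) \<omega>" unfolding k_def using not_less_Least by blast
    then show ?thesis using that by (cases q) auto
  qed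
  with k \<open>k \<le> m\<close> show ?thesis by (auto simp: run_of_length_iff)
qed

lemma run_of_length_ge_iff:
  assumes "run_of_length X u i k \<omega>"
  shows "(\<forall>q\<in>{1..j}. upcrossing X u (i + 2 * q) \<omega>) \<longleftrightarrow> j \<le> k"
proof
  assume "\<forall>q\<in>{1..j}. upcrossing X u (i + 2 * q) \<omega>"
  then have "\<not> (Suc k \<in> {1..j})" using assms unfolding run_of_length_iff by blast
  then show "j \<le> k" by simp
qed (use assms in \<open>auto simp: run_of_length_iff\<close>)

definition start_in :: "nat set \<Rightarrow> nat \<Rightarrow> bool" where
  "start_in W i \<longleftrightarrow> \<not> up_in W i \<and> up_in W (i + 2)"

text \<open>
The length of the run that follows \<open>i\<close>, cut off at \<open>m\<close>: the summand for \<open>j\<close> says that the run has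
length at least \<open>j\<close>. Unlike the full length it depends on finitely many indices.
\<close>

definition capped_run :: "nat set \<Rightarrow> nat \<Rightarrow> nat \<Rightarrow> nat" where
  "capped_run W m i = (\<Sum>j=1..m. of_bool (\<forall>q\<in>{1..j}. up_in W (i + 2 * q)))"

definition block_starts :: "nat \<Rightarrow> nat set \<Rightarrow> real" where
  "block_starts s W = (\<Sum>i=1..s. of_bool (start_in W i))"

text \<open>
The cap is the number of the indices \<open>i + 2, i + 4, \<dots>\<close> that do not exceed \<open>s + 2\<close>, so that the sum
can be read off from the first \<open>s + 3\<close> levels of the block.
\<close>

definition block_runs :: "nat \<Rightarrow> nat set \<Rightarrow> real" where
  "block_runs s W = (\<Sum>i=1..s. real (capped_run W ((s + 2 - i) div 2) i) * of_bool (start_in W i))"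

lemma run_length_eq_capped:
  assumes gap: "\<not> upcrossing X u (i + h + 2 * Suc m) \<omega>" and i: "1 \<le> i" and b: "i + 2 * m < b"
  shows "run_length X u (i + h) \<omega> = capped_run (pattern X u h b \<omega>) m i"
proof -
  obtain k where k: "k \<le> m" "run_of_length X u (i + h) k \<omega>" using run_exists[OF gap] by auto
  have "capped_run (pattern X u h b \<omega>) m i = (\<Sum>j=1..m. of_bool (j \<le> k))"
    unfolding capped_run_def
  proof (intro sum.cong refl arg_cong[where f=of_bool])
    fix j assume j: "j \<in> {1..m}"
    have "(\<forall>q\<in>{1..j}. up_in (pattern X u h b \<omega>) (i + 2 * q)) \<longleftrightarrow> (\<forall>q\<in>{1..j}. upcrossing X u (i + h + 2 * q) \<omega>)"
    proof (intro ball_cong refl)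
      fix q assume "q \<in> {1..j}"
      then show "up_in (pattern X u h b \<omega>) (i + 2 * q) = upcrossing X u (i + h + 2 * q) \<omega>"
        using j i b by (subst up_in_pattern) (auto simp: add_ac)
    qed
    also have "\<dots> \<longleftrightarrow> j \<le> k" by (rule run_of_length_ge_iff[OF k(2)])
    finally show "(\<forall>q\<in>{1..j}. up_in (pattern X u h b \<omega>) (i + 2 * q)) = (j \<le> k)" .
  qed
  also have "\<dots> = (\<Sum>j\<in>{1..k}. 1)"
    using k(1) by (intro sum.mono_neutral_cong_right) auto
  finally show ?thesis using run_length_eqI[OF k(2)] by simp
qed

text \<open>
A run proceeds in steps of 2, so it cannot jump over the gap, whose length is at least 2: the cap does
not matter. The omitted starts are those in \<open>h + r - L < i \<le> h + r\<close>; their first upcrossing, at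
\<open>i + 2\<close>, would lie in the gap.
\<close>

lemma block_sums_eq_pattern:
  assumes L: "2 \<le> L" "L \<le> r" and w: "\<omega> \<in> space M"
    and gap: "\<And>i. h + r - L + 2 < i \<Longrightarrow> i \<le> h + r + 2 \<Longrightarrow> \<not> upcrossing X u i \<omega>"
  shows "(\<Sum>i=1..r. indicator (run_start M X u (i + h)) \<omega>) = block_starts (r - L) (pattern X u h (r - L + 3) \<omega>)"
    and "(\<Sum>i=1..r. real (run_length X u (i + h) \<omega>) * indicator (run_start M X u (i + h)) \<omega>)
      = block_runs (r - L) (pattern X u h (r - L + 3) \<omega>)"
proof -
  let ?W = "pattern X u h (r - L + 3) \<omega>"
  have st: "(indicator (run_start M X u (i + h)) \<omega> :: real) = of_bool (start_in ?W i)" if "i \<in> {1..r - L}" for i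
    using that w by (auto simp: indicator_def run_start_iff start_in_def up_in_pattern add_ac)
  have rl: "run_length X u (i + h) \<omega> = capped_run ?W ((r - L + 2 - i) div 2) i" if "i \<in> {1..r - L}" for i
  proof (rule run_length_eq_capped)
    show "\<not> upcrossing X u (i + h + 2 * Suc ((r - L + 2 - i) div 2)) \<omega>"
      using that L by (intro gap) auto
    show "i + 2 * ((r - L + 2 - i) div 2) < r - L + 3" using that by auto
  qed (use that in auto)
  have z: "indicator (run_start M X u (i + h)) \<omega> = (0::real)" if "i \<in> {1..r} - {1..r - L}" for i
  proof -
    have "\<not> upcrossing X u (i + h + 2) \<omega>" by (rule gap) (use that L in auto)
    then show ?thesis by (simp add: indicator_def run_start_iff)
  qed
  show "(\<Sum>i=1..r. indicator (run_start M X u (i + h)) \<omega>) = block_starts (r - L) ?W"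
    unfolding block_starts_def by (intro sum.mono_neutral_cong_right) (use z st in auto)
  show "(\<Sum>i=1..r. real (run_length X u (i + h) \<omega>) * indicator (run_start M X u (i + h)) \<omega>)
      = block_runs (r - L) ?W"
    unfolding block_runs_def by (intro sum.mono_neutral_cong_right) (use z st rl in auto)
qed

lemma sum_blocks: "(\<Sum>i=1..k * r. f i) = (\<Sum>j<k. \<Sum>i=1..r. f (i + j * r))" for f :: "nat \<Rightarrow> 'b::comm_monoid_add"
proof (induction k)
  case (Suc k)
  have "{1..Suc k * r} = {1..k * r} \<union> {1 + k * r..r + k * r}" by auto
  then have "(\<Sum>i=1..Suc k * r. f i) = (\<Sum>i=1..k * r. f i) + (\<Sum>i=1 + k * r..r + k * r. f i)"
    by (simp only:, subst sum.union_disjoint) auto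
  also have "(\<Sum>i=1 + k * r..r + k * r. f i) = (\<Sum>i=1..r. f (i + k * r))"
    by (rule sum.shift_bounds_cl_nat_ivl)
  finally show ?case using Suc by simp
qed simp

text \<open>
The sums over all indices stop at \<open>n - 3\<close> and the blocks at \<open>k * r\<close>; a gap of length at least 3 at the
end of the last block absorbs the difference if \<open>n - 3 < k * r\<close>, and otherwise \<open>rest\<close> does.
\<close>

lemma global_sums_eq_pattern:
  assumes L: "3 \<le> L" "L \<le> r" and kr: "k * r \<le> n" and k: "k \<ge> 1" and w: "\<omega> \<in> space M"
    and gap: "\<And>j i. j < k \<Longrightarrow> j * r + r - L + 2 < i \<Longrightarrow> i \<le> j * r + r + 2 \<Longrightarrow> \<not> upcrossing X u i \<omega>"
    and rest: "\<And>i. k * r + 2 < i \<Longrightarrow> i < n \<Longrightarrow> \<not> upcrossing X u i \<omega>"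
  shows "N_hat M X u n n \<omega> = (\<Sum>j<k. block_starts (r - L) (pattern X u (j * r) (r - L + 3) \<omega>))"
    and "N_bar M X u n n \<omega> = (\<Sum>j<k. block_runs (r - L) (pattern X u (j * r) (r - L + 3) \<omega>))"
proof -
  obtain k' where k': "k = Suc k'" using k by (cases k) auto
  have no: "\<not> upcrossing X u i \<omega>" if "k * r - L + 2 < i" "i < n" for i
  proof (cases "k * r + 2 < i")
    case True
    then show ?thesis using rest that by simp
  next
    case False
    then show ?thesis using gap[of k' i] that by (simp add: k' add_ac)
  qed
  have no_start: "indicator (run_start M X u i) \<omega> = (0::real)" if "k * r - L < i" "i \<le> n - 3 \<or> i \<le> k * r" "1 \<le> i" for i
  proof -
    have "\<not> upcrossing X u (i + 2) \<omega>"
    proof (cases "i + 2 < n")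
      case True
      then show ?thesis using no that by simp
    next
      case False
      then have "i \<le> k * r" using that L kr k k' by auto
      then show ?thesis using gap[of k' "i + 2"] that by (simp add: k' add_ac)
    qed
    then show ?thesis by (simp add: run_start_iff)
  qed
  have cut: "(\<Sum>i=1..min n (n - 3). g i * indicator (run_start M X u i) \<omega>)
      = (\<Sum>i=1..k * r. g i * indicator (run_start M X u i) \<omega>)" for g :: "nat \<Rightarrow> real"
  proof -
    have "k * r \<ge> L" using k' L by simp
    then have s: "{1..k * r - L} \<subseteq> {1..n - 3}" using kr L by auto
    have "(\<Sum>i=1..min n (n - 3). g i * indicator (run_start M X u i) \<omega>)
      = (\<Sum>i=1..k * r - L. g i * indicator (run_start M X u i) \<omega>)"
      using s no_start by (intro sum.mono_neutral_right) (auto simp: not_le)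
    also have "\<dots> = (\<Sum>i=1..k * r. g i * indicator (run_start M X u i) \<omega>)"
      using no_start by (intro sum.mono_neutral_left) (auto simp: not_le)
    finally show ?thesis .
  qed
  have gap': "\<not> upcrossing X u i \<omega>" if "j < k" "j * r + r - L + 2 < i" "i \<le> j * r + r + 2" for i j
    using gap that by blast
  have L2: "2 \<le> L" using L by simp
  have "N_hat M X u n n \<omega> = (\<Sum>i=1..k * r. indicator (run_start M X u i) \<omega>)"
    using cut[of "\<lambda>_. 1"] by (simp add: N_hat_def)
  also have "\<dots> = (\<Sum>j<k. \<Sum>i=1..r. indicator (run_start M X u (i + j * r)) \<omega>)"
    by (rule sum_blocks)
  also have "\<dots> = (\<Sum>j<k. block_starts (r - L) (pattern X u (j * r) (r - L + 3) \<omega>))"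
    by (intro sum.cong refl block_sums_eq_pattern[OF L2 L(2) w] gap') auto
  finally show "N_hat M X u n n \<omega> = (\<Sum>j<k. block_starts (r - L) (pattern X u (j * r) (r - L + 3) \<omega>))" .
  have "N_bar M X u n n \<omega> = (\<Sum>i=1..k * r. real (run_length X u i \<omega>) * indicator (run_start M X u i) \<omega>)"
    using cut[of "\<lambda>i. real (run_length X u i \<omega>)"] by (simp add: N_bar_def)
  also have "\<dots> = (\<Sum>j<k. \<Sum>i=1..r. real (run_length X u (i + j * r) \<omega>) * indicator (run_start M X u (i + j * r)) \<omega>)"
    by (rule sum_blocks)
  also have "\<dots> = (\<Sum>j<k. block_runs (r - L) (pattern X u (j * r) (r - L + 3) \<omega>))"
    by (intro sum.cong refl block_sums_eq_pattern[OF L2 L(2) w] gap') auto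
  finally show "N_bar M X u n n \<omega> = (\<Sum>j<k. block_runs (r - L) (pattern X u (j * r) (r - L + 3) \<omega>))" .
qed

lemma cluster_weight_bound:
  fixes \<theta> K :: real and m :: nat
  assumes \<theta>: "\<bar>\<theta>\<bar> \<le> K"
  shows "\<bar>if m > 0 then 1 - \<theta> * real m else 0\<bar> \<le> (1 + K) * real m"
proof (cases "m = 0")
  case False
  have "\<bar>1 - \<theta> * real m\<bar> \<le> 1 + \<bar>\<theta>\<bar> * real m"
    by (metis abs_mult abs_of_nat abs_one abs_triangle_ineq4)
  also have "\<dots> \<le> real m + K * real m" using False \<theta> by (intro add_mono mult_right_mono) auto
  finally show ?thesis using False by (simp add: algebra_simps)
qed simp

text \<open>
If at most one of the \<open>v i\<close> is positive, the square of the sum is the sum of the squares. Otherwise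
both are bounded by \<open>(1 + K)\<^sup>2 * B\<^sup>2\<close>.
\<close>

lemma sum_square_vs_square_sum:
  fixes v :: "'i \<Rightarrow> nat" and \<theta> K :: real
  assumes I: "finite I" and \<theta>: "\<bar>\<theta>\<bar> \<le> K"
  defines "f \<equiv> \<lambda>m::nat. if m > 0 then 1 - \<theta> * real m else 0"
    and "N \<equiv> \<Sum>i\<in>I. of_bool (v i > 0) :: real" and "B \<equiv> \<Sum>i\<in>I. real (v i)"
  shows "\<bar>(\<Sum>i\<in>I. f (v i))\<^sup>2 - (\<Sum>i\<in>I. (f (v i))\<^sup>2)\<bar> \<le> (1 + K)\<^sup>2 * (B\<^sup>2 * of_bool (N > 1))"
    and "(\<Sum>i\<in>I. f (v i))\<^sup>2 * of_bool ((\<Sum>i\<in>I. f (v i))\<^sup>2 > \<epsilon>)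
      \<le> (1 + K)\<^sup>2 * (B\<^sup>2 * of_bool (N > 1)) + (\<Sum>i\<in>I. (f (v i))\<^sup>2 * of_bool ((f (v i))\<^sup>2 > \<epsilon>))"
proof -
  have f: "\<bar>f m\<bar> \<le> (1 + K) * real m" for m
    unfolding f_def by (rule cluster_weight_bound[OF \<theta>])
  have f2: "(f m)\<^sup>2 \<le> (1 + K)\<^sup>2 * (real m)\<^sup>2" for m
    using power_mono[OF f[of m] abs_ge_zero, of 2] by (simp add: power_mult_distrib)
  have S: "\<bar>\<Sum>i\<in>I. f (v i)\<bar> \<le> (1 + K) * B"
    unfolding B_def sum_distrib_left by (rule order_trans[OF sum_abs]) (intro sum_mono f)
  have S2: "(\<Sum>i\<in>I. f (v i))\<^sup>2 \<le> (1 + K)\<^sup>2 * B\<^sup>2"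
    using power_mono[OF S abs_ge_zero, of 2] by (simp add: power_mult_distrib)
  have "(\<Sum>i\<in>I. (f (v i))\<^sup>2) \<le> (\<Sum>i\<in>I. (1 + K)\<^sup>2 * (real (v i))\<^sup>2)"
    by (intro sum_mono f2)
  also have "\<dots> = (1 + K)\<^sup>2 * (\<Sum>i\<in>I. (real (v i))\<^sup>2)" by (simp add: sum_distrib_left)
  also have "\<dots> \<le> (1 + K)\<^sup>2 * B\<^sup>2"
  proof (rule mult_left_mono)
    have "(\<Sum>i\<in>I. (real (v i))\<^sup>2) \<le> (\<Sum>i\<in>I. real (v i) * B)"
      unfolding power2_eq_square B_def using I by (intro sum_mono mult_left_mono member_le_sum) auto
    then show "(\<Sum>i\<in>I. (real (v i))\<^sup>2) \<le> B\<^sup>2"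
      by (simp add: B_def power2_eq_square sum_distrib_right)
  qed simp
  finally have Q: "(\<Sum>i\<in>I. (f (v i))\<^sup>2) \<le> (1 + K)\<^sup>2 * B\<^sup>2" .
  have Q0: "(\<Sum>i\<in>I. (f (v i))\<^sup>2) \<ge> 0" by (intro sum_nonneg) auto
  have single: "(\<exists>i\<in>I. \<forall>j\<in>I - {i}. v j = 0) \<or> I = {}" if "\<not> N > 1"
  proof (rule ccontr)
    assume *: "\<not> ?thesis"
    then obtain i where i: "i \<in> I" "v i > 0" by (metis all_not_in_conv gr0I DiffD1)
    with * obtain j where j: "j \<in> I" "j \<noteq> i" "v j > 0" by auto
    have "(\<Sum>i\<in>{i, j}. of_bool (v i > 0) :: real) \<le> N"
      unfolding N_def using I i j by (intro sum_mono2) auto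
    then show False using that i j by simp
  qed
  have one: "(\<Sum>i\<in>I. g (f (v i))) = g (\<Sum>i\<in>I. f (v i))" if "\<not> N > 1" "g 0 = 0" for g :: "real \<Rightarrow> real"
  proof (cases "I = {}")
    case False
    with single that obtain i where i: "i \<in> I" "\<And>j. j \<in> I - {i} \<Longrightarrow> v j = 0" by blast
    then have "(\<Sum>i\<in>I. f (v i)) = f (v i)" "(\<Sum>i\<in>I. g (f (v i))) = g (f (v i))"
      using I that by (auto simp: sum.remove[OF I i(1)] f_def)
    then show ?thesis by simp
  qed (simp add: that)
  show "\<bar>(\<Sum>i\<in>I. f (v i))\<^sup>2 - (\<Sum>i\<in>I. (f (v i))\<^sup>2)\<bar> \<le> (1 + K)\<^sup>2 * (B\<^sup>2 * of_bool (N > 1))"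
  proof (cases "N > 1")
    case True
    then have *: "of_bool (N > 1) = (1 :: real)" by simp
    show ?thesis using S2 Q Q0 zero_le_power2[of "\<Sum>i\<in>I. f (v i)"] unfolding abs_le_iff * by linarith
  next
    case False
    then show ?thesis using one[of "\<lambda>x. x\<^sup>2"] by simp
  qed
  show "(\<Sum>i\<in>I. f (v i))\<^sup>2 * of_bool ((\<Sum>i\<in>I. f (v i))\<^sup>2 > \<epsilon>)
      \<le> (1 + K)\<^sup>2 * (B\<^sup>2 * of_bool (N > 1)) + (\<Sum>i\<in>I. (f (v i))\<^sup>2 * of_bool ((f (v i))\<^sup>2 > \<epsilon>))"
  proof (cases "N > 1")
    case True
    have "(\<Sum>i\<in>I. f (v i))\<^sup>2 * of_bool ((\<Sum>i\<in>I. f (v i))\<^sup>2 > \<epsilon>) \<le> (\<Sum>i\<in>I. f (v i))\<^sup>2 * 1"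
      by (intro mult_left_mono) auto
    moreover have "0 \<le> (\<Sum>i\<in>I. (f (v i))\<^sup>2 * of_bool ((f (v i))\<^sup>2 > \<epsilon>))" by (intro sum_nonneg) auto
    ultimately show ?thesis using S2 True by simp
  next
    case False
    then show ?thesis using one[of "\<lambda>x. x\<^sup>2 * of_bool (x\<^sup>2 > \<epsilon>)"] by simp
  qed
qed

section \<open>Cluster sizes\<close>

context stationary_process begin

text \<open>
Setting the size to 0 away from the starts makes \<open>N_bar\<close> a sum of identically distributed terms.
\<close>

definition cluster_size :: "nat \<Rightarrow> 'a \<Rightarrow> nat" where
  "cluster_size i \<omega> = (if \<omega> \<in> run_start M X u i then run_length X u i \<omega> else 0)"

text \<open>
The first upcrossing is required at \<open>h + 1\<close>, so that \<open>h\<close> is a shift of the whole event and does not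
influence its probability.
\<close>

definition runs :: "nat \<Rightarrow> nat \<Rightarrow> 'a set" where
  "runs h j = {\<omega> \<in> space M. \<forall>q<j. upcrossing X u (h + 1 + 2 * q) \<omega>}"

lemma upcrossing_event[measurable]: "{\<omega> \<in> space M. upcrossing X u (Suc h) \<omega>} \<in> events"
  using pattern_event[of h 2 "{W. up_in W 1}"] by (simp add: up_in_pattern)

lemma upcrossing_event': "1 \<le> i \<Longrightarrow> {\<omega> \<in> space M. upcrossing X u i \<omega>} \<in> events"
  using upcrossing_event[of "i - 1"] by simp

lemma prob_upcrossing:
  "1 \<le> i \<Longrightarrow> prob {\<omega> \<in> space M. upcrossing X u i \<omega>} = prob {\<omega> \<in> space M. upcrossing X u 1 \<omega>}"
  using prob_pattern_shift[of "i - 1" 2 "{W. up_in W 1}"] by (simp add: up_in_pattern)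

lemma run_start_event[measurable]: "run_start M X u (Suc h) \<in> events"
proof -
  have "run_start M X u (Suc h) = {\<omega> \<in> space M. pattern X u h 4 \<omega> \<in> {W. start_in W 1}}"
    by (auto simp: up_in_pattern start_in_def run_start_iff)
  then show ?thesis by simp
qed

lemma run_start_event': "1 \<le> i \<Longrightarrow> run_start M X u i \<in> events"
  using run_start_event[of "i - 1"] by simp

lemma runs_pattern: "runs h j = {\<omega> \<in> space M. pattern X u h (2 * j) \<omega> \<in> {W. \<forall>q<j. up_in W (1 + 2 * q)}}"
  by (auto simp: runs_def up_in_pattern add_ac)

lemma runs_event[measurable]: "runs h j \<in> events"
  unfolding runs_pattern by simp

lemma prob_runs: "prob (runs h j) = prob (runs 0 j)"
  unfolding runs_pattern by (rule prob_pattern_shift)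

lemma up_in_pattern_odd:
  "1 + 2 * q + 1 \<le> m \<Longrightarrow> up_in (pattern X u h m \<omega>) (1 + 2 * q) \<longleftrightarrow> upcrossing X u (Suc h + 2 * q) \<omega>"
  using up_in_pattern[of "1 + 2 * q" m X u h \<omega>] by (simp add: add_ac)

lemma run_length_Suc_pattern:
  "{\<omega> \<in> space M. run_length X u (Suc h) \<omega> = Suc k}
   = {\<omega> \<in> space M. pattern X u h (2 * k + 6) \<omega> \<in> {W. (\<forall>q\<in>{1..Suc k}. up_in W (1 + 2 * q)) \<and> \<not> up_in W (1 + 2 * Suc (Suc k))}}"
proof -
  have "run_length X u (Suc h) \<omega> = Suc k \<longleftrightarrow> run_of_length X u (Suc h) (Suc k) \<omega>" for \<omega>
    using run_length_eqI run_length_def by (metis nat.distinct(1))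
  also have "\<dots> \<omega> \<longleftrightarrow> (\<forall>q\<in>{1..Suc k}. up_in (pattern X u h (2 * k + 6) \<omega>) (1 + 2 * q)) \<and>
      \<not> up_in (pattern X u h (2 * k + 6) \<omega>) (1 + 2 * Suc (Suc k))" for \<omega>
    unfolding run_of_length_iff by (intro arg_cong2[where f="(\<and>)"] arg_cong[where f=Not] ball_cong refl
      up_in_pattern_odd[symmetric]) auto
  finally show ?thesis by simp
qed

lemma cluster_size_Suc_pattern:
  "{\<omega> \<in> space M. cluster_size (Suc h) \<omega> = Suc k}
   = {\<omega> \<in> space M. pattern X u h (2 * k + 6) \<omega> \<in>
       {W. start_in W 1 \<and> (\<forall>q\<in>{1..Suc k}. up_in W (1 + 2 * q)) \<and> \<not> up_in W (1 + 2 * Suc (Suc k))}}"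
proof -
  have "\<omega> \<in> run_start M X u (Suc h) \<longleftrightarrow> start_in (pattern X u h (2 * k + 6) \<omega>) 1" if "\<omega> \<in> space M" for \<omega>
    using that by (simp add: run_start_iff start_in_def up_in_pattern)
  then show ?thesis using run_length_Suc_pattern[of h k] unfolding cluster_size_def by (auto simp: set_eq_iff)
qed

lemma nat_measurableI:
  assumes "\<And>k. {\<omega> \<in> space M. f \<omega> = Suc k} \<in> events"
  shows "f \<in> M \<rightarrow>\<^sub>M count_space UNIV"
proof (subst measurable_count_space_eq2_countable, intro conjI ballI)
  fix k :: nat
  show "f -` {k} \<inter> space M \<in> events"
  proof (cases k)
    case 0
    have "f -` {k} \<inter> space M = space M - (\<Union>k. {\<omega> \<in> space M. f \<omega> = Suc k})"
      using 0 by (auto, metis not0_implies_Suc)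
    also have "\<dots> \<in> events" using assms by auto
    finally show ?thesis .
  next
    case (Suc k)
    then show ?thesis using assms[of k] by (simp add: vimage_def Int_def conj_commute)
  qed
qed simp

lemma run_length_measurable: "run_length X u (Suc h) \<in> M \<rightarrow>\<^sub>M count_space UNIV"
  by (rule nat_measurableI) (simp only: run_length_Suc_pattern pattern_event)

lemma cluster_size_measurable: "cluster_size (Suc h) \<in> M \<rightarrow>\<^sub>M count_space UNIV"
  by (rule nat_measurableI) (simp only: cluster_size_Suc_pattern pattern_event)

text \<open>
A positive size is an event of a finite window, to which stationarity applies. The value 0, which
covers infinite runs too, carries the remaining probability.
\<close>

lemma distr_cluster_size:
  assumes "1 \<le> i"
  shows "distr M (count_space UNIV) (cluster_size i) = distr M (count_space UNIV) (cluster_size 1)"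
proof -
  obtain h where i: "i = Suc h" using assms by (cases i) auto
  let ?P = "\<lambda>h k. prob {\<omega> \<in> space M. cluster_size (Suc h) \<omega> = k}"
  note [measurable] = cluster_size_measurable
  have S: "?P h (Suc k) = ?P 0 (Suc k)" for h k
    unfolding cluster_size_Suc_pattern by (rule prob_pattern_shift)
  have Z: "(\<lambda>k. ?P h (Suc k)) sums (1 - ?P h 0)" for h
  proof -
    have "(\<lambda>k. ?P h (Suc k)) sums prob (\<Union>k. {\<omega> \<in> space M. cluster_size (Suc h) \<omega> = Suc k})"
      by (rule finite_measure_UNION) (auto simp: disjoint_family_on_def)
    also have "(\<Union>k. {\<omega> \<in> space M. cluster_size (Suc h) \<omega> = Suc k})
        = space M - {\<omega> \<in> space M. cluster_size (Suc h) \<omega> = 0}"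
      by (auto, metis not0_implies_Suc)
    also have "prob \<dots> = 1 - ?P h 0" by (subst prob_compl) auto
    finally show ?thesis .
  qed
  have "?P h 0 = ?P 0 0"
    using sums_unique2[OF Z[of h, unfolded S[of h]] Z[of 0]] by simp
  then have P: "?P h k = ?P 0 k" for k using S[of h] by (cases k) simp_all
  show ?thesis unfolding i
  proof (rule measure_eqI_countable[where A = UNIV])
    fix k :: nat
    show "emeasure (distr M (count_space UNIV) (cluster_size (Suc h))) {k}
      = emeasure (distr M (count_space UNIV) (cluster_size 1)) {k}"
      using P[of k] by (simp add: emeasure_distr cluster_size_measurable vimage_def Int_def conj_commute
          emeasure_eq_measure)
  qed auto
qed

lemma expectation_cluster_size:
  fixes g :: "nat \<Rightarrow> real"
  assumes "1 \<le> i"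
  shows "expectation (\<lambda>\<omega>. g (cluster_size i \<omega>)) = expectation (\<lambda>\<omega>. g (cluster_size 1 \<omega>))"
    and "integrable M (\<lambda>\<omega>. g (cluster_size i \<omega>)) \<longleftrightarrow> integrable M (\<lambda>\<omega>. g (cluster_size 1 \<omega>))"
proof -
  have m: "cluster_size i \<in> M \<rightarrow>\<^sub>M count_space UNIV" if "1 \<le> i" for i
    using cluster_size_measurable[of "i - 1"] that by simp
  show "expectation (\<lambda>\<omega>. g (cluster_size i \<omega>)) = expectation (\<lambda>\<omega>. g (cluster_size 1 \<omega>))"
    using integral_distr[OF m[OF assms], of g] integral_distr[OF m, of 1 g] distr_cluster_size[OF assms] by simp
  show "integrable M (\<lambda>\<omega>. g (cluster_size i \<omega>)) \<longleftrightarrow> integrable M (\<lambda>\<omega>. g (cluster_size 1 \<omega>))"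
    using integrable_distr_eq[OF m[OF assms], of g] integrable_distr_eq[OF m, of 1 g] distr_cluster_size[OF assms] by simp
qed

text \<open>
As \<open>g\<close> vanishes at 0, conditioning on the start of a run amounts to division by its probability.
\<close>

lemma nn_integral_Z_law:
  assumes "g 0 = 0"
  shows "(\<integral>\<^sup>+z. g z \<partial>Z_law M X u 1) = (\<integral>\<^sup>+\<omega>. g (cluster_size 1 \<omega>) \<partial>M) / emeasure M (run_start M X u 1)"
proof -
  have m: "run_length X u 1 \<in> M \<rightarrow>\<^sub>M count_space UNIV" using run_length_measurable[of 0] by simp
  have "(\<integral>\<^sup>+z. g z \<partial>Z_law M X u 1) = (\<integral>\<^sup>+\<omega>. g (run_length X u 1 \<omega>) \<partial>uniform_measure M (run_start M X u 1))"
    unfolding Z_law_def using m by (subst nn_integral_distr) auto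
  also have "\<dots> = (\<integral>\<^sup>+\<omega>. g (run_length X u 1 \<omega>) * indicator (run_start M X u 1) \<omega> \<partial>M) / emeasure M (run_start M X u 1)"
    using run_start_event[of 0] m by (intro nn_integral_uniform_measure) (auto intro: measurable_compose)
  also have "(\<integral>\<^sup>+\<omega>. g (run_length X u 1 \<omega>) * indicator (run_start M X u 1) \<omega> \<partial>M) = (\<integral>\<^sup>+\<omega>. g (cluster_size 1 \<omega>) \<partial>M)"
    using assms by (intro nn_integral_cong) (auto simp: cluster_size_def indicator_def)
  finally show ?thesis .
qed

lemma window_event[measurable]: "{\<omega> \<in> space M. \<exists>i\<in>{h+1..h+L}. upcrossing X u i \<omega>} \<in> events"
  and prob_window: "prob {\<omega> \<in> space M. \<exists>i\<in>{h+1..h+L}. upcrossing X u i \<omega>}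
    = prob {\<omega> \<in> space M. \<exists>i\<in>{1..L}. upcrossing X u i \<omega>}"
proof -
  have "(\<exists>i\<in>{h+1..h+L}. upcrossing X u i \<omega>) \<longleftrightarrow> pattern X u h (L + 1) \<omega> \<in> {W. \<exists>i\<in>{1..L}. up_in W i}" for h \<omega>
  proof -
    have "(\<exists>i\<in>{h+1..h+L}. upcrossing X u i \<omega>) \<longleftrightarrow> (\<exists>i\<in>{1..L}. upcrossing X u (i + h) \<omega>)"
    proof
      assume "\<exists>i\<in>{h+1..h+L}. upcrossing X u i \<omega>"
      then obtain i where "i \<in> {h+1..h+L}" "upcrossing X u i \<omega>" by blast
      then show "\<exists>i\<in>{1..L}. upcrossing X u (i + h) \<omega>" by (intro bexI[of _ "i - h"]) auto
    next
      assume "\<exists>i\<in>{1..L}. upcrossing X u (i + h) \<omega>"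
      then obtain i where "i \<in> {1..L}" "upcrossing X u (i + h) \<omega>" by blast
      then show "\<exists>i\<in>{h+1..h+L}. upcrossing X u i \<omega>" by (intro bexI[of _ "i + h"]) auto
    qed
    also have "\<dots> \<longleftrightarrow> (\<exists>i\<in>{1..L}. up_in (pattern X u h (L + 1) \<omega>) i)"
      by (intro bex_cong refl) (auto simp: up_in_pattern)
    finally show ?thesis by simp
  qed
  note * = this
  have w0: "(\<exists>i\<in>{1..L}. upcrossing X u i \<omega>) \<longleftrightarrow> pattern X u 0 (L + 1) \<omega> \<in> {W. \<exists>i\<in>{1..L}. up_in W i}" for \<omega>
    using *[of 0] unfolding add_0 .
  show "{\<omega> \<in> space M. \<exists>i\<in>{h+1..h+L}. upcrossing X u i \<omega>} \<in> events"
    unfolding * by (rule pattern_event)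
  show "prob {\<omega> \<in> space M. \<exists>i\<in>{h+1..h+L}. upcrossing X u i \<omega>}
    = prob {\<omega> \<in> space M. \<exists>i\<in>{1..L}. upcrossing X u i \<omega>}"
    unfolding * w0 by (rule prob_pattern_shift)
qed

lemma prob_window_le: "prob {\<omega> \<in> space M. \<exists>i\<in>{h+1..h+L}. upcrossing X u i \<omega>}
    \<le> real L * prob {\<omega> \<in> space M. upcrossing X u 1 \<omega>}"
proof -
  have "{\<omega> \<in> space M. \<exists>i\<in>{h+1..h+L}. upcrossing X u i \<omega>} = (\<Union>i\<in>{h+1..h+L}. {\<omega> \<in> space M. upcrossing X u i \<omega>})"
    by auto
  then have "prob {\<omega> \<in> space M. \<exists>i\<in>{h+1..h+L}. upcrossing X u i \<omega>} \<le> (\<Sum>i\<in>{h+1..h+L}. prob {\<omega> \<in> space M. upcrossing X u i \<omega>})"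
    by (simp only:) (rule measure_UNION_le, auto intro!: upcrossing_event')
  also have "\<dots> = (\<Sum>i\<in>{h+1..h+L}. prob {\<omega> \<in> space M. upcrossing X u 1 \<omega>})"
    by (intro sum.cong refl prob_upcrossing) auto
  finally show ?thesis by simp
qed

end

locale finite_run_process = stationary_process +
  assumes finite_runs: "(\<lambda>j. prob {\<omega> \<in> space M. \<forall>i\<in>{2..j}. X (2 * i - 1) \<omega> \<le> u \<and> u < X (2 * i) \<omega>}) \<longlonglongrightarrow> 0"
begin

lemma prob_runs_tendsto: "(\<lambda>j. prob (runs h j)) \<longlonglongrightarrow> 0"
proof -
  have "{\<omega> \<in> space M. \<forall>i\<in>{2..Suc j}. X (2 * i - 1) \<omega> \<le> u \<and> u < X (2 * i) \<omega>} = runs 2 j" for j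
  proof -
    have r: "(\<forall>i\<in>{2..Suc j}. P i) \<longleftrightarrow> (\<forall>q<j. P (q + 2))" for P :: "nat \<Rightarrow> bool"
    proof
      assume *: "\<forall>q<j. P (q + 2)"
      show "\<forall>i\<in>{2..Suc j}. P i"
      proof
        fix i assume "i \<in> {2..Suc j}"
        then have "i - 2 < j" "i - 2 + 2 = i" by auto
        then show "P i" using * by metis
      qed
    qed auto
    have n: "2 * (q + 2) - 1 = 2 + 1 + 2 * q" "2 * (q + 2) = 2 + 1 + 2 * q + 1" for q :: nat by auto
    show ?thesis unfolding runs_def upcrossing_def r n(1) unfolding n(2) by (rule refl)
  qed
  then have "(\<lambda>j. prob (runs 2 j)) \<longlonglongrightarrow> 0"
    using LIMSEQ_Suc[OF finite_runs] by (simp only:)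
  then show ?thesis by (simp only: prob_runs[of h] prob_runs[of 2])
qed

text \<open>
Infinite runs have probability 0. For a finite run, \<open>runs (h + 2) j\<close> holds exactly if the run
starting at \<open>Suc h\<close> has length at least \<open>j\<close>.
\<close>

lemma AE_cluster_size: "AE \<omega> in M. \<forall>h. \<omega> \<in> run_start M X u (Suc h) \<longrightarrow>
    (\<forall>j. \<omega> \<in> runs (h + 2) j \<longleftrightarrow> j \<le> cluster_size (Suc h) \<omega>)"
proof (subst AE_all_countable, intro allI)
  fix h
  have "prob (\<Inter>j. runs (h + 2) j) = 0"
  proof (rule antisym)
    show "prob (\<Inter>j. runs (h + 2) j) \<le> 0"
    proof (rule LIMSEQ_le_const[OF prob_runs_tendsto[of "h + 2"]], intro exI allI impI)
      show "prob (\<Inter>j. runs (h + 2) j) \<le> prob (runs (h + 2) n)" for n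
        by (rule finite_measure_mono) (blast, rule runs_event)
    qed
  qed simp
  then have "AE \<omega> in M. \<omega> \<notin> (\<Inter>j. runs (h + 2) j)"
  proof (intro AE_not_in null_setsI)
    show "(\<Inter>j. runs (h + 2) j) \<in> events" by (rule sets.countable_INT) auto
  qed (simp add: emeasure_eq_measure)
  then show "AE \<omega> in M. \<omega> \<in> run_start M X u (Suc h) \<longrightarrow>
    (\<forall>j. \<omega> \<in> runs (h + 2) j \<longleftrightarrow> j \<le> cluster_size (Suc h) \<omega>)"
  proof (eventually_elim, intro impI allI)
    fix \<omega> j assume nr: "\<omega> \<notin> (\<Inter>j. runs (h + 2) j)" and st: "\<omega> \<in> run_start M X u (Suc h)"
    have sp: "\<omega> \<in> space M" using st by (simp add: run_start_iff)
    have up: "upcrossing X u (Suc h + 2 * Suc q) \<omega> \<longleftrightarrow> upcrossing X u (h + 2 + 1 + 2 * q) \<omega>" for q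
      by (simp add: numeral_3_eq_3)
    have runs: "\<omega> \<in> runs (h + 2) j \<longleftrightarrow> (\<forall>q\<in>{1..j}. upcrossing X u (Suc h + 2 * q) \<omega>)" for j
    proof -
      have "(\<forall>q\<in>{1..j}. P q) \<longleftrightarrow> (\<forall>q<j. P (Suc q))" for P :: "nat \<Rightarrow> bool"
        unfolding image_Suc_lessThan[symmetric] by blast
      then show ?thesis using sp unfolding runs_def up[symmetric] by simp
    qed
    from nr obtain j0 where "\<omega> \<notin> runs (h + 2) j0" by auto
    then obtain q where "q \<in> {1..j0}" "\<not> upcrossing X u (Suc h + 2 * q) \<omega>" using runs by auto
    then have "\<not> upcrossing X u (Suc h + 2 * Suc (q - 1)) \<omega>" by (cases q) auto
    from run_exists[OF this] obtain k where k: "run_of_length X u (Suc h) k \<omega>" by auto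
    then show "\<omega> \<in> runs (h + 2) j \<longleftrightarrow> j \<le> cluster_size (Suc h) \<omega>"
      unfolding runs run_of_length_ge_iff[OF k] cluster_size_def run_length_eqI[OF k] using st by simp
  qed
qed

lemma AE_run_start_iff: "AE \<omega> in M. \<forall>h. \<omega> \<in> run_start M X u (Suc h) \<longleftrightarrow> cluster_size (Suc h) \<omega> > 0"
  using AE_cluster_size
proof (eventually_elim, intro allI)
  fix \<omega> h assume *: "\<forall>h. \<omega> \<in> run_start M X u (Suc h) \<longrightarrow> (\<forall>j. \<omega> \<in> runs (h + 2) j \<longleftrightarrow> j \<le> cluster_size (Suc h) \<omega>)"
  show "\<omega> \<in> run_start M X u (Suc h) \<longleftrightarrow> cluster_size (Suc h) \<omega> > 0"
  proof
    assume st: "\<omega> \<in> run_start M X u (Suc h)"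
    have "\<omega> \<in> runs (h + 2) 1"
      using st unfolding runs_def run_start_iff less_one by simp
    then have "1 \<le> cluster_size (Suc h) \<omega>" using * st by blast
    then show "cluster_size (Suc h) \<omega> > 0" by simp
  qed (simp add: cluster_size_def split: if_splits)
qed

text \<open>
Let \<open>q j\<close> be the probability of \<open>j\<close> upcrossings in a row, two indices apart. For a run that starts at 1
to be longer than \<open>j\<close>, a row of \<open>j + 1\<close> upcrossings must begin at 3 and not be extended to a row of
\<open>j + 2\<close> by one at 1. This has probability \<open>q (j + 1) - q (j + 2)\<close>, and the sum over \<open>j\<close> telescopes to
\<open>q 1\<close>, because \<open>q\<close> tends to 0.
\<close>

lemma nn_integral_cluster_size:
  "(\<integral>\<^sup>+\<omega>. ennreal (real (cluster_size 1 \<omega>)) \<partial>M) = ennreal (prob {\<omega> \<in> space M. upcrossing X u 1 \<omega>})"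
proof -
  let ?A = "run_start M X u 1"
  have A[measurable]: "?A \<in> events" using run_start_event[of 0] by simp
  have "(\<integral>\<^sup>+\<omega>. ennreal (real (cluster_size 1 \<omega>)) \<partial>M) = (\<integral>\<^sup>+\<omega>. (\<Sum>j. indicator (?A \<inter> runs 2 (Suc j)) \<omega>) \<partial>M)"
  proof (rule nn_integral_cong_AE, use AE_cluster_size in eventually_elim)
    fix \<omega> assume *: "\<forall>h. \<omega> \<in> run_start M X u (Suc h) \<longrightarrow> (\<forall>j. \<omega> \<in> runs (h + 2) j \<longleftrightarrow> j \<le> cluster_size (Suc h) \<omega>)"
    have "(indicator (?A \<inter> runs 2 (Suc j)) \<omega> :: ennreal) = (if j < cluster_size 1 \<omega> then 1 else 0)" for j
      using *[rule_format, of 0] by (auto simp: cluster_size_def indicator_def numeral_2_eq_2)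
    then have "(\<Sum>j. indicator (?A \<inter> runs 2 (Suc j)) \<omega> :: ennreal) = (\<Sum>j<cluster_size 1 \<omega>. 1)"
      by (subst suminf_finite[of "{..<cluster_size 1 \<omega>}"]) auto
    then show "ennreal (real (cluster_size 1 \<omega>)) = (\<Sum>j. indicator (?A \<inter> runs 2 (Suc j)) \<omega>)"
      by (simp add: ennreal_of_nat_eq_real_of_nat)
  qed
  also have "\<dots> = (\<Sum>j. \<integral>\<^sup>+\<omega>. indicator (?A \<inter> runs 2 (Suc j)) \<omega> \<partial>M)"
    by (rule nn_integral_suminf) auto
  also have "\<dots> = (\<Sum>j. ennreal (prob (runs 0 (Suc j)) - prob (runs 0 (Suc (Suc j)))))"
  proof (intro suminf_cong)
    fix j
    have r: "\<omega> \<in> runs 0 (Suc (Suc j)) \<longleftrightarrow> \<omega> \<in> runs 2 (Suc j) \<and> upcrossing X u 1 \<omega>" for \<omega>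
    proof -
      have n: "0 + 1 + 2 * Suc q = 2 + 1 + 2 * q" "0 + 1 + 2 * 0 = (1::nat)" for q :: nat by simp_all
      show ?thesis unfolding runs_def All_less_Suc2[of "Suc j"] mem_Collect_eq n by blast
    qed
    then have i: "runs 0 (Suc (Suc j)) \<subseteq> runs 2 (Suc j)" by blast
    have "?A \<inter> runs 2 (Suc j) = runs 2 (Suc j) - runs 0 (Suc (Suc j))"
    proof (intro set_eqI)
      fix \<omega>
      have "\<omega> \<in> runs 2 (Suc j) \<Longrightarrow> \<omega> \<in> space M \<and> upcrossing X u (2 + 1 + 2 * 0) \<omega>"
        unfolding runs_def by blast
      then have "\<omega> \<in> runs 2 (Suc j) \<Longrightarrow> \<omega> \<in> space M \<and> upcrossing X u (1 + 2) \<omega>"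
        unfolding mult_0_right add_0_right by (simp only: add.commute)
      then show "\<omega> \<in> ?A \<inter> runs 2 (Suc j) \<longleftrightarrow> \<omega> \<in> runs 2 (Suc j) - runs 0 (Suc (Suc j))"
        using r[of \<omega>] unfolding Int_iff Diff_iff run_start_iff by blast
    qed
    then have "prob (?A \<inter> runs 2 (Suc j)) = prob (runs 2 (Suc j)) - prob (runs 0 (Suc (Suc j)))"
      by (simp only:) (rule finite_measure_Diff[OF runs_event runs_event i])
    then have "prob (?A \<inter> runs 2 (Suc j)) = prob (runs 0 (Suc j)) - prob (runs 0 (Suc (Suc j)))"
      by (simp only: prob_runs[of 2])
    then show "(\<integral>\<^sup>+\<omega>. indicator (?A \<inter> runs 2 (Suc j)) \<omega> \<partial>M) = ennreal (prob (runs 0 (Suc j)) - prob (runs 0 (Suc (Suc j))))"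
      by (subst nn_integral_indicator) (simp_all add: emeasure_eq_measure)
  qed
  also have "\<dots> = ennreal (prob (runs 0 1))"
  proof (rule suminf_ennreal_eq)
    show "0 \<le> prob (runs 0 (Suc j)) - prob (runs 0 (Suc (Suc j)))" for j
      using finite_measure_mono[of "runs 0 (Suc (Suc j))" "runs 0 (Suc j)"] by (simp add: runs_def Collect_mono_iff less_SucI)
    show "(\<lambda>j. prob (runs 0 (Suc j)) - prob (runs 0 (Suc (Suc j)))) sums prob (runs 0 1)"
      using telescope_sums'[OF LIMSEQ_Suc[OF prob_runs_tendsto[of 0]]] by (simp only: diff_zero One_nat_def)
  qed
  also have "runs 0 1 = {\<omega> \<in> space M. upcrossing X u 1 \<omega>}"
    unfolding runs_def less_one by simp
  finally show ?thesis .
qed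

end

section \<open>Moments of a block\<close>

context stationary_process begin

lemma N_hat_measurable[measurable]: "N_hat M X u n r \<in> borel_measurable M"
  unfolding N_hat_def[abs_def]
  by (intro borel_measurable_sum borel_measurable_indicator run_start_event') auto

lemma N_bar_cluster_size: "N_bar M X u n r \<omega> = (\<Sum>i=1..min r (n - 3). real (cluster_size i \<omega>))"
  unfolding N_bar_def by (intro sum.cong) (auto simp: cluster_size_def)

lemma cluster_size_measurable': "1 \<le> i \<Longrightarrow> cluster_size i \<in> M \<rightarrow>\<^sub>M count_space UNIV"
  using cluster_size_measurable[of "i - 1"] by simp

lemma cluster_size_borel: "1 \<le> i \<Longrightarrow> (\<lambda>\<omega>. g (cluster_size i \<omega>)) \<in> borel_measurable M"
  by (rule measurable_compose[OF cluster_size_measurable']) auto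

lemma sum_cluster_size_borel:
  fixes g :: "nat \<Rightarrow> real"
  shows "(\<lambda>\<omega>. \<Sum>i=1..m. g (cluster_size i \<omega>)) \<in> borel_measurable M"
  by (intro borel_measurable_sum cluster_size_borel) auto

lemma N_bar_measurable[measurable]: "N_bar M X u n r \<in> borel_measurable M"
  unfolding N_bar_cluster_size[abs_def] by (intro borel_measurable_sum cluster_size_borel) auto

lemma N_bar_nonneg: "N_bar M X u n r \<omega> \<ge> 0" and N_hat_nonneg: "N_hat M X u n r \<omega> \<ge> 0"
  unfolding N_bar_def N_hat_def by (auto intro!: sum_nonneg)

end

context finite_run_process begin

abbreviation "up_prob \<equiv> prob {\<omega> \<in> space M. upcrossing X u 1 \<omega>}"
abbreviation "start_prob \<equiv> prob (run_start M X u 1)"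

lemma cluster_size_mean:
  "integrable M (\<lambda>\<omega>. real (cluster_size 1 \<omega>))" "expectation (\<lambda>\<omega>. real (cluster_size 1 \<omega>)) = up_prob"
proof -
  have m: "(\<lambda>\<omega>. real (cluster_size 1 \<omega>)) \<in> borel_measurable M" by (rule cluster_size_borel) simp
  show "integrable M (\<lambda>\<omega>. real (cluster_size 1 \<omega>))"
    using m nn_integral_cluster_size by (intro integrableI_nonneg) auto
  show "expectation (\<lambda>\<omega>. real (cluster_size 1 \<omega>)) = up_prob"
    using m nn_integral_cluster_size by (subst integral_eq_nn_integral) auto
qed

lemma start_prob_eq:
  "expectation (\<lambda>\<omega>. of_bool (cluster_size 1 \<omega> > 0)) = start_prob"
proof -
  have "expectation (\<lambda>\<omega>. of_bool (cluster_size 1 \<omega> > 0)) = expectation (indicator (run_start M X u 1) :: 'a \<Rightarrow> real)"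
  proof (rule integral_cong_AE)
    show "AE \<omega> in M. of_bool (0 < cluster_size 1 \<omega>) = (indicator (run_start M X u 1) \<omega> :: real)"
      using AE_run_start_iff
    proof eventually_elim
      fix \<omega> assume "\<forall>h. \<omega> \<in> run_start M X u (Suc h) \<longleftrightarrow> cluster_size (Suc h) \<omega> > 0"
      from this[rule_format, of 0]
      show "of_bool (0 < cluster_size 1 \<omega>) = (indicator (run_start M X u 1) \<omega> :: real)"
        by (simp add: indicator_def)
    qed
  qed (auto intro!: cluster_size_borel borel_measurable_indicator run_start_event')
  then show ?thesis using run_start_event'[of 1] by simp
qed

lemma AE_N_hat: "AE \<omega> in M. \<forall>n r. N_hat M X u n r \<omega> = (\<Sum>i=1..min r (n - 3). of_bool (cluster_size i \<omega> > 0))"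
  using AE_run_start_iff
proof eventually_elim
  case (elim \<omega>)
  have "\<omega> \<in> run_start M X u i \<longleftrightarrow> cluster_size i \<omega> > 0" if "1 \<le> i" for i
    using elim[rule_format, of "i - 1"] that by simp
  then show ?case by (auto simp: N_hat_def indicator_def intro!: sum.cong)
qed

lemma expectation_sum_cluster:
  fixes g :: "nat \<Rightarrow> real"
  assumes "integrable M (\<lambda>\<omega>. g (cluster_size 1 \<omega>))"
  shows "integrable M (\<lambda>\<omega>. \<Sum>i=1..m. g (cluster_size i \<omega>))"
    and "expectation (\<lambda>\<omega>. \<Sum>i=1..m. g (cluster_size i \<omega>)) = real m * expectation (\<lambda>\<omega>. g (cluster_size 1 \<omega>))"
proof -
  have i: "integrable M (\<lambda>\<omega>. g (cluster_size i \<omega>))" if "i \<in> {1..m}" for i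
    using expectation_cluster_size(2)[of i g] assms that by simp
  show "integrable M (\<lambda>\<omega>. \<Sum>i=1..m. g (cluster_size i \<omega>))"
    by (intro Bochner_Integration.integrable_sum i)
  have "expectation (\<lambda>\<omega>. \<Sum>i=1..m. g (cluster_size i \<omega>)) = (\<Sum>i=1..m. expectation (\<lambda>\<omega>. g (cluster_size i \<omega>)))"
    by (rule Bochner_Integration.integral_sum[OF i])
  also have "\<dots> = (\<Sum>i=1..m. expectation (\<lambda>\<omega>. g (cluster_size 1 \<omega>)))"
    by (intro sum.cong refl expectation_cluster_size(1)) auto
  finally show "expectation (\<lambda>\<omega>. \<Sum>i=1..m. g (cluster_size i \<omega>)) = real m * expectation (\<lambda>\<omega>. g (cluster_size 1 \<omega>))"
    by simp
qed

lemma of_bool_integrable: "integrable M (\<lambda>\<omega>. of_bool (cluster_size 1 \<omega> > 0) :: real)"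
  using cluster_size_borel[of 1 "\<lambda>m. of_bool (m > 0)"] by (intro integrable_const_bound[of _ 1]) auto

lemma expectation_N_hat: "expectation (N_hat M X u n r) = real (min r (n - 3)) * start_prob"
proof -
  have "expectation (N_hat M X u n r) = expectation (\<lambda>\<omega>. \<Sum>i=1..min r (n - 3). of_bool (cluster_size i \<omega> > 0))"
    by (rule integral_cong_AE[OF N_hat_measurable sum_cluster_size_borel])
       (use AE_N_hat in \<open>eventually_elim, blast\<close>)
  also have "\<dots> = real (min r (n - 3)) * start_prob"
    using expectation_sum_cluster(2)[OF of_bool_integrable] start_prob_eq by simp
  finally show ?thesis .
qed

lemma expectation_N_bar: "expectation (N_bar M X u n r) = real (min r (n - 3)) * up_prob"
  unfolding N_bar_cluster_size[abs_def] expectation_sum_cluster(2)[OF cluster_size_mean(1)] cluster_size_mean(2) ..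

abbreviation "excess n r \<equiv> expectation (\<lambda>\<omega>. (N_bar M X u n r \<omega>)\<^sup>2 * of_bool (N_hat M X u n r \<omega> > 1))"

text \<open>
Up to \<open>excess\<close>, the moments of the block sum are \<open>r\<close> times those of one cluster of size \<open>V\<close>, whose
contribution is \<open>1 - \<theta> * V\<close> if \<open>V > 0\<close> and 0 otherwise.
\<close>

lemma block_moments:
  fixes \<theta> K :: real
  assumes r: "r \<le> n - 3" and sq: "integrable M (\<lambda>\<omega>. (real (cluster_size 1 \<omega>))\<^sup>2)" and \<theta>: "\<bar>\<theta>\<bar> \<le> K"
  defines "S \<equiv> \<lambda>\<omega>. N_hat M X u n r \<omega> - \<theta> * N_bar M X u n r \<omega>"
    and "V2 \<equiv> expectation (\<lambda>\<omega>. (real (cluster_size 1 \<omega>))\<^sup>2)"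
  shows "integrable M (\<lambda>\<omega>. (S \<omega>)\<^sup>2)" "integrable M (\<lambda>\<omega>. (N_bar M X u n r \<omega>)\<^sup>2)"
    and "expectation S = real r * (start_prob - \<theta> * up_prob)"
    and "\<bar>expectation (\<lambda>\<omega>. (S \<omega>)\<^sup>2) - real r * (start_prob - 2 * \<theta> * up_prob + \<theta>\<^sup>2 * V2)\<bar> \<le> (1 + K)\<^sup>2 * excess n r"
    and "expectation (\<lambda>\<omega>. (S \<omega>)\<^sup>2 * of_bool ((S \<omega>)\<^sup>2 > \<epsilon>)) \<le> (1 + K)\<^sup>2 * excess n r +
      real r * ((1 + K)\<^sup>2 * expectation (\<lambda>\<omega>. (real (cluster_size 1 \<omega>))\<^sup>2 * of_bool ((1 + K)\<^sup>2 * (real (cluster_size 1 \<omega>))\<^sup>2 > \<epsilon>)))"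
proof -
  define f where "f m = (if m > 0 then 1 - \<theta> * real m else 0)" for m :: nat
  have K: "K \<ge> 0" using \<theta> by linarith
  have minr: "min r (n - 3) = r" using r by simp
  let ?Q = "\<lambda>\<omega>. \<Sum>i=1..r. (f (cluster_size i \<omega>))\<^sup>2"
  let ?QL = "\<lambda>\<omega>. \<Sum>i=1..r. (f (cluster_size i \<omega>))\<^sup>2 * of_bool ((f (cluster_size i \<omega>))\<^sup>2 > \<epsilon>)"
  let ?G = "\<lambda>\<omega>. (N_bar M X u n r \<omega>)\<^sup>2 * of_bool (N_hat M X u n r \<omega> > 1)"
  note m1[measurable] = cluster_size_measurable'[of 1, simplified]
  have S_meas[measurable]: "S \<in> borel_measurable M" unfolding S_def by measurable
  have f_eq: "f m = of_bool (m > 0) - \<theta> * real m" for m by (simp add: f_def)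
  have S_eq: "AE \<omega> in M. S \<omega> = (\<Sum>i=1..r. f (cluster_size i \<omega>)) \<and>
      N_hat M X u n r \<omega> = (\<Sum>i=1..r. of_bool (cluster_size i \<omega> > 0))"
    using AE_N_hat
  proof eventually_elim
    case (elim \<omega>)
    then have "N_hat M X u n r \<omega> = (\<Sum>i=1..r. of_bool (cluster_size i \<omega> > 0))" using minr by metis
    then show ?case by (simp add: S_def f_eq N_bar_cluster_size minr sum_subtractf sum_distrib_left)
  qed
  have B_int: "integrable M (\<lambda>\<omega>. (N_bar M X u n r \<omega>)\<^sup>2)"
  proof (rule Bochner_Integration.integrable_bound)
    show "integrable M (\<lambda>\<omega>. real r * (\<Sum>i=1..r. (real (cluster_size i \<omega>))\<^sup>2))"
      using expectation_sum_cluster(1)[of "\<lambda>m. (real m)\<^sup>2" r] sq by simp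
    show "AE \<omega> in M. norm ((N_bar M X u n r \<omega>)\<^sup>2) \<le> norm (real r * (\<Sum>i=1..r. (real (cluster_size i \<omega>))\<^sup>2))"
    proof (rule AE_I2)
      fix \<omega>
      have "(\<Sum>i=1..r. real (cluster_size i \<omega>))\<^sup>2 \<le> real (card {1..r}) * (\<Sum>i=1..r. (real (cluster_size i \<omega>))\<^sup>2)"
        using sum_squared_le_sum_of_squares[where I="{1..r}" and f="\<lambda>i. real (cluster_size i \<omega>)"] by (simp add: mult.commute)
      moreover have "0 \<le> (\<Sum>i=1..r. (real (cluster_size i \<omega>))\<^sup>2)" by (intro sum_nonneg) auto
      ultimately show "norm ((N_bar M X u n r \<omega>)\<^sup>2) \<le> norm (real r * (\<Sum>i=1..r. (real (cluster_size i \<omega>))\<^sup>2))"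
        by (simp add: N_bar_cluster_size minr)
    qed
  qed measurable
  then show "integrable M (\<lambda>\<omega>. (N_bar M X u n r \<omega>)\<^sup>2)" .
  have G_int: "integrable M ?G"
    by (rule Bochner_Integration.integrable_bound[OF B_int]) auto
  have f1: "integrable M (\<lambda>\<omega>. f (cluster_size 1 \<omega>))"
    unfolding f_eq using of_bool_integrable cluster_size_mean(1) by auto
  have f2_eq: "(f m)\<^sup>2 = of_bool (m > 0) - 2 * \<theta> * real m + \<theta>\<^sup>2 * (real m)\<^sup>2" for m
    by (simp add: f_def power2_eq_square algebra_simps)
  have f2: "integrable M (\<lambda>\<omega>. (f (cluster_size 1 \<omega>))\<^sup>2)"
    unfolding f2_eq using of_bool_integrable cluster_size_mean(1) sq by auto
  have Ef2: "expectation (\<lambda>\<omega>. (f (cluster_size 1 \<omega>))\<^sup>2) = start_prob - 2 * \<theta> * up_prob + \<theta>\<^sup>2 * V2"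
    unfolding f2_eq V2_def using of_bool_integrable cluster_size_mean sq start_prob_eq by simp
  have fL: "integrable M (\<lambda>\<omega>. (f (cluster_size 1 \<omega>))\<^sup>2 * of_bool ((f (cluster_size 1 \<omega>))\<^sup>2 > \<epsilon>))"
    by (rule Bochner_Integration.integrable_bound[OF f2])
       (auto intro!: cluster_size_borel[of 1 "\<lambda>m. (f m)\<^sup>2 * of_bool ((f m)\<^sup>2 > \<epsilon>)", simplified])
  have Q_int: "integrable M ?Q" and EQ: "expectation ?Q = real r * (start_prob - 2 * \<theta> * up_prob + \<theta>\<^sup>2 * V2)"
    by (rule expectation_sum_cluster(1)[OF f2], simp only: expectation_sum_cluster(2)[of "\<lambda>m. (f m)\<^sup>2", OF f2, of r] Ef2)
  have QL_int: "integrable M ?QL" and EQL: "expectation ?QL = real r *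
      expectation (\<lambda>\<omega>. (f (cluster_size 1 \<omega>))\<^sup>2 * of_bool ((f (cluster_size 1 \<omega>))\<^sup>2 > \<epsilon>))"
    using expectation_sum_cluster[of "\<lambda>m. (f m)\<^sup>2 * of_bool ((f m)\<^sup>2 > \<epsilon>)", OF fL, of r] by simp_all
  have pw: "AE \<omega> in M. \<bar>(S \<omega>)\<^sup>2 - ?Q \<omega>\<bar> \<le> (1 + K)\<^sup>2 * ?G \<omega> \<and>
      (S \<omega>)\<^sup>2 * of_bool ((S \<omega>)\<^sup>2 > \<epsilon>) \<le> (1 + K)\<^sup>2 * ?G \<omega> + ?QL \<omega>"
    using S_eq
  proof eventually_elim
    case (elim \<omega>)
    from sum_square_vs_square_sum[of "{1..r}" \<theta> K "\<lambda>i. cluster_size i \<omega>"] \<theta>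
    show ?case unfolding conjunct1[OF elim] conjunct2[OF elim] N_bar_cluster_size minr f_def by blast
  qed
  show S2: "integrable M (\<lambda>\<omega>. (S \<omega>)\<^sup>2)"
  proof (rule Bochner_Integration.integrable_bound)
    show "integrable M (\<lambda>\<omega>. (1 + K)\<^sup>2 * ?G \<omega> + ?Q \<omega>)" using G_int Q_int by auto
    show "AE \<omega> in M. norm ((S \<omega>)\<^sup>2) \<le> norm ((1 + K)\<^sup>2 * ?G \<omega> + ?Q \<omega>)"
      using pw
    proof eventually_elim
      case (elim \<omega>)
      have "0 \<le> (S \<omega>)\<^sup>2" by simp
      then show ?case using conjunct1[OF elim] unfolding real_norm_def abs_le_iff by linarith
    qed
  qed measurable
  have "expectation S = expectation (\<lambda>\<omega>. \<Sum>i=1..r. f (cluster_size i \<omega>))"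
    by (rule integral_cong_AE[OF S_meas sum_cluster_size_borel]) (use S_eq in \<open>eventually_elim, blast\<close>)
  also have "\<dots> = real r * (start_prob - \<theta> * up_prob)"
    using expectation_sum_cluster(2)[of f, OF f1, of r] of_bool_integrable cluster_size_mean start_prob_eq
    by (simp add: f_eq)
  finally show "expectation S = real r * (start_prob - \<theta> * up_prob)" .
  have "\<bar>expectation (\<lambda>\<omega>. (S \<omega>)\<^sup>2) - expectation ?Q\<bar> = \<bar>expectation (\<lambda>\<omega>. (S \<omega>)\<^sup>2 - ?Q \<omega>)\<bar>"
    using S2 Q_int by simp
  also have "\<dots> \<le> expectation (\<lambda>\<omega>. \<bar>(S \<omega>)\<^sup>2 - ?Q \<omega>\<bar>)" by (rule integral_abs_bound)
  also have "\<dots> \<le> expectation (\<lambda>\<omega>. (1 + K)\<^sup>2 * ?G \<omega>)"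
    by (rule integral_mono_AE) (use S2 Q_int G_int pw in \<open>auto elim: eventually_mono\<close>)
  also have "\<dots> = (1 + K)\<^sup>2 * excess n r" by (rule integral_mult_right_zero)
  finally show "\<bar>expectation (\<lambda>\<omega>. (S \<omega>)\<^sup>2) - real r * (start_prob - 2 * \<theta> * up_prob + \<theta>\<^sup>2 * V2)\<bar> \<le> (1 + K)\<^sup>2 * excess n r"
    unfolding EQ .
  have SL: "integrable M (\<lambda>\<omega>. (S \<omega>)\<^sup>2 * of_bool ((S \<omega>)\<^sup>2 > \<epsilon>))"
    by (rule Bochner_Integration.integrable_bound[OF S2]) auto
  have vL: "integrable M (\<lambda>\<omega>. (real (cluster_size 1 \<omega>))\<^sup>2 * of_bool ((1 + K)\<^sup>2 * (real (cluster_size 1 \<omega>))\<^sup>2 > \<epsilon>))"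
    by (rule Bochner_Integration.integrable_bound[OF sq])
       (auto intro!: cluster_size_borel[of 1 "\<lambda>m. (real m)\<^sup>2 * of_bool ((1 + K)\<^sup>2 * (real m)\<^sup>2 > \<epsilon>)", simplified])
  have "expectation (\<lambda>\<omega>. (S \<omega>)\<^sup>2 * of_bool ((S \<omega>)\<^sup>2 > \<epsilon>)) \<le> expectation (\<lambda>\<omega>. (1 + K)\<^sup>2 * ?G \<omega> + ?QL \<omega>)"
    by (rule integral_mono_AE) (use SL QL_int G_int pw in \<open>auto elim: eventually_mono\<close>)
  also have "\<dots> = (1 + K)\<^sup>2 * excess n r + expectation ?QL"
    using G_int QL_int by simp
  also have "expectation ?QL \<le> real r * ((1 + K)\<^sup>2 * expectation (\<lambda>\<omega>. (real (cluster_size 1 \<omega>))\<^sup>2 * of_bool ((1 + K)\<^sup>2 * (real (cluster_size 1 \<omega>))\<^sup>2 > \<epsilon>)))"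
    unfolding EQL integral_mult_right_zero[symmetric]
  proof (intro mult_left_mono integral_mono fL integrable_mult_right vL)
    fix \<omega>
    let ?v = "cluster_size 1 \<omega>"
    have "\<bar>f ?v\<bar> \<le> (1 + K) * real ?v"
      unfolding f_def by (rule cluster_weight_bound[OF \<theta>])
    from power_mono[OF this abs_ge_zero, of 2] have "(f ?v)\<^sup>2 \<le> (1 + K)\<^sup>2 * (real ?v)\<^sup>2" by (simp add: power_mult_distrib)
    then show "(f ?v)\<^sup>2 * of_bool (\<epsilon> < (f ?v)\<^sup>2) \<le> (1 + K)\<^sup>2 * ((real ?v)\<^sup>2 * of_bool (\<epsilon> < (1 + K)\<^sup>2 * (real ?v)\<^sup>2))"
      by (auto simp: of_bool_def)
  qed simp
  finally show "expectation (\<lambda>\<omega>. (S \<omega>)\<^sup>2 * of_bool ((S \<omega>)\<^sup>2 > \<epsilon>)) \<le> (1 + K)\<^sup>2 * excess n r +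
      real r * ((1 + K)\<^sup>2 * expectation (\<lambda>\<omega>. (real (cluster_size 1 \<omega>))\<^sup>2 * of_bool ((1 + K)\<^sup>2 * (real (cluster_size 1 \<omega>))\<^sup>2 > \<epsilon>)))"
    by simp
qed

end

section \<open>Factorization over the blocks\<close>

lemma (in prob_space) norm_expectation_diff_le:
  fixes f g :: "'a \<Rightarrow> complex"
  assumes f: "f \<in> borel_measurable M" "\<And>\<omega>. norm (f \<omega>) \<le> 1"
    and g: "g \<in> borel_measurable M" "\<And>\<omega>. norm (g \<omega>) \<le> 1"
    and D: "D \<in> events" and eq: "\<And>\<omega>. \<omega> \<in> space M \<Longrightarrow> \<omega> \<notin> D \<Longrightarrow> f \<omega> = g \<omega>"
  shows "norm (expectation f - expectation g) \<le> 2 * prob D"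
proof -
  have fi: "integrable M f" and gi: "integrable M g"
    using f g by (auto intro!: integrable_const_bound[of _ 1])
  have "norm (expectation f - expectation g) = norm (expectation (\<lambda>\<omega>. f \<omega> - g \<omega>))"
    using fi gi by simp
  also have "\<dots> \<le> expectation (\<lambda>\<omega>. norm (f \<omega> - g \<omega>))" by (rule integral_norm_bound)
  also have "\<dots> \<le> expectation (\<lambda>\<omega>. 2 * indicator D \<omega>)"
  proof (rule integral_mono)
    fix \<omega> assume w: "\<omega> \<in> space M"
    have "norm (f \<omega> - g \<omega>) \<le> 2"
      using norm_triangle_ineq4[of "f \<omega>" "g \<omega>"] f(2)[of \<omega>] g(2)[of \<omega>] by linarith
    then show "norm (f \<omega> - g \<omega>) \<le> 2 * indicator D \<omega>"
      using eq[OF w] by (cases "\<omega> \<in> D") auto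
  qed (use fi gi D in \<open>auto simp: emeasure_eq_measure\<close>)
  also have "\<dots> = 2 * prob D" using D by simp
  finally show ?thesis .
qed

context stationary_process begin

lemma upcrossing_process_pos_iff:
  assumes "n \<ge> 1"
  shows "upcrossing_process X u n {0..real_of_int l / real n} \<omega> > 0 \<longleftrightarrow>
    (\<exists>i\<in>{1..n-1}. upcrossing X u i \<omega> \<and> int i \<le> l)"
proof -
  have "real i / real n \<in> {0..real_of_int l / real n} \<longleftrightarrow> int i \<le> l" for i
  proof -
    have "real i / real n \<le> real_of_int l / real n \<longleftrightarrow> real i \<le> real_of_int l"
      using assms by (simp add: divide_le_cancel)
    also have "\<dots> \<longleftrightarrow> int i \<le> l" by linarith
    finally show ?thesis by simp
  qed
  then have ind: "indicator {0..real_of_int l / real n} (real i / real n) = (of_bool (int i \<le> l) :: nat)" for i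
    unfolding indicator_def by simp
  have "upcrossing_process X u n {0..real_of_int l / real n} \<omega>
    = (\<Sum>i=1..n-1. of_bool (upcrossing X u i \<omega>) * of_bool (int i \<le> l))"
    unfolding upcrossing_process_def ind ..
  also have "\<dots> > 0 \<longleftrightarrow> (\<exists>i\<in>{1..n-1}. upcrossing X u i \<omega> \<and> int i \<le> l)"
    by (subst zero_less_iff_neq_zero, subst sum_eq_0_iff) auto
  finally show ?thesis .
qed

abbreviation "early_prob n l \<equiv> prob {\<omega> \<in> space M. upcrossing_process X u n {0..real_of_int l / real n} \<omega> > 0}"
abbreviation "window_prob L \<equiv> prob {\<omega> \<in> space M. \<exists>i\<in>{1..L}. upcrossing X u i \<omega>}"

lemma early_event:
  assumes "n \<ge> 1"
  shows "{\<omega> \<in> space M. upcrossing_process X u n {0..real_of_int l / real n} \<omega> > 0} \<in> events"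
proof -
  have "{\<omega> \<in> space M. upcrossing_process X u n {0..real_of_int l / real n} \<omega> > 0}
    = (\<Union>i\<in>{i\<in>{1..n-1}. int i \<le> l}. {\<omega> \<in> space M. upcrossing X u i \<omega>})"
    unfolding upcrossing_process_pos_iff[OF assms] by auto
  also have "\<dots> \<in> events" by (intro sets.finite_UN upcrossing_event') auto
  finally show ?thesis .
qed

lemma window_prob_le_early:
  assumes "n \<ge> 1" "m \<le> n - 1" "int m \<le> l"
  shows "window_prob m \<le> early_prob n l"
  by (rule finite_measure_mono[OF _ early_event[OF assms(1)]])
     (use assms in \<open>auto simp: upcrossing_process_pos_iff[OF assms(1)]\<close>)

text \<open>
There cannot be upcrossings at both 1 and 2.
\<close>

lemma prob_upcrossing_le_half: "prob {\<omega> \<in> space M. upcrossing X u 1 \<omega>} \<le> 1 / 2"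
proof -
  let ?E = "\<lambda>i. {\<omega> \<in> space M. upcrossing X u i \<omega>}"
  have "prob (?E 1 \<union> ?E 2) = prob (?E 1) + prob (?E 2)"
    by (intro finite_measure_Union upcrossing_event') (auto simp: upcrossing_def numeral_2_eq_2)
  also have "prob (?E 2) = prob (?E 1)" by (rule prob_upcrossing) simp
  finally show ?thesis using prob_le_1[of "?E 1 \<union> ?E 2"] by linarith
qed

text \<open>
If \<open>l \<ge> 1\<close>, an upcrossing at 1 is counted by the process on \<open>[0, l / n]\<close>. Otherwise the gap \<open>l - 2\<close> is
negative enough for the event \<open>E\<close> of an upcrossing at 1 to belong to both sigma-fields, so that
\<open>P(E) - P(E)\<^sup>2 \<ge> P(E) / 2\<close> is bounded by the mixing coefficient.
\<close>

lemma prob_upcrossing_le_mixing: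
  assumes n: "n \<ge> 2"
  shows "prob {\<omega> \<in> space M. upcrossing X u 1 \<omega>} \<le> 2 * (mixing_coeff M X u n (l - 2) + early_prob n l)"
proof (cases "l \<ge> 1")
  case True
  have "prob {\<omega> \<in> space M. upcrossing X u 1 \<omega>} \<le> early_prob n l"
    using window_prob_le_early[of n 1 l] n True by simp
  moreover have "a \<le> 2 * (b + c)" if "a \<le> c" "0 \<le> b" "0 \<le> c" for a b c :: real using that by (simp add: algebra_simps)
  ultimately show ?thesis using mixing_coeff_nonneg[OF prob_space_axioms] measure_nonneg by blast
next
  case False
  let ?E = "{\<omega> \<in> space M. upcrossing X u 1 \<omega>}"
  have E: "?E \<in> level_sigma_field M X u 1 2"
    using pattern_in_level_sigma_field[of M X u 0 2 "{W. up_in W 1}"] by (simp add: up_in_pattern)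
  have "\<bar>prob (?E \<inter> ?E) - prob ?E * prob ?E\<bar> \<le> mixing_coeff M X u n (l - 2)"
  proof (rule mixing_coeff_upper[OF prob_space_axioms, of 2])
    show "?E \<in> level_sigma_field M X u (2 + (l - 2)) (int n)"
      using E level_sigma_field_mono[of "2 + (l - 2)" 1 2 "int n" M X u] False n by auto
  qed (use E False n in auto)
  moreover have "prob ?E * prob ?E \<le> prob ?E * (1 / 2)"
    by (intro mult_left_mono prob_upcrossing_le_half) simp
  moreover have "a \<le> 2 * b + 2 * c" if "\<bar>a - s\<bar> \<le> b" "s \<le> a * (1 / 2)" "0 \<le> c" for a b c s :: real
    using that by simp
  ultimately show ?thesis unfolding Int_absorb distrib_left using measure_nonneg by blast
qed

lemma window_prob_le:
  assumes n: "n \<ge> 1" and L: "L = nat (max l c)" "L \<le> n - 1"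
  shows "window_prob L \<le> early_prob n l + real (nat c) * prob {\<omega> \<in> space M. upcrossing X u 1 \<omega>}"
proof (cases "l \<ge> 1 \<and> l \<ge> c")
  case True
  then have "window_prob L \<le> early_prob n l" using n L by (intro window_prob_le_early) auto
  then show ?thesis by (smt (verit) measure_nonneg mult_nonneg_nonneg of_nat_0_le_iff)
next
  case False
  then have "L = nat c \<or> L = 0" using L by auto
  then have "L \<le> nat c" by auto
  have "window_prob L \<le> real L * prob {\<omega> \<in> space M. upcrossing X u 1 \<omega>}"
    using prob_window_le[of 0 L] by simp
  also have "\<dots> \<le> real (nat c) * prob {\<omega> \<in> space M. upcrossing X u 1 \<omega>}"
    using \<open>L \<le> nat c\<close> by (intro mult_right_mono) auto
  finally show ?thesis 
    using measure_nonneg[of M "{\<omega> \<in> space M. upcrossing_process X u n {0..real_of_int l / real n} \<omega> > 0}"] by linarith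
qed

text \<open>
An upcrossing in the gap at the end of some block, or in the incomplete block after the last one,
which has fewer than \<open>k\<close> indices if \<open>r = n div k\<close>.
\<close>

definition bad_event :: "nat \<Rightarrow> nat \<Rightarrow> nat \<Rightarrow> 'a set" where
  "bad_event k r L = (\<Union>j<k. {\<omega> \<in> space M. \<exists>i\<in>{(j * r + r - L + 2) + 1..(j * r + r - L + 2) + L}. upcrossing X u i \<omega>})
     \<union> {\<omega> \<in> space M. \<exists>i\<in>{(k * r + 2) + 1..(k * r + 2) + k}. upcrossing X u i \<omega>}"

lemma bad_event_event[measurable]: "bad_event k r L \<in> events"
  unfolding bad_event_def by (intro sets.Un sets.finite_UN window_event) auto

lemma prob_bad_event:
  "prob (bad_event k r L) \<le> real k * (window_prob L + prob {\<omega> \<in> space M. upcrossing X u 1 \<omega>})"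
proof -
  let ?W = "\<lambda>j. {\<omega> \<in> space M. \<exists>i\<in>{(j * r + r - L + 2) + 1..(j * r + r - L + 2) + L}. upcrossing X u i \<omega>}"
  let ?R = "{\<omega> \<in> space M. \<exists>i\<in>{(k * r + 2) + 1..(k * r + 2) + k}. upcrossing X u i \<omega>}"
  have "prob (bad_event k r L) \<le> prob (\<Union>j<k. ?W j) + prob ?R"
    unfolding bad_event_def by (intro measure_Un_le sets.finite_UN window_event) auto
  also have "prob (\<Union>j<k. ?W j) \<le> (\<Sum>j<k. prob (?W j))"
    by (intro measure_UNION_le window_event) auto
  also have "(\<Sum>j<k. prob (?W j)) = (\<Sum>j<k. window_prob L)" by (intro sum.cong refl prob_window)
  also have "prob ?R \<le> real k * prob {\<omega> \<in> space M. upcrossing X u 1 \<omega>}" by (rule prob_window_le)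
  finally show ?thesis by (simp add: algebra_simps)
qed

lemma block_sums_nonneg: "block_starts s W \<ge> 0" "block_runs s W \<ge> 0"
  by (auto simp: block_starts_def block_runs_def intro!: sum_nonneg)

text \<open>
The multiplicativity of \<open>F\<close> admits both \<open>exp (i t (a - \<theta> b))\<close>, which gives characteristic functions,
and the indicator of \<open>a = 0\<close>, which gives the probability that there is no cluster.
\<close>

lemma functional_factorization:
  fixes F :: "real \<Rightarrow> real \<Rightarrow> complex"
  assumes L: "3 \<le> L" "L \<le> r" and k: "k \<ge> 1" and r: "r = n div k" "r \<le> n - 3"
    and F1: "\<And>a b. norm (F a b) \<le> 1" and F0: "F 0 0 = 1"
    and Fadd: "\<And>a b a' b'. 0 \<le> a \<Longrightarrow> 0 \<le> b \<Longrightarrow> 0 \<le> a' \<Longrightarrow> 0 \<le> b' \<Longrightarrow> F (a + a') (b + b') = F a b * F a' b'"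
    and Fm: "\<And>r. (\<lambda>\<omega>. F (N_hat M X u n r \<omega>) (N_bar M X u n r \<omega>)) \<in> borel_measurable M"
  shows "norm ((\<integral>\<omega>. F (N_hat M X u n n \<omega>) (N_bar M X u n n \<omega>) \<partial>M)
      - (\<integral>\<omega>. F (N_hat M X u n r \<omega>) (N_bar M X u n r \<omega>) \<partial>M) ^ k)
    \<le> real k * (4 * window_prob L + 2 * prob {\<omega> \<in> space M. upcrossing X u 1 \<omega>}
        + 8 * mixing_coeff M X u n (int L - 2))"
proof -
  let ?s = "r - L" and ?m = "r - L + 3"
  define H where "H W = F (block_starts ?s W) (block_runs ?s W)" for W
  have H1: "norm (H W) \<le> 1" for W by (simp add: H_def F1)
  have kr: "k * r \<le> n" and rest: "n < k * r + k"
  proof -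
    have "k * r + n mod k = n" "n mod k < k" using k r by auto
    then show "k * r \<le> n" "n < k * r + k" by linarith+
  qed
  have prodH: "(\<Prod>j<J. H (p j)) = F (\<Sum>j<J. block_starts ?s (p j)) (\<Sum>j<J. block_runs ?s (p j))" for J :: nat and p
    by (induct J) (auto simp: F0 H_def Fadd[symmetric] sum_nonneg block_sums_nonneg)
  have off: "F (N_hat M X u n n \<omega>) (N_bar M X u n n \<omega>) = (\<Prod>j<k. H (pattern X u (j * r) ?m \<omega>))"
    if w: "\<omega> \<in> space M" "\<omega> \<notin> bad_event k r L" for \<omega>
  proof -
    have gap: "\<not> upcrossing X u i \<omega>" if "j < k" "j * r + r - L + 2 < i" "i \<le> j * r + r + 2" for i j
    proof
      assume "upcrossing X u i \<omega>"
      moreover have "i \<in> {(j * r + r - L + 2) + 1..(j * r + r - L + 2) + L}" using that L by auto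
      ultimately show False using w that(1) unfolding bad_event_def by blast
    qed
    have rst: "\<not> upcrossing X u i \<omega>" if "k * r + 2 < i" "i < n" for i
    proof
      assume "upcrossing X u i \<omega>"
      moreover have "i \<in> {(k * r + 2) + 1..(k * r + 2) + k}" using that rest by auto
      ultimately show False using w unfolding bad_event_def by blast
    qed
    show ?thesis unfolding prodH
      using global_sums_eq_pattern[OF L kr k w(1) gap rst] by simp
  qed
  have Hm: "(\<lambda>\<omega>. \<Prod>j<k. H (pattern X u (j * r) ?m \<omega>)) \<in> borel_measurable M"
    by (intro borel_measurable_prod borel_measurable_pattern_fun)
  have Hp1: "norm (\<Prod>j<k. H (pattern X u (j * r) ?m \<omega>)) \<le> 1" for \<omega>
    unfolding prod_norm[symmetric] by (rule prod_le_1) (use H1 in auto)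
  have 1: "norm ((\<integral>\<omega>. F (N_hat M X u n n \<omega>) (N_bar M X u n n \<omega>) \<partial>M) - (\<integral>\<omega>. (\<Prod>j<k. H (pattern X u (j * r) ?m \<omega>)) \<partial>M))
      \<le> 2 * prob (bad_event k r L)"
    by (rule norm_expectation_diff_le[OF Fm F1 Hm Hp1 bad_event_event off])
  have 2: "norm ((\<integral>\<omega>. (\<Prod>j<k. H (pattern X u (j * r) ?m \<omega>)) \<partial>M) - (\<integral>\<omega>. H (pattern X u 0 ?m \<omega>) \<partial>M) ^ k)
      \<le> real k * (8 * mixing_coeff M X u n (int L - 2))"
    using L by (intro block_factorization[OF H1] kr) auto
  let ?W = "{\<omega> \<in> space M. \<exists>i\<in>{(r - L + 2) + 1..(r - L + 2) + L}. upcrossing X u i \<omega>}"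
  have single: "H (pattern X u 0 ?m \<omega>) = F (N_hat M X u n r \<omega>) (N_bar M X u n r \<omega>)"
    if "\<omega> \<in> space M" "\<omega> \<notin> ?W" for \<omega>
  proof -
    have "\<not> upcrossing X u i \<omega>" if "0 + r - L + 2 < i" "i \<le> 0 + r + 2" for i
    proof -
      have "i \<in> {(r - L + 2) + 1..(r - L + 2) + L}" using that L by auto
      with \<open>\<omega> \<notin> ?W\<close> \<open>\<omega> \<in> space M\<close> show ?thesis by blast
    qed
    from block_sums_eq_pattern[OF _ L(2) \<open>\<omega> \<in> space M\<close>, of 0, OF _ this] L
    show ?thesis using r(2) by (simp add: H_def N_hat_def N_bar_def min_absorb1)
  qed
  have "norm ((\<integral>\<omega>. H (pattern X u 0 ?m \<omega>) \<partial>M) - (\<integral>\<omega>. F (N_hat M X u n r \<omega>) (N_bar M X u n r \<omega>) \<partial>M)) \<le> 2 * prob ?W"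
    by (rule norm_expectation_diff_le[OF borel_measurable_pattern_fun H1 Fm F1 window_event single])
  also have "prob ?W = window_prob L" by (rule prob_window)
  finally have 3: "norm ((\<integral>\<omega>. H (pattern X u 0 ?m \<omega>) \<partial>M) - (\<integral>\<omega>. F (N_hat M X u n r \<omega>) (N_bar M X u n r \<omega>) \<partial>M)) \<le> 2 * window_prob L" .
  have le1: "norm (\<integral>\<omega>. f \<omega> \<partial>M) \<le> 1" if "f \<in> borel_measurable M" "\<And>\<omega>. norm (f \<omega>) \<le> 1" for f :: "'a \<Rightarrow> complex"
  proof -
    have "norm (\<integral>\<omega>. f \<omega> \<partial>M) \<le> (\<integral>\<omega>. norm (f \<omega>) \<partial>M)" by (rule integral_norm_bound)
    also have "\<dots> \<le> (\<integral>\<omega>. 1 \<partial>M)"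
      using that by (intro integral_mono integrable_norm integrable_const_bound[of _ 1]) auto
    finally show ?thesis by (simp add: prob_space)
  qed
  have "norm ((\<integral>\<omega>. H (pattern X u 0 ?m \<omega>) \<partial>M) ^ k - (\<integral>\<omega>. F (N_hat M X u n r \<omega>) (N_bar M X u n r \<omega>) \<partial>M) ^ k)
    \<le> real k * norm ((\<integral>\<omega>. H (pattern X u 0 ?m \<omega>) \<partial>M) - (\<integral>\<omega>. F (N_hat M X u n r \<omega>) (N_bar M X u n r \<omega>) \<partial>M))"
    by (intro norm_power_diff le1 borel_measurable_pattern_fun H1 Fm F1)
  also have "\<dots> \<le> real k * (2 * window_prob L)" by (intro mult_left_mono 3) simp
  finally have 4: "norm ((\<integral>\<omega>. H (pattern X u 0 ?m \<omega>) \<partial>M) ^ k - (\<integral>\<omega>. F (N_hat M X u n r \<omega>) (N_bar M X u n r \<omega>) \<partial>M) ^ k)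
      \<le> real k * (2 * window_prob L)" .
  have "norm ((\<integral>\<omega>. F (N_hat M X u n n \<omega>) (N_bar M X u n n \<omega>) \<partial>M)
      - (\<integral>\<omega>. F (N_hat M X u n r \<omega>) (N_bar M X u n r \<omega>) \<partial>M) ^ k)
    \<le> 2 * prob (bad_event k r L) + (real k * (8 * mixing_coeff M X u n (int L - 2)) + real k * (2 * window_prob L))"
    by (rule norm_diff_triangle_le[OF 1 norm_diff_triangle_le[OF 2 4]])
  also have "\<dots> \<le> 2 * (real k * (window_prob L + prob {\<omega> \<in> space M. upcrossing X u 1 \<omega>}))
     + (real k * (8 * mixing_coeff M X u n (int L - 2)) + real k * (2 * window_prob L))"
    using prob_bad_event[of k r L] by linarith
  also have "\<dots> = real k * (4 * window_prob L + 2 * prob {\<omega> \<in> space M. upcrossing X u 1 \<omega>}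
        + 8 * mixing_coeff M X u n (int L - 2))"
    by (simp add: algebra_simps)
  finally show ?thesis .
qed

end

context finite_run_process begin

lemma AE_N_hat_le_N_bar: "AE \<omega> in M. \<forall>n r. N_hat M X u n r \<omega> \<le> N_bar M X u n r \<omega>"
  using AE_N_hat
proof eventually_elim
  case (elim \<omega>)
  show ?case unfolding elim[rule_format] N_bar_cluster_size by (intro allI sum_mono) (auto simp: of_bool_def)
qed

text \<open>
\<open>N_hat\<close> exceeds the indicator of \<open>N_hat > 0\<close> only where \<open>N_hat > 1\<close>, and there it is
almost surely at most \<open>N_bar\<^sup>2\<close>.
\<close>

lemma prob_N_hat_pos:
  assumes r: "r \<le> n - 3" and sq: "integrable M (\<lambda>\<omega>. (real (cluster_size 1 \<omega>))\<^sup>2)"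
  shows "real r * start_prob - excess n r \<le> prob {\<omega> \<in> space M. N_hat M X u n r \<omega> > 0}"
proof -
  let ?E = "{\<omega> \<in> space M. N_hat M X u n r \<omega> > 0}"
  let ?G = "\<lambda>\<omega>. (N_bar M X u n r \<omega>)\<^sup>2 * of_bool (N_hat M X u n r \<omega> > 1)"
  have E[measurable]: "?E \<in> events" by measurable
  have G: "integrable M ?G"
    by (rule Bochner_Integration.integrable_bound[OF block_moments(2)[OF r sq order_refl]]) auto
  have N: "integrable M (N_hat M X u n r)"
  proof (rule integrable_const_bound[of _ "real (min r (n - 3))"])
    show "AE \<omega> in M. norm (N_hat M X u n r \<omega>) \<le> real (min r (n - 3))"
      using sum_bounded_above[of "{1..min r (n - 3)}" "\<lambda>i. indicator (run_start M X u i) _ :: real" 1] N_hat_nonneg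
      by (intro AE_I2) (auto simp: N_hat_def indicator_def)
  qed simp
  have "real r * start_prob = expectation (N_hat M X u n r)" using r by (simp add: expectation_N_hat)
  also have "\<dots> \<le> expectation (\<lambda>\<omega>. indicator ?E \<omega> + ?G \<omega>)"
  proof (rule integral_mono_AE)
    show "AE \<omega> in M. N_hat M X u n r \<omega> \<le> indicator ?E \<omega> + ?G \<omega>"
      using AE_N_hat_le_N_bar AE_space
    proof eventually_elim
      case (elim \<omega>)
      then have le: "N_hat M X u n r \<omega> \<le> N_bar M X u n r \<omega>" by blast
      show ?case
      proof (cases "N_hat M X u n r \<omega> > 1")
        case True
        have "N_hat M X u n r \<omega> \<le> N_bar M X u n r \<omega> * 1" using le by simp
        also have "\<dots> \<le> N_bar M X u n r \<omega> * N_bar M X u n r \<omega>" using le True by (intro mult_left_mono) auto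
        finally show ?thesis using True elim by (simp add: power2_eq_square)
      qed (use elim in \<open>auto simp: indicator_def not_less\<close>)
    qed
  qed (use N G E in \<open>auto simp: emeasure_eq_measure\<close>)
  also have "\<dots> = prob ?E + excess n r" using G E by (simp add: emeasure_eq_measure)
  finally show ?thesis by simp
qed

lemma prob_N_hat_pos_le_window: 
  "prob {\<omega> \<in> space M. N_hat M X u n r \<omega> > 0} \<le> window_prob r"
proof -
  have "{\<omega> \<in> space M. N_hat M X u n r \<omega> > 0} \<subseteq> {\<omega> \<in> space M. \<exists>i\<in>{2+1..2+r}. upcrossing X u i \<omega>}"
  proof safe
    fix \<omega> assume w: "\<omega> \<in> space M" and pos: "N_hat M X u n r \<omega> > 0"
    have "\<exists>i\<in>{1..min r (n - 3)}. \<omega> \<in> run_start M X u i"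
    proof (rule ccontr)
      assume "\<not> ?thesis"
      then have "N_hat M X u n r \<omega> = 0" unfolding N_hat_def by (intro sum.neutral) auto
      then show False using pos by simp
    qed
    then obtain i where "i \<in> {1..r}" "\<omega> \<in> run_start M X u i" by auto
    then show "\<exists>i\<in>{2+1..2+r}. upcrossing X u i \<omega>"
      by (intro bexI[of _ "i + 2"]) (auto simp: run_start_iff)
  qed
  then have "prob {\<omega> \<in> space M. N_hat M X u n r \<omega> > 0} \<le> prob {\<omega> \<in> space M. \<exists>i\<in>{2+1..2+r}. upcrossing X u i \<omega>}"
    by (rule finite_measure_mono[OF _ window_event])
  then show ?thesis unfolding prob_window .
qed

lemma char_factorization:
  fixes \<theta> t :: real
  assumes "3 \<le> L" "L \<le> r" "k \<ge> 1" "r = n div k" "r \<le> n - 3"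
  shows "norm ((CLINT \<omega>|M. iexp (t * (N_hat M X u n n \<omega> - \<theta> * N_bar M X u n n \<omega>)))
      - (CLINT \<omega>|M. iexp (t * (N_hat M X u n r \<omega> - \<theta> * N_bar M X u n r \<omega>))) ^ k)
    \<le> real k * (4 * window_prob L + 2 * up_prob + 8 * mixing_coeff M X u n (int L - 2))"
  by (rule functional_factorization[OF assms, where F="\<lambda>a b. iexp (t * (a - \<theta> * b))"])
     (auto simp: exp_add[symmetric] algebra_simps)

lemma prob_N_bar_zero:
  assumes L: "3 \<le> L" "L \<le> r" and k: "k \<ge> 1" and r: "r = n div k" "r \<le> n - 3"
    and sq: "integrable M (\<lambda>\<omega>. (real (cluster_size 1 \<omega>))\<^sup>2)"
  shows "prob {\<omega> \<in> space M. N_bar M X u n n \<omega> = 0} \<le> exp (- (real k * (real r * start_prob - excess n r)))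
    + real k * (4 * window_prob L + 2 * up_prob + 8 * mixing_coeff M X u n (int L - 2))"
proof -
  let ?Z = "\<lambda>r. {\<omega> \<in> space M. N_hat M X u n r \<omega> = 0}"
  have Z[measurable]: "?Z r \<in> events" for r by measurable
  have EZ: "(\<integral>\<omega>. of_bool (N_hat M X u n r \<omega> = 0) \<partial>M) = complex_of_real (prob (?Z r))" for r
  proof -
    have "(\<integral>\<omega>. of_bool (N_hat M X u n r \<omega> = 0) \<partial>M) = (\<integral>\<omega>. complex_of_real (indicator (?Z r) \<omega>) \<partial>M)"
      by (intro Bochner_Integration.integral_cong) (auto simp: indicator_def)
    then show ?thesis using Z[of r] by simp
  qed
  have "prob {\<omega> \<in> space M. N_bar M X u n n \<omega> = 0} \<le> prob (?Z n)"
  proof (rule finite_measure_mono_AE)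
    show "AE \<omega> in M. \<omega> \<in> {\<omega> \<in> space M. N_bar M X u n n \<omega> = 0} \<longrightarrow> \<omega> \<in> ?Z n"
      using AE_N_hat_le_N_bar
    proof eventually_elim
      case (elim \<omega>)
      then have "N_hat M X u n n \<omega> \<le> N_bar M X u n n \<omega>" by blast
      then show ?case using N_hat_nonneg[of n n \<omega>] by auto
    qed
  qed simp
  also have "prob (?Z n) \<le> prob (?Z r) ^ k + real k * (4 * window_prob L + 2 * up_prob + 8 * mixing_coeff M X u n (int L - 2))"
  proof -
    have "norm ((\<integral>\<omega>. of_bool (N_hat M X u n n \<omega> = 0) \<partial>M) - (\<integral>\<omega>. of_bool (N_hat M X u n r \<omega> = 0) \<partial>M) ^ k :: complex)
      \<le> real k * (4 * window_prob L + 2 * up_prob + 8 * mixing_coeff M X u n (int L - 2))"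
      by (rule functional_factorization[OF L k r, where F="\<lambda>a b. of_bool (a = 0)"]) (auto simp: add_nonneg_eq_0_iff)
    then have "\<bar>prob (?Z n) - prob (?Z r) ^ k\<bar> \<le> real k * (4 * window_prob L + 2 * up_prob + 8 * mixing_coeff M X u n (int L - 2))"
      unfolding EZ of_real_power[symmetric] of_real_diff[symmetric] norm_of_real .
    then show ?thesis by linarith
  qed
  also have "prob (?Z r) ^ k \<le> exp (- (real k * (real r * start_prob - excess n r)))"
  proof -
    have "?Z r = space M - {\<omega> \<in> space M. N_hat M X u n r \<omega> > 0}"
      using N_hat_nonneg by (auto simp: less_le)
    then have "prob (?Z r) = 1 - prob {\<omega> \<in> space M. N_hat M X u n r \<omega> > 0}"
      by (simp only:) (rule prob_compl, measurable)
    also have "\<dots> \<le> 1 + - (real r * start_prob - excess n r)" using prob_N_hat_pos[OF r(2) sq] by simp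
    also have "\<dots> \<le> exp (- (real r * start_prob - excess n r))" by (rule exp_ge_add_one_self)
    finally have "prob (?Z r) ^ k \<le> exp (- (real r * start_prob - excess n r)) ^ k" by (intro power_mono) auto
    then show ?thesis unfolding exp_of_nat_mult[symmetric] mult_minus_right .
  qed
  finally show ?thesis by simp
qed

end

section \<open>The limit theorem for a sequence of levels\<close>

locale level_sequence = prob_space M for M :: "'a measure" +
  fixes X :: "nat \<Rightarrow> 'a \<Rightarrow> real" and v c :: "nat \<Rightarrow> real" and k r :: "nat \<Rightarrow> nat"
  assumes stationary_X: "stationary M X"
    and c_at_top: "filterlim c at_top sequentially"
    and k_at_top: "filterlim k at_top sequentially"
    and finite_runs_ev: "\<forall>\<^sub>F n in sequentially. finite_run_process M X (v n)"
begin

lemma stationary_process_v: "stationary_process M X"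
  by unfold_locales (rule stationary_X)

abbreviation "crossing_prob n \<equiv> prob {\<omega> \<in> space M. upcrossing X (v n) 1 \<omega>}"
abbreviation "cluster_prob n \<equiv> prob (run_start M X (v n) 1)"
abbreviation "csize n \<omega> \<equiv> real (stationary_process.cluster_size M X (v n) 1 \<omega>)"
abbreviation "Nh n m \<equiv> N_hat M X (v n) n m"
abbreviation "Nb n m \<equiv> N_bar M X (v n) n m"
abbreviation "multi_moment n \<equiv> expectation (\<lambda>\<omega>. (Nb n (r n) \<omega>)\<^sup>2 * of_bool (Nh n (r n) \<omega> > 1))"
abbreviation "mean_ratio n \<equiv> expectation (Nh n n) / expectation (Nb n n)"

lemma Nh_measurable[measurable]: "Nh n m \<in> borel_measurable M"
  and Nb_measurable[measurable]: "Nb n m \<in> borel_measurable M"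
  and Nb_nonneg: "Nb n m \<omega> \<ge> 0"
proof -
  interpret stationary_process M X "v n" by (rule stationary_process_v)
  show "Nh n m \<in> borel_measurable M" "Nb n m \<in> borel_measurable M" "Nb n m \<omega> \<ge> 0"
    by (rule N_hat_measurable N_bar_measurable N_bar_nonneg)+
qed

lemma c_pos: "\<forall>\<^sub>F n in sequentially. c n > 0"
  using c_at_top by (simp add: filterlim_at_top_dense)

end

text \<open>
There are about \<open>\<nu> * c n\<close> upcrossings, in clusters of mean size \<open>1 / \<eta>\<close>, and the blocks with
several clusters are negligible to second order.
\<close>

locale cluster_asymptotics = level_sequence +
  fixes \<nu> \<eta> \<sigma> :: real
  assumes \<nu>: "\<nu> > 0" and \<eta>: "\<eta> > 0"
    and crossing_rate: "(\<lambda>n. real n * crossing_prob n / c n) \<longlonglongrightarrow> \<nu>"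
    and cluster_rate: "(\<lambda>n. cluster_prob n / crossing_prob n) \<longlonglongrightarrow> \<eta>"
    and block_length: "(\<lambda>n. real (k n) * real (r n) / real n) \<longlonglongrightarrow> 1"
    and r_le: "\<forall>\<^sub>F n in sequentially. r n \<le> n - 3"
    and square_integrable: "\<forall>\<^sub>F n in sequentially. integrable M (\<lambda>\<omega>. (csize n \<omega>)\<^sup>2)"
    and second_moment: "(\<lambda>n. expectation (\<lambda>\<omega>. (csize n \<omega>)\<^sup>2) / cluster_prob n) \<longlonglongrightarrow> \<sigma>\<^sup>2"
    and large_clusters: "\<And>\<epsilon>. \<epsilon> > 0 \<Longrightarrow>
      (\<lambda>n. expectation (\<lambda>\<omega>. (csize n \<omega>)\<^sup>2 * of_bool ((csize n \<omega>)\<^sup>2 > \<epsilon> * c n)) / cluster_prob n) \<longlonglongrightarrow> 0"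
    and multi: "(\<lambda>n. real (k n) * multi_moment n / c n) \<longlonglongrightarrow> 0"
begin

lemma crossing_prob_pos: "\<forall>\<^sub>F n in sequentially. crossing_prob n > 0"
  using order_tendstoD(1)[OF crossing_rate \<nu>] c_pos
  by eventually_elim (auto simp: zero_less_divide_iff zero_less_mult_iff)

lemma cluster_prob_pos: "\<forall>\<^sub>F n in sequentially. cluster_prob n > 0"
  using order_tendstoD(1)[OF cluster_rate \<eta>] crossing_prob_pos
  by eventually_elim (auto simp: zero_less_divide_iff)

lemma block_crossing_rate: "(\<lambda>n. real (k n) * real (r n) * crossing_prob n / c n) \<longlonglongrightarrow> \<nu>"
proof -
  have "(\<lambda>n. (real (k n) * real (r n) / real n) * (real n * crossing_prob n / c n)) \<longlonglongrightarrow> \<nu>"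
    using tendsto_mult[OF block_length crossing_rate] by simp
  moreover have "\<forall>\<^sub>F n in sequentially. (real (k n) * real (r n) / real n) * (real n * crossing_prob n / c n)
     = real (k n) * real (r n) * crossing_prob n / c n"
    using eventually_gt_at_top[of 0] by eventually_elim simp
  ultimately show ?thesis by (rule Lim_transform_eventually)
qed

lemma block_cluster_rate: "(\<lambda>n. real (k n) * real (r n) * cluster_prob n / c n) \<longlonglongrightarrow> \<nu> * \<eta>"
proof -
  have "(\<lambda>n. (real (k n) * real (r n) * crossing_prob n / c n) * (cluster_prob n / crossing_prob n)) \<longlonglongrightarrow> \<nu> * \<eta>"
    by (intro tendsto_mult block_crossing_rate cluster_rate)
  moreover have "\<forall>\<^sub>F n in sequentially. (real (k n) * real (r n) * crossing_prob n / c n) * (cluster_prob n / crossing_prob n)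
     = real (k n) * real (r n) * cluster_prob n / c n"
    using crossing_prob_pos by eventually_elim simp
  ultimately show ?thesis by (rule Lim_transform_eventually)
qed

text \<open>
This bounds from below the expected number of blocks that contain a cluster.
\<close>

lemma nonempty_blocks_at_top:
  "filterlim (\<lambda>n. real (k n) * (real (r n) * cluster_prob n - multi_moment n)) at_top sequentially"
proof -
  have "(\<lambda>n. real (k n) * real (r n) * cluster_prob n / c n - real (k n) * multi_moment n / c n) \<longlonglongrightarrow> \<nu> * \<eta> - 0"
    by (intro tendsto_diff block_cluster_rate multi)
  then have A: "filterlim (\<lambda>n. (real (k n) * real (r n) * cluster_prob n / c n - real (k n) * multi_moment n / c n) * c n) at_top sequentially"
    using \<nu> \<eta> by (intro filterlim_tendsto_pos_mult_at_top[OF _ _ c_at_top, of _ "\<nu> * \<eta>"]) auto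
  have alg: "(m * q * p / z - m * g / z) * z = m * (q * p - g)" if "z > 0" for m q p g z :: real
    using that by (simp add: field_simps)
  have E: "\<forall>\<^sub>F n in sequentially. (real (k n) * real (r n) * cluster_prob n / c n - real (k n) * multi_moment n / c n) * c n
     = real (k n) * (real (r n) * cluster_prob n - multi_moment n)"
    using c_pos by eventually_elim (rule alg)
  show ?thesis by (rule iffD1[OF filterlim_cong[OF refl refl E] A])
qed

lemma mean_ratio_eq: "\<forall>\<^sub>F n in sequentially. mean_ratio n = cluster_prob n / crossing_prob n"
  using finite_runs_ev eventually_gt_at_top[of 3]
proof eventually_elim
  case (elim n)
  interpret finite_run_process M X "v n" by fact
  show ?case using elim(2) by (simp add: expectation_N_hat expectation_N_bar)
qed

lemma mean_ratio_tendsto: "mean_ratio \<longlonglongrightarrow> \<eta>"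
  using cluster_rate mean_ratio_eq by (simp add: tendsto_cong)

text \<open>
\<open>mean_ratio\<close> is the value of \<open>\<theta>\<close> at which the block sum is centered, so the term \<open>x / sqrt (c n)\<close> alone
determines the limiting mean. The limiting variance is \<open>\<nu> * \<eta>\<close> times the limit \<open>\<eta>\<^sup>2 * \<sigma>\<^sup>2 - 1\<close> of
\<open>E (1 - \<theta> Z)\<^sup>2\<close>, where \<open>E Z \<rightarrow> 1 / \<eta>\<close> and \<open>E Z\<^sup>2 \<rightarrow> \<sigma>\<^sup>2\<close>.
\<close>

lemma block_limits:
  fixes x :: real
  defines "\<theta> \<equiv> \<lambda>n. mean_ratio n + x / sqrt (c n)"
  defines "S \<equiv> \<lambda>n \<omega>. (Nh n (r n) \<omega> - \<theta> n * Nb n (r n) \<omega>) / sqrt (c n)"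
  shows "\<forall>\<^sub>F n in sequentially. integrable M (\<lambda>\<omega>. (S n \<omega>)\<^sup>2)"
    and "(\<lambda>n. k n * expectation (S n)) \<longlonglongrightarrow> - (\<nu> * x)"
    and "(\<lambda>n. k n * expectation (\<lambda>\<omega>. (S n \<omega>)\<^sup>2)) \<longlonglongrightarrow> \<nu> * \<eta> * (\<eta>\<^sup>2 * \<sigma>\<^sup>2 - 1)"
    and "\<epsilon> > 0 \<Longrightarrow> (\<lambda>n. k n * expectation (\<lambda>\<omega>. (S n \<omega>)\<^sup>2 * of_bool ((S n \<omega>)\<^sup>2 > \<epsilon>))) \<longlonglongrightarrow> 0"
proof -
  define K where "K = \<eta> + 1"
  let ?S = "\<lambda>n \<omega>. Nh n (r n) \<omega> - \<theta> n * Nb n (r n) \<omega>"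
  let ?V2 = "\<lambda>n. expectation (\<lambda>\<omega>. (csize n \<omega>)\<^sup>2)"
  let ?VL = "\<lambda>\<epsilon> n. expectation (\<lambda>\<omega>. (csize n \<omega>)\<^sup>2 * of_bool ((csize n \<omega>)\<^sup>2 > \<epsilon> * c n))"
  let ?G = "multi_moment"
  let ?m2 = "\<lambda>n. (real (k n) * real (r n) * crossing_prob n / c n) *
    (cluster_prob n / crossing_prob n - 2 * \<theta> n + (\<theta> n)\<^sup>2 * (?V2 n / cluster_prob n * (cluster_prob n / crossing_prob n)))"
  have K: "K > 0" using \<eta> by (simp add: K_def)
  have sqrt_c: "filterlim (\<lambda>n. sqrt (c n)) at_top sequentially"
    by (rule filterlim_compose[OF sqrt_at_top c_at_top])
  have \<theta>_lim: "\<theta> \<longlonglongrightarrow> \<eta>"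
  proof -
    have "(\<lambda>n. x / sqrt (c n)) \<longlonglongrightarrow> 0"
      by (rule tendsto_divide_0[OF tendsto_const filterlim_at_top_imp_at_infinity[OF sqrt_c]])
    from tendsto_add[OF mean_ratio_tendsto this] show ?thesis by (simp add: \<theta>_def)
  qed
  have \<theta>_K: "\<forall>\<^sub>F n in sequentially. \<bar>\<theta> n\<bar> \<le> K"
  proof -
    have "\<forall>\<^sub>F n in sequentially. \<bar>\<theta> n\<bar> < \<eta> + 1"
      by (rule order_tendstoD(2)[OF tendsto_rabs[OF \<theta>_lim]]) (use \<eta> in simp)
    then show ?thesis unfolding K_def by (rule eventually_mono) simp
  qed
  have alg1: "p - (p / y + x / s) * y = - (x * y / s)" if "y > 0" for p y s :: real
    using that by (simp add: distrib_right)
  have alg2: "kr * y / z * (p / y - 2 * q + q\<^sup>2 * (w / p * (p / y))) = kr / z * (p - 2 * q * y + q\<^sup>2 * w)"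
    if "y > 0" "p > 0" for kr y z p q w :: real
  proof -
    have "w / p * (p / y) = w / y" using that by simp
    then have "y * (p / y - 2 * q + q\<^sup>2 * (w / p * (p / y))) = p - 2 * q * y + q\<^sup>2 * w"
      using that by (simp add: distrib_left right_diff_distrib)
    then show ?thesis by (metis mult.assoc times_divide_eq_left)
  qed
  have alg3: "m / z * (a * g + q * (a * w)) = a * (m * g / z) + a * (m * q * p / z) * (w / p)"
    if "p > 0" for m z a g q w p :: real
    using that by (cases "z = 0") (simp_all add: field_simps)
  have S2: "(S n \<omega>)\<^sup>2 = (?S n \<omega>)\<^sup>2 / c n" if "c n > 0" for n \<omega>
    using that by (simp add: S_def power_divide)
  have moments: "\<forall>\<^sub>F n in sequentially. integrable M (\<lambda>\<omega>. (S n \<omega>)\<^sup>2) \<and>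
     k n * expectation (S n) = - (x * (real (k n) * real (r n) * crossing_prob n / c n)) \<and>
     norm (k n * expectation (\<lambda>\<omega>. (S n \<omega>)\<^sup>2) - ?m2 n)
       \<le> (1 + K)\<^sup>2 * (real (k n) * ?G n / c n)"
    using finite_runs_ev r_le square_integrable \<theta>_K c_pos crossing_prob_pos cluster_prob_pos mean_ratio_eq
  proof eventually_elim
    case (elim n)
    interpret finite_run_process M X "v n" by fact
    note bm = block_moments[OF elim(2,3,4)]
    have c0: "c n > 0" by fact
    have u0: "crossing_prob n > 0" by fact
    have p0: "cluster_prob n > 0" by fact
    have "integrable M (\<lambda>\<omega>. (S n \<omega>)\<^sup>2)"
      unfolding S2[OF c0] by (intro integrable_divide bm(1))
    moreover have "k n * expectation (S n) = - (x * (real (k n) * real (r n) * crossing_prob n / c n))"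
    proof -
      have "k n * expectation (S n) = k n * (real (r n) * (cluster_prob n - \<theta> n * crossing_prob n)) / sqrt (c n)"
        unfolding S_def integral_divide_zero bm(3) by simp
      also have "cluster_prob n - \<theta> n * crossing_prob n = - (x * crossing_prob n / sqrt (c n))"
        unfolding \<theta>_def elim(8) by (rule alg1[OF u0])
      also have "k n * (real (r n) * (- (x * crossing_prob n / sqrt (c n)))) / sqrt (c n)
        = - (x * (real (k n) * real (r n) * crossing_prob n / (sqrt (c n) * sqrt (c n))))"
        by simp
      finally show ?thesis using c0 by simp
    qed
    moreover have "norm (k n * expectation (\<lambda>\<omega>. (S n \<omega>)\<^sup>2) - ?m2 n)
       \<le> (1 + K)\<^sup>2 * (real (k n) * ?G n / c n)"
    proof -
      have "k n * expectation (\<lambda>\<omega>. (S n \<omega>)\<^sup>2) = real (k n) / c n * expectation (\<lambda>\<omega>. (?S n \<omega>)\<^sup>2)"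
        unfolding S2[OF c0] integral_divide_zero by simp
      moreover have "?m2 n
         = real (k n) / c n * (real (r n) * (cluster_prob n - 2 * \<theta> n * crossing_prob n + (\<theta> n)\<^sup>2 * ?V2 n))"
        unfolding alg2[OF u0 p0] by simp
      ultimately have "norm (k n * expectation (\<lambda>\<omega>. (S n \<omega>)\<^sup>2) - ?m2 n)
        = \<bar>real (k n) / c n * (expectation (\<lambda>\<omega>. (?S n \<omega>)\<^sup>2) - real (r n) * (cluster_prob n - 2 * \<theta> n * crossing_prob n + (\<theta> n)\<^sup>2 * ?V2 n))\<bar>"
        by (simp only: real_norm_def right_diff_distrib)
      also have "\<dots> = real (k n) / c n * \<bar>expectation (\<lambda>\<omega>. (?S n \<omega>)\<^sup>2) - real (r n) * (cluster_prob n - 2 * \<theta> n * crossing_prob n + (\<theta> n)\<^sup>2 * ?V2 n)\<bar>"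
        using c0 by (simp add: abs_mult)
      also have "\<dots> \<le> real (k n) / c n * ((1 + K)\<^sup>2 * ?G n)"
        using c0 by (intro mult_left_mono bm(4)) simp
      finally show ?thesis by (simp add: mult_ac)
    qed
    ultimately show ?case by blast
  qed
  show "\<forall>\<^sub>F n in sequentially. integrable M (\<lambda>\<omega>. (S n \<omega>)\<^sup>2)"
    using moments by (auto elim: eventually_mono)
  have "(\<lambda>n. - (x * (real (k n) * real (r n) * crossing_prob n / c n))) \<longlonglongrightarrow> - (x * \<nu>)"
    by (intro tendsto_minus tendsto_mult tendsto_const block_crossing_rate)
  moreover have "\<forall>\<^sub>F n in sequentially. k n * expectation (S n) = - (x * (real (k n) * real (r n) * crossing_prob n / c n))"
    using moments by (auto elim: eventually_mono)
  ultimately show "(\<lambda>n. k n * expectation (S n)) \<longlonglongrightarrow> - (\<nu> * x)"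
    by (simp add: tendsto_cong mult.commute)
  have G0: "(\<lambda>n. (1 + K)\<^sup>2 * (real (k n) * ?G n / c n)) \<longlonglongrightarrow> 0"
    using tendsto_mult[OF tendsto_const[of "(1 + K)\<^sup>2"] multi] by simp
  have "(\<lambda>n. k n * expectation (\<lambda>\<omega>. (S n \<omega>)\<^sup>2) - ?m2 n) \<longlonglongrightarrow> 0"
    by (rule Lim_null_comparison[OF _ G0]) (use moments in \<open>auto elim: eventually_mono\<close>)
  moreover have "(\<lambda>n. ?m2 n)
     \<longlonglongrightarrow> \<nu> * (\<eta> - 2 * \<eta> + \<eta>\<^sup>2 * (\<sigma>\<^sup>2 * \<eta>))"
    by (intro tendsto_mult tendsto_add tendsto_diff tendsto_power tendsto_const block_crossing_rate cluster_rate \<theta>_lim second_moment)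
  ultimately have "(\<lambda>n. k n * expectation (\<lambda>\<omega>. (S n \<omega>)\<^sup>2)) \<longlonglongrightarrow> \<nu> * (\<eta> - 2 * \<eta> + \<eta>\<^sup>2 * (\<sigma>\<^sup>2 * \<eta>))"
    by (rule Lim_transform[rotated])
  then show "(\<lambda>n. k n * expectation (\<lambda>\<omega>. (S n \<omega>)\<^sup>2)) \<longlonglongrightarrow> \<nu> * \<eta> * (\<eta>\<^sup>2 * \<sigma>\<^sup>2 - 1)"
    by (simp add: algebra_simps)
  assume \<epsilon>: "\<epsilon> > 0"
  define \<epsilon>' where "\<epsilon>' = \<epsilon> / (1 + K)\<^sup>2"
  have \<epsilon>': "\<epsilon>' > 0" using \<epsilon> K by (simp add: \<epsilon>'_def)
  have bound: "\<forall>\<^sub>F n in sequentially. norm (k n * expectation (\<lambda>\<omega>. (S n \<omega>)\<^sup>2 * of_bool ((S n \<omega>)\<^sup>2 > \<epsilon>)))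
     \<le> (1 + K)\<^sup>2 * (real (k n) * ?G n / c n) + (1 + K)\<^sup>2 * (real (k n) * real (r n) * cluster_prob n / c n) * (?VL \<epsilon>' n / cluster_prob n)"
    using finite_runs_ev r_le square_integrable \<theta>_K c_pos cluster_prob_pos
  proof eventually_elim
    case (elim n)
    interpret finite_run_process M X "v n" by fact
    have c0: "c n > 0" by fact
    have p0: "cluster_prob n > 0" by fact
    have big: "(S n \<omega>)\<^sup>2 > \<epsilon> \<longleftrightarrow> (?S n \<omega>)\<^sup>2 > \<epsilon> * c n" for \<omega>
      unfolding S2[OF c0] by (rule pos_less_divide_eq[OF c0])
    have big': "(1 + K)\<^sup>2 * z > \<epsilon> * c n \<longleftrightarrow> z > \<epsilon>' * c n" for z
      using K by (simp add: \<epsilon>'_def pos_divide_less_eq mult.commute)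
    have "norm (k n * expectation (\<lambda>\<omega>. (S n \<omega>)\<^sup>2 * of_bool ((S n \<omega>)\<^sup>2 > \<epsilon>)))
        = real (k n) / c n * expectation (\<lambda>\<omega>. (?S n \<omega>)\<^sup>2 * of_bool ((?S n \<omega>)\<^sup>2 > \<epsilon> * c n))"
    proof -
      have "expectation (\<lambda>\<omega>. (S n \<omega>)\<^sup>2 * of_bool ((S n \<omega>)\<^sup>2 > \<epsilon>)) = expectation (\<lambda>\<omega>. (?S n \<omega>)\<^sup>2 * of_bool ((?S n \<omega>)\<^sup>2 > \<epsilon> * c n) / c n)"
        unfolding big unfolding S2[OF c0] by (simp add: mult_ac)
      moreover have "0 \<le> expectation (\<lambda>\<omega>. (?S n \<omega>)\<^sup>2 * of_bool ((?S n \<omega>)\<^sup>2 > \<epsilon> * c n))"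
        by (rule integral_nonneg_AE) simp
      ultimately show ?thesis using c0 by (simp add: abs_mult)
    qed
    also have "\<dots> \<le> real (k n) / c n * ((1 + K)\<^sup>2 * ?G n + real (r n) * ((1 + K)\<^sup>2 * ?VL \<epsilon>' n))"
      using block_moments(5)[OF elim(2,3,4), of "\<epsilon> * c n"] c0 unfolding big'
      by (intro mult_left_mono) auto
    also have "\<dots> = (1 + K)\<^sup>2 * (real (k n) * ?G n / c n) + (1 + K)\<^sup>2 * (real (k n) * real (r n) * cluster_prob n / c n) * (?VL \<epsilon>' n / cluster_prob n)"
      by (rule alg3[OF p0])
    finally show ?case .
  qed
  have "(\<lambda>n. (1 + K)\<^sup>2 * (real (k n) * ?G n / c n) + (1 + K)\<^sup>2 * (real (k n) * real (r n) * cluster_prob n / c n) * (?VL \<epsilon>' n / cluster_prob n))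
     \<longlonglongrightarrow> 0 + (1 + K)\<^sup>2 * (\<nu> * \<eta>) * 0"
    by (intro tendsto_add G0 tendsto_mult tendsto_const block_cluster_rate large_clusters \<epsilon>')
  then show "(\<lambda>n. k n * expectation (\<lambda>\<omega>. (S n \<omega>)\<^sup>2 * of_bool ((S n \<omega>)\<^sup>2 > \<epsilon>))) \<longlonglongrightarrow> 0"
    by (intro Lim_null_comparison[OF bound]) simp
qed

theorem cluster_ratio_clt:
  fixes L :: "nat \<Rightarrow> nat"
  assumes L: "\<forall>\<^sub>F n in sequentially. 3 \<le> L n \<and> L n \<le> r n" and r: "\<forall>\<^sub>F n in sequentially. r n = n div k n"
    and err: "(\<lambda>n. real (k n) * (4 * prob {\<omega> \<in> space M. \<exists>i\<in>{1..L n}. upcrossing X (v n) i \<omega>}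
      + 2 * crossing_prob n + 8 * mixing_coeff M X (v n) n (int (L n) - 2))) \<longlonglongrightarrow> 0"
  shows "weak_conv_m (\<lambda>n. distr M borel (\<lambda>\<omega>. sqrt (c n) * (Nh n n \<omega> / Nb n n \<omega> - mean_ratio n)))
    (normal_law 0 (\<eta> / \<nu> * (\<eta>\<^sup>2 * \<sigma>\<^sup>2 - 1)))"
proof (rule ratio_weak_conv)
  let ?V = "\<eta> / \<nu> * (\<eta>\<^sup>2 * \<sigma>\<^sup>2 - 1)"
  let ?err = "\<lambda>n. real (k n) * (4 * prob {\<omega> \<in> space M. \<exists>i\<in>{1..L n}. upcrossing X (v n) i \<omega>}
      + 2 * crossing_prob n + 8 * mixing_coeff M X (v n) n (int (L n) - 2))"
  have V_eq: "\<nu>\<^sup>2 * ?V = \<nu> * \<eta> * (\<eta>\<^sup>2 * \<sigma>\<^sup>2 - 1)"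
    using \<nu> by (simp add: power2_eq_square)
  have "0 \<le> \<nu> * \<eta> * (\<eta>\<^sup>2 * \<sigma>\<^sup>2 - 1)"
    by (rule LIMSEQ_le_const[OF block_limits(3)[of 0]]) auto
  then have "0 \<le> \<nu>\<^sup>2 * ?V" unfolding V_eq .
  then show "0 \<le> ?V" using \<nu> by (metis mult_le_cancel_left_pos mult_zero_right zero_less_power)
  show "\<nu> > 0" by (rule \<nu>)
  show "filterlim c at_top sequentially" by (rule c_at_top)
  have k1: "\<forall>\<^sub>F n in sequentially. k n \<ge> 1" using k_at_top by (simp add: filterlim_at_top)
  show "weak_conv_m (\<lambda>n. distr M borel (\<lambda>\<omega>. (Nh n n \<omega> - (mean_ratio n + x / sqrt (c n)) * Nb n n \<omega>) / sqrt (c n)))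
      (normal_law (- (\<nu> * x)) (\<nu>\<^sup>2 * ?V))" for x
    unfolding V_eq
  proof (rule block_clt[OF _ _ k_at_top block_limits])
    fix t
    show "(\<lambda>n. (CLINT \<omega>|M. iexp (t * ((Nh n n \<omega> - (mean_ratio n + x / sqrt (c n)) * Nb n n \<omega>) / sqrt (c n)))) -
         (CLINT \<omega>|M. iexp (t * ((Nh n (r n) \<omega> - (mean_ratio n + x / sqrt (c n)) * Nb n (r n) \<omega>) / sqrt (c n)))) ^ k n) \<longlonglongrightarrow> 0"
    proof (rule Lim_null_comparison[OF _ err], use finite_runs_ev L r r_le k1 in eventually_elim)
      case (elim n)
      interpret finite_run_process M X "v n" by fact
      have s: "t * (z / sqrt (c n)) = t / sqrt (c n) * z" for z by simp
      show ?case unfolding s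
        by (rule char_factorization) (use elim in auto)
    qed
  qed simp_all
  show "(\<lambda>n. prob {\<omega> \<in> space M. Nb n n \<omega> = 0}) \<longlonglongrightarrow> 0"
  proof (rule Lim_null_comparison)
    show "\<forall>\<^sub>F n in sequentially. norm (prob {\<omega> \<in> space M. Nb n n \<omega> = 0})
        \<le> exp (- (real (k n) * (real (r n) * cluster_prob n - multi_moment n))) + ?err n"
      using finite_runs_ev L r r_le k1 square_integrable
    proof eventually_elim
      case (elim n)
      interpret finite_run_process M X "v n" by fact
      show ?case using prob_N_bar_zero[of "L n" "r n" "k n" n] elim by simp
    qed
    have "(\<lambda>n. exp (- (real (k n) * (real (r n) * cluster_prob n - multi_moment n)))) \<longlonglongrightarrow> 0"
      by (rule filterlim_compose[OF exp_at_bot filterlim_compose[OF filterlim_uminus_at_bot_at_top nonempty_blocks_at_top]])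
    then show "(\<lambda>n. exp (- (real (k n) * (real (r n) * cluster_prob n - multi_moment n))) + ?err n) \<longlonglongrightarrow> 0"
      using tendsto_add[OF _ err, of _ 0] by simp
  qed
qed (auto simp: Nb_nonneg)

end

section \<open>Asymptotic normality of the ratio estimator\<close>

text \<open>
A finite limit forces the extended moments to be finite from some point on, after which they are
quotients of ordinary expectations.
\<close>

lemma (in level_sequence) Z_law_moment_limit:
  fixes g :: "nat \<Rightarrow> nat \<Rightarrow> real"
  assumes g: "\<And>n. g n 0 = 0" "\<And>n z. g n z \<ge> 0" and a: "a \<ge> 0"
    and p: "\<forall>\<^sub>F n in sequentially. cluster_prob n > 0"
    and lim: "(\<lambda>n. \<integral>\<^sup>+z. ennreal (g n z) \<partial>Z_law M X (v n) 1) \<longlonglongrightarrow> ennreal a"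
  shows "\<forall>\<^sub>F n in sequentially. integrable M (\<lambda>\<omega>. g n (stationary_process.cluster_size M X (v n) 1 \<omega>))"
    and "(\<lambda>n. expectation (\<lambda>\<omega>. g n (stationary_process.cluster_size M X (v n) 1 \<omega>)) / cluster_prob n) \<longlonglongrightarrow> a"
proof -
  have "\<forall>\<^sub>F n in sequentially. (\<integral>\<^sup>+z. ennreal (g n z) \<partial>Z_law M X (v n) 1) < top"
    by (rule order_tendstoD(2)[OF lim]) simp
  then have ev: "\<forall>\<^sub>F n in sequentially. integrable M (\<lambda>\<omega>. g n (stationary_process.cluster_size M X (v n) 1 \<omega>)) \<and>
      (\<integral>\<^sup>+z. ennreal (g n z) \<partial>Z_law M X (v n) 1)
        = ennreal (expectation (\<lambda>\<omega>. g n (stationary_process.cluster_size M X (v n) 1 \<omega>)) / cluster_prob n)"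
    using p
  proof eventually_elim
    case (elim n)
    interpret stationary_process M X "v n" by (rule stationary_process_v)
    let ?I = "\<integral>\<^sup>+\<omega>. ennreal (g n (cluster_size 1 \<omega>)) \<partial>M"
    have Z: "(\<integral>\<^sup>+z. ennreal (g n z) \<partial>Z_law M X (v n) 1) = ?I / ennreal (cluster_prob n)"
      using nn_integral_Z_law[of "\<lambda>z. ennreal (g n z)"] g by (simp add: emeasure_eq_measure)
    have "?I < top"
    proof (rule ccontr)
      assume "\<not> ?I < top"
      then have "?I = top" using top.not_eq_extremum by blast
      then show False using elim(1) unfolding Z by (simp add: ennreal_top_divide)
    qed
    then have i: "integrable M (\<lambda>\<omega>. g n (cluster_size 1 \<omega>))"
      using g(2) by (intro integrableI_nonneg cluster_size_borel) auto
    then have "?I = ennreal (expectation (\<lambda>\<omega>. g n (cluster_size 1 \<omega>)))"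
      by (intro nn_integral_eq_integral) (auto simp: g)
    then have "(\<integral>\<^sup>+z. ennreal (g n z) \<partial>Z_law M X (v n) 1)
        = ennreal (expectation (\<lambda>\<omega>. g n (cluster_size 1 \<omega>)) / cluster_prob n)"
      unfolding Z using elim(2) g(2) by (simp only:) (intro divide_ennreal integral_nonneg_AE, auto)
    with i show ?case by blast
  qed
  then show "\<forall>\<^sub>F n in sequentially. integrable M (\<lambda>\<omega>. g n (stationary_process.cluster_size M X (v n) 1 \<omega>))"
    by (auto elim: eventually_mono)
  have "(\<lambda>n. ennreal (expectation (\<lambda>\<omega>. g n (stationary_process.cluster_size M X (v n) 1 \<omega>)) / cluster_prob n)) \<longlonglongrightarrow> ennreal a"
    by (rule Lim_transform_eventually[OF lim]) (use ev in \<open>auto elim: eventually_mono\<close>)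
  then show "(\<lambda>n. expectation (\<lambda>\<omega>. g n (stationary_process.cluster_size M X (v n) 1 \<omega>)) / cluster_prob n) \<longlonglongrightarrow> a"
    by (rule tendsto_ennrealD) (auto simp: a g intro!: always_eventually divide_nonneg_nonneg integral_nonneg_AE)
qed

theorem corollary4p1:
  fixes M :: "'a measure" and X :: "nat \<Rightarrow> 'a \<Rightarrow> real"
    and u :: "real \<Rightarrow> nat \<Rightarrow> real" and v c :: "nat \<Rightarrow> real"
    and k r :: "nat \<Rightarrow> nat" and l :: "nat \<Rightarrow> int"
    and \<eta> \<nu> \<sigma> :: real
  assumes prob: "prob_space M"
    and stat: "stationary M X"
    \<comment> \<open>standing assumptions\<close>
    and D3: "\<And>\<mu>. \<mu> > 0 \<Longrightarrow> D3_condition M X (u \<mu>)"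
    and finite_runs: "\<And>\<mu> n. \<mu> > 0 \<Longrightarrow> n \<ge> 1 \<Longrightarrow>
      (\<lambda>j. measure M {\<omega> \<in> space M. \<forall>i\<in>{2..j}. X (2 * i - 1) \<omega> \<le> u \<mu> n \<and> u \<mu> n < X (2 * i) \<omega>})
        \<longlonglongrightarrow> 0"
    and index: "has_upcrossings_index M X u \<eta>" and eta_pos: "\<eta> > 0"
    and mean_Z: "(\<lambda>n. \<integral>\<^sup>+z. ennreal (real z) \<partial>Z_law M X (v n) 1) \<longlonglongrightarrow> ennreal (1 / \<eta>)"
    \<comment> \<open>the sequences and levels\<close>
    and nu_pos: "\<nu> > 0"
    and c_lim: "filterlim c at_top sequentially"
    and k_pos: "\<And>n. n \<ge> 1 \<Longrightarrow> k n > 0" and k_lim: "filterlim k at_top sequentially"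
    and c_k: "(\<lambda>n. c n / real (k n)) \<longlonglongrightarrow> 0"
    and r_def: "\<And>n. r n = n div k n"
    and v_def: "\<And>n. v n = u \<nu> (nat \<lfloor>real n / c n\<rfloor>)"
    and v_levels: "(\<lambda>n. real n * measure M {\<omega> \<in> space M. X 1 \<omega> \<le> v n \<and> v n < X 2 \<omega>} - c n * \<nu>)
      \<longlonglongrightarrow> 0"
    \<comment> \<open>the hypotheses of the corollary\<close>
    and mixing: "(\<lambda>n. real (k n) * (mixing_coeff M X (v n) n (l n - 2) +
        measure M {\<omega> \<in> space M.
          upcrossing_process X (v n) n {0..real_of_int (l n) / real n} \<omega> > 0})) \<longlonglongrightarrow> 0"
    and N_bar_sq: "(\<lambda>n. (\<integral>\<^sup>+\<omega>. ennreal ((N_bar M X (v n) n (r n) \<omega>)\<^sup>2) *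
          indicator {\<omega> \<in> space M. N_hat M X (v n) n (r n) \<omega> > 1} \<omega> \<partial>M)
        / ennreal (c n / real (k n))) \<longlonglongrightarrow> 0"
    and Z_sq_uniform: "\<And>\<epsilon>::real. \<epsilon> > 0 \<Longrightarrow> \<forall>\<^sub>F n in sequentially. \<forall>j\<in>{1..r n}.
        Z_expectation_on M X (v n) j (\<lambda>z. ennreal ((real z)\<^sup>2))
          {\<omega> \<in> space M. N_hat M X (v n) n (r n) \<omega> > 1} \<le> ennreal \<epsilon>"
    and Z_sq: "(\<lambda>n. \<integral>\<^sup>+z. ennreal ((real z)\<^sup>2) \<partial>Z_law M X (v n) 1) \<longlonglongrightarrow> ennreal (\<sigma>\<^sup>2)"
    and Lindeberg: "\<And>\<epsilon>::real. \<epsilon> > 0 \<Longrightarrow>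
        (\<lambda>n. \<integral>\<^sup>+z. ennreal ((real z)\<^sup>2) * indicator {z. (real z)\<^sup>2 > \<epsilon> * c n} z \<partial>Z_law M X (v n) 1)
          \<longlonglongrightarrow> 0"
  shows "weak_conv_m
      (\<lambda>n. distr M borel (\<lambda>\<omega>. sqrt (c n) *
         (N_hat M X (v n) n n \<omega> / N_bar M X (v n) n n \<omega>
          - (\<integral>\<omega>. N_hat M X (v n) n n \<omega> \<partial>M) / (\<integral>\<omega>. N_bar M X (v n) n n \<omega> \<partial>M))))
      (normal_law 0 (\<eta> / \<nu> * (\<eta>\<^sup>2 * \<sigma>\<^sup>2 - 1)))"
proof -
  interpret prob_space M by (rule prob)
  have sp: "stationary_process M X" by unfold_locales (rule stat)
  define U where "U n = prob {\<omega> \<in> space M. upcrossing X (v n) 1 \<omega>}" for n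
  define E where "E n = prob {\<omega> \<in> space M. upcrossing_process X (v n) n {0..real_of_int (l n) / real n} \<omega> > 0}" for n
  define \<alpha> where "\<alpha> n = mixing_coeff M X (v n) n (l n - 2)" for n
  have U0: "U n \<ge> 0" and E0: "E n \<ge> 0" and \<alpha>0: "\<alpha> n \<ge> 0" for n
    by (auto simp: U_def E_def \<alpha>_def mixing_coeff_nonneg[OF prob])
  have mix: "(\<lambda>n. real (k n) * (\<alpha> n + E n)) \<longlonglongrightarrow> 0" using mixing by (simp add: \<alpha>_def E_def)
  have c_1: "\<forall>\<^sub>F n in sequentially. c n \<ge> 1"
    using c_lim by (simp add: filterlim_at_top)
  then have c_pos: "\<forall>\<^sub>F n in sequentially. c n > 0"
    by eventually_elim simp
  have n_pos: "\<forall>\<^sub>F n::nat in sequentially. n > 0" by (rule eventually_gt_at_top)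

  \<comment> \<open>this fixes the scales: with \<open>n U / c \<rightarrow> \<nu>\<close> it gives \<open>k c / n \<rightarrow> 0\<close>, hence \<open>n / c\<close> and \<open>r\<close> tend to infinity\<close>
  have kU: "(\<lambda>n. real (k n) * U n) \<longlonglongrightarrow> 0"
  proof (rule Lim_null_comparison)
    show "\<forall>\<^sub>F n in sequentially. norm (real (k n) * U n) \<le> 2 * (real (k n) * (\<alpha> n + E n))"
      using eventually_ge_at_top[of 2]
    proof eventually_elim
      case (elim n)
      interpret stationary_process M X "v n" by (rule sp)
      have "real (k n) * U n \<le> real (k n) * (2 * (\<alpha> n + E n))"
        unfolding U_def \<alpha>_def E_def by (intro mult_left_mono prob_upcrossing_le_mixing elim) simp
      then show ?case using U0[of n] by (simp add: mult_ac)
    qed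
    show "(\<lambda>n. 2 * (real (k n) * (\<alpha> n + E n))) \<longlonglongrightarrow> 0"
      using tendsto_mult[OF tendsto_const[of 2] mix] by simp
  qed
  have rate: "(\<lambda>n. real n * U n / c n) \<longlonglongrightarrow> \<nu>"
  proof -
    have "U n = prob {\<omega> \<in> space M. X 1 \<omega> \<le> v n \<and> v n < X 2 \<omega>}" for n
      by (simp add: U_def upcrossing_def numeral_2_eq_2)
    then have "(\<lambda>n. real n * U n - c n * \<nu>) \<longlonglongrightarrow> 0" using v_levels by (simp only:)
    then have "(\<lambda>n. (real n * U n - c n * \<nu>) / c n) \<longlonglongrightarrow> 0"
      by (rule tendsto_divide_0[OF _ filterlim_at_top_imp_at_infinity[OF c_lim]])
    from tendsto_add[OF this tendsto_const[of \<nu>]]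
    have "(\<lambda>n. (real n * U n - c n * \<nu>) / c n + \<nu>) \<longlonglongrightarrow> \<nu>" by simp
    moreover have "\<forall>\<^sub>F n in sequentially. (real n * U n - c n * \<nu>) / c n + \<nu> = real n * U n / c n"
      using c_pos by eventually_elim (simp add: diff_divide_distrib)
    ultimately show ?thesis by (rule Lim_transform_eventually)
  qed
  have U_pos: "\<forall>\<^sub>F n in sequentially. U n > 0"
    using order_tendstoD(1)[OF rate nu_pos] c_pos
    by eventually_elim (auto simp: zero_less_divide_iff zero_less_mult_iff)
  have kc: "(\<lambda>n. real (k n) * c n / real n) \<longlonglongrightarrow> 0"
  proof -
    have "(\<lambda>n. real (k n) * U n / (real n * U n / c n)) \<longlonglongrightarrow> 0"
      using tendsto_divide[OF kU rate] nu_pos by simp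
    moreover have "\<forall>\<^sub>F n in sequentially. real (k n) * U n / (real n * U n / c n) = real (k n) * c n / real n"
      using U_pos c_pos n_pos by eventually_elim simp
    ultimately show ?thesis by (rule Lim_transform_eventually)
  qed
  have kn: "(\<lambda>n. real (k n) / real n) \<longlonglongrightarrow> 0"
  proof (rule Lim_null_comparison[OF _ kc], use c_1 in eventually_elim)
    case (elim n)
    have "real (k n) * 1 \<le> real (k n) * c n" using elim by (intro mult_left_mono) auto
    then have "real (k n) / real n \<le> real (k n) * c n / real n" by (intro divide_right_mono) auto
    then show ?case by simp
  qed
  \<comment> \<open>runs are known to be finite at the levels \<open>u \<nu> m\<close> with \<open>m \<ge> 1\<close>, so \<open>n / c n \<ge> 1\<close> is needed\<close>
  have finite_ev: "\<forall>\<^sub>F n in sequentially. finite_run_process M X (v n)"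
    using order_tendstoD(2)[OF kc zero_less_one] c_pos n_pos
  proof eventually_elim
    case (elim n)
    have "c n \<le> real (k n) * c n" using k_pos[of n] elim by simp
    also have "\<dots> \<le> real n" using elim by (simp add: divide_less_eq)
    finally have "1 \<le> real n / c n" using elim by simp
    then have m: "nat \<lfloor>real n / c n\<rfloor> \<ge> 1" by (simp add: le_nat_iff le_floor_iff)
    show ?case
      by unfold_locales (use stat finite_runs[OF nu_pos m] in \<open>simp_all add: v_def[of n]\<close>)
  qed
  have "\<forall>\<^sub>F n in sequentially. real (k n) / real n < 1 / 10"
    by (rule order_tendstoD(2)[OF kn]) simp
  then have k_le: "\<forall>\<^sub>F n in sequentially. 10 * k n \<le> n"
    using n_pos
  proof eventually_elim
    case (elim n)
    then have "real (10 * k n) \<le> real n" by (simp add: divide_less_eq)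
    then show ?case by linarith
  qed
  have r_ge: "\<forall>\<^sub>F n in sequentially. 10 \<le> r n"
    using k_le n_pos
  proof eventually_elim
    case (elim n)
    then show ?case using k_pos[of n] by (simp add: r_def less_eq_div_iff_mult_less_eq)
  qed
  have k2: "\<forall>\<^sub>F n in sequentially. 2 \<le> k n" using k_lim by (simp add: filterlim_at_top)
  have r_le: "\<forall>\<^sub>F n in sequentially. r n \<le> n - 3"
    using k2 eventually_ge_at_top[of 6]
  proof eventually_elim
    case (elim n)
    have "r n \<le> n div 2" unfolding r_def using elim by (intro div_le_mono2) auto
    then show ?case using elim by linarith
  qed
  have block_length: "(\<lambda>n. real (k n) * real (r n) / real n) \<longlonglongrightarrow> 1"
  proof (rule Lim_transform[OF tendsto_const[of 1]], rule Lim_null_comparison[OF _ kn], use n_pos in eventually_elim)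
    case (elim n)
    have "k n * r n + n mod k n = n" by (simp add: r_def)
    then have "real n = real (k n) * real (r n) + real (n mod k n)" by (metis of_nat_add of_nat_mult)
    then have "1 - real (k n) * real (r n) / real n = real (n mod k n) / real n"
      using elim by (simp add: field_simps)
    moreover have "real (n mod k n) / real n \<le> real (k n) / real n"
      using k_pos[of n] elim by (intro divide_right_mono) (auto simp: less_imp_le)
    ultimately show ?case by (simp add: abs_minus_commute)
  qed

  interpret level_sequence M X v c k r
    by unfold_locales (use stat c_lim k_lim finite_ev in auto)
  have p_pos: "\<forall>\<^sub>F n in sequentially. cluster_prob n > 0"
  proof -
    have "\<forall>\<^sub>F n in sequentially. (\<integral>\<^sup>+z. ennreal (real z) \<partial>Z_law M X (v n) 1) < top"
      by (rule order_tendstoD(2)[OF mean_Z]) simp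
    then show ?thesis using finite_ev U_pos
    proof eventually_elim
      case (elim n)
      interpret finite_run_process M X "v n" by fact
      have "ennreal (U n) / ennreal (cluster_prob n) < top"
        using elim(1) nn_integral_Z_law[of "\<lambda>z. ennreal (real z)"] nn_integral_cluster_size
        by (simp add: emeasure_eq_measure U_def)
      then have "cluster_prob n \<noteq> 0"
        using elim(3) by (auto simp: divide_ennreal_def ennreal_mult_top)
      then show ?case by (simp add: less_le)
    qed
  qed
  have cluster_rate: "(\<lambda>n. cluster_prob n / U n) \<longlonglongrightarrow> \<eta>"
  proof -
    have "(\<lambda>n. expectation (csize n) / cluster_prob n) \<longlonglongrightarrow> 1 / \<eta>"
      by (rule Z_law_moment_limit(2)[OF _ _ _ p_pos mean_Z]) (use eta_pos in auto)
    moreover have "\<forall>\<^sub>F n in sequentially. expectation (csize n) / cluster_prob n = U n / cluster_prob n"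
      using finite_ev
    proof eventually_elim
      case (elim n)
      interpret finite_run_process M X "v n" by fact
      show ?case by (simp add: cluster_size_mean(2)[unfolded One_nat_def] U_def)
    qed
    ultimately have "(\<lambda>n. U n / cluster_prob n) \<longlonglongrightarrow> 1 / \<eta>" by (rule Lim_transform_eventually)
    from tendsto_inverse[OF this] eta_pos show ?thesis by (simp add: inverse_eq_divide)
  qed
  have sq_ev: "\<forall>\<^sub>F n in sequentially. integrable M (\<lambda>\<omega>. (csize n \<omega>)\<^sup>2)"
    and sq_lim: "(\<lambda>n. expectation (\<lambda>\<omega>. (csize n \<omega>)\<^sup>2) / cluster_prob n) \<longlonglongrightarrow> \<sigma>\<^sup>2"
    using Z_law_moment_limit[OF _ _ _ p_pos Z_sq] by auto
  have large: "(\<lambda>n. expectation (\<lambda>\<omega>. (csize n \<omega>)\<^sup>2 * of_bool ((csize n \<omega>)\<^sup>2 > \<epsilon> * c n)) / cluster_prob n) \<longlonglongrightarrow> 0"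
    if "\<epsilon> > 0" for \<epsilon>
  proof (rule Z_law_moment_limit(2)[where g="\<lambda>n z. (real z)\<^sup>2 * of_bool ((real z)\<^sup>2 > \<epsilon> * c n)", OF _ _ _ p_pos])
    have "ennreal ((real z)\<^sup>2 * of_bool ((real z)\<^sup>2 > \<epsilon> * c n))
        = ennreal ((real z)\<^sup>2) * indicator {z. (real z)\<^sup>2 > \<epsilon> * c n} z" for n z
      by (simp add: indicator_def)
    then show "(\<lambda>n. \<integral>\<^sup>+z. ennreal ((real z)\<^sup>2 * of_bool ((real z)\<^sup>2 > \<epsilon> * c n)) \<partial>Z_law M X (v n) 1) \<longlonglongrightarrow> ennreal 0"
      using Lindeberg[OF that] by simp
  qed auto
  have multi: "(\<lambda>n. real (k n) * multi_moment n / c n) \<longlonglongrightarrow> 0"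
  proof (rule tendsto_ennrealD)
    show "(\<lambda>n. ennreal (real (k n) * multi_moment n / c n)) \<longlonglongrightarrow> ennreal 0"
      unfolding ennreal_0
    proof (rule Lim_transform_eventually[OF N_bar_sq], use finite_ev r_le sq_ev c_pos k2 in eventually_elim)
      case (elim n)
      interpret finite_run_process M X "v n" by fact
      have i: "integrable M (\<lambda>\<omega>. (Nb n (r n) \<omega>)\<^sup>2 * of_bool (Nh n (r n) \<omega> > 1))"
        by (rule Bochner_Integration.integrable_bound[OF block_moments(2)[OF elim(2,3) order_refl]]) auto
      have "(\<integral>\<^sup>+\<omega>. ennreal ((Nb n (r n) \<omega>)\<^sup>2) * indicator {\<omega> \<in> space M. Nh n (r n) \<omega> > 1} \<omega> \<partial>M)
        = (\<integral>\<^sup>+\<omega>. ennreal ((Nb n (r n) \<omega>)\<^sup>2 * of_bool (Nh n (r n) \<omega> > 1)) \<partial>M)"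
        by (intro nn_integral_cong) (simp add: indicator_def)
      also have "\<dots> = ennreal (multi_moment n)"
        using i by (intro nn_integral_eq_integral) auto
      finally show ?case using elim(4,5)
        by (simp only:) (subst divide_ennreal, auto intro!: integral_nonneg_AE simp: mult.commute)
    qed
  qed (use c_pos in \<open>auto elim!: eventually_mono intro!: divide_nonneg_pos mult_nonneg_nonneg integral_nonneg_AE\<close>)

  interpret cluster_asymptotics M X v c k r \<nu> \<eta> \<sigma>
    by unfold_locales
       (use nu_pos eta_pos rate cluster_rate block_length r_le sq_ev sq_lim large multi in \<open>simp_all add: U_def\<close>)

  \<comment> \<open>the gap must be a natural number of at least 3; the enlargement costs at most \<open>10 k U\<close>\<close>
  define L where "L n = nat (max (l n) 10)" for n
  \<comment> \<open>if a gap filled a whole block, clusters would occur in too few blocks\<close>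
  have L_le: "\<forall>\<^sub>F n in sequentially. L n \<le> r n"
  proof -
    have "\<forall>\<^sub>F n in sequentially. real (k n) * (real (r n) * cluster_prob n - multi_moment n) \<ge> 1"
      using nonempty_blocks_at_top by (simp add: filterlim_at_top)
    then show ?thesis using order_tendstoD(2)[OF mix zero_less_one] finite_ev r_ge r_le sq_ev n_pos
    proof eventually_elim
      case (elim n)
      interpret finite_run_process M X "v n" by fact
      show ?case
      proof (rule ccontr)
        assume "\<not> L n \<le> r n"
        then have "int (r n) \<le> l n" using elim(4) by (auto simp: L_def)
        then have "window_prob (r n) \<le> E n"
          unfolding E_def using elim(5,7) by (intro window_prob_le_early) auto
        then have "real (r n) * cluster_prob n - multi_moment n \<le> E n"
          using prob_N_hat_pos[OF elim(5,6)] prob_N_hat_pos_le_window[of n "r n"] by linarith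
        then have "real (k n) * (real (r n) * cluster_prob n - multi_moment n) \<le> real (k n) * (\<alpha> n + E n)"
          using \<alpha>0[of n] by (intro mult_left_mono) auto
        then show False using elim(1,2) by linarith
      qed
    qed
  qed
  have "(\<lambda>n. real (k n) * (4 * prob {\<omega> \<in> space M. \<exists>i\<in>{1..L n}. upcrossing X (v n) i \<omega>}
      + 2 * crossing_prob n + 8 * mixing_coeff M X (v n) n (int (L n) - 2))) \<longlonglongrightarrow> 0"
  proof (rule Lim_null_comparison)
    show "\<forall>\<^sub>F n in sequentially. norm (real (k n) * (4 * prob {\<omega> \<in> space M. \<exists>i\<in>{1..L n}. upcrossing X (v n) i \<omega>}
      + 2 * crossing_prob n + 8 * mixing_coeff M X (v n) n (int (L n) - 2)))
      \<le> 8 * (real (k n) * (\<alpha> n + E n)) + 42 * (real (k n) * U n)"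
      using L_le r_le n_pos
    proof eventually_elim
      case (elim n)
      interpret stationary_process M X "v n" by (rule sp)
      let ?m = "mixing_coeff M X (v n) n (int (L n) - 2)"
      have w: "window_prob (L n) \<le> E n + 10 * U n"
        using window_prob_le[of n "L n" "l n" 10] elim by (simp add: L_def E_def U_def)
      have m: "?m \<le> \<alpha> n"
        unfolding \<alpha>_def L_def by (rule mixing_coeff_antimono[OF prob]) linarith
      have "0 \<le> real (k n) * (4 * window_prob (L n) + 2 * U n + 8 * ?m)"
        using U0[of n] mixing_coeff_nonneg[OF prob] by (intro mult_nonneg_nonneg add_nonneg_nonneg) auto
      moreover have "real (k n) * (4 * window_prob (L n) + 2 * U n + 8 * ?m)
          \<le> real (k n) * (8 * (\<alpha> n + E n) + 42 * U n)"
        using w m E0[of n] by (intro mult_left_mono) auto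
      ultimately show ?case by (simp add: U_def distrib_left mult_ac)
    qed
    show "(\<lambda>n. 8 * (real (k n) * (\<alpha> n + E n)) + 42 * (real (k n) * U n)) \<longlonglongrightarrow> 0"
      using tendsto_add[OF tendsto_mult[OF tendsto_const[of 8] mix] tendsto_mult[OF tendsto_const[of 42] kU]] by simp
  qed
  moreover have "\<forall>\<^sub>F n in sequentially. 3 \<le> L n \<and> L n \<le> r n"
    using L_le by eventually_elim (simp add: L_def)
  ultimately show ?thesis
    by (intro cluster_ratio_clt) (auto simp: r_def)
qed

end
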